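(* Assume the setting of the context, including $(C_1)$. Suppose that $(C_2)$, $(H_3)$, $(R')$ and $(H_2')$ hold and that the Melnikov function $$M^l_\lambda(\alpha):=\int_0^{T}\dot\psi^l_\lambda(t+\alpha)\gamma(t)\,dt$$ has a simple zero at some $\alpha=\alpha_0$. Then there exists $\rho>0$ such that for any $\varepsilon$ sufficiently small there exists a unique $\alpha^l(\varepsilon)$ ($C^1$ with respect to $\varepsilon$) such that $|\alpha^l(\varepsilon)-\alpha_0|\to0$ as $\varepsilon\to0$ and such that the equation $$\ddot\psi=f(\psi)+\varepsilon\gamma(t)\,h\Big(H^{-1}\Big(\tfrac{\dot\psi^2}{2}-F(\psi)-d\Big)\Big)$$ has a unique $p$-shift-periodic solution $\psi(t,\varepsilon)$ satisfying $$\|\psi(t,\varepsilon)-\psi^l_\lambda(t+\alpha^l(\varepsilon))\|_2\le\rho .$$ Moreover $\|\psi(t,\varepsilon)-\psi^l_\lambda(t+\alpha^l(\varepsilon))\|_2\to0$ as $\varepsilon\to0$.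
   Context: Setting: $f,h$ are $C^2$ real functions of a real variable, $\gamma:\mathbb R\to\mathbb R$ is $C^2$ and $1$-periodic, $\varepsilon\in\mathbb R$ is a small parameter, $d\in\mathbb R$ is a fixed constant, $F(\psi)=\int_0^\psi f(u)\,du$, $H(z)=\int_0^z h(u)\,du$. A function $\psi$ is called $\tau$-shift-periodic if $\psi(t+\tau)=\psi(t)+2\pi$ for all $t$. $(C_1)$: $H:I\to J$ is a diffeomorphism between open intervals $I,J\subseteq\mathbb R$, i.e. $h(z)\ne0$ for any $z\in I$; $H^{-1}:J\to I$ is its inverse. $(C_2)$: $f(\psi+2\pi)=f(\psi)$ and $F(\psi+2\pi)=F(\psi)$. $(H_3)$: the unperturbed equation $\ddot\psi=f(\psi)$ has a family of $T^l_\lambda$-shift-periodic solutions, $\psi^l_\lambda(t+T^l_\lambda)=\psi^l_\lambda(t)+2\pi$, with shift-periods $T^l_\lambda\in\mathbb R$, and $\dot\psi^l_\lambda(t)$ is the unique, up to a multiplicative constant, $T^l_\lambda$-periodic solution of the variational equation $\ddot\psi=f'(\psi^l_\lambda(t))\psi$. (The superscript $l$ is only a label.) $(R')$: for the given $\lambda$, $T^l_\lambda=p/q$ with $p,q\in\mathbb N$. Put $T:=p=qT^l_\lambda$. $(H_2')$: $c^l_\lambda-d\in J$, where $c^l_\lambda$ is the constant value (in $t$) of $\frac{(\dot\psi^l_\lambda(t))^2}{2}-F(\psi^l_\lambda(t))$. A solution of the perturbed equation is required to satisfy $\frac{\dot\psi(t)^2}{2}-F(\psi(t))-d\in J$ for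 all $t\in\mathbb R$. The norm is $\|u\|_2=\max\{\|u\|_0,\|\dot u\|_0,\|\ddot u\|_0\}$ with $\|\cdot\|_0$ the maximum (supremum) norm. A simple zero of $M^l_\lambda$ is a point $\alpha_0$ at which $M^l_\lambda$ vanishes and its derivative does not.
   Formalization: "p-shift-periodic" is read as ψ(t+p)=ψ(t)+2πq; ε=0 is excluded, since all translates solve the equation there; α(ε) is unique near α₀ only under L²-orthogonality of the deviation to the derivative of ψ_λ(·+α), as literal uniqueness of α fails. *)

theory Defs
  imports "HOL-Analysis.Analysis"
begin

definition C2 :: "(real \<Rightarrow> real) \<Rightarrow> bool" where
  "C2 f \<longleftrightarrow> f C1_differentiable_on UNIV \<and> deriv f C1_differentiable_on UNIV"

definition diffeo_on :: "(real \<Rightarrow> real) \<Rightarrow> real set \<Rightarrow> real set \<Rightarrow> bool" where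
  "diffeo_on g I J \<longleftrightarrow>
     bij_betw g I J \<and> g C1_differentiable_on I \<and> inv_into I g C1_differentiable_on J"

text \<open>The integral is oriented: for negative upper limit it is minus the integral over
  the interval from that limit to 0.\<close>

definition primitive :: "(real \<Rightarrow> real) \<Rightarrow> real \<Rightarrow> real" where
  "primitive g x = (LBINT u=0..x. g u)"

text \<open>Classical solutions, defined on the whole real line, of the scalar second order equation
  with right-hand side \<open>g t x x'\<close>.\<close>

definition solves2 :: "(real \<Rightarrow> real \<Rightarrow> real \<Rightarrow> real) \<Rightarrow> (real \<Rightarrow> real) \<Rightarrow> bool" where
  "solves2 g \<psi> \<longleftrightarrow>
     (\<forall>t. \<psi> differentiable (at t) \<and>
          (deriv \<psi> has_real_derivative g t (\<psi> t) (deriv \<psi> t)) (at t))"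

text \<open>A \<open>\<tau>\<close>-shift-periodic function is the case \<open>n = 1\<close>. The winding number \<open>n\<close> is needed
  because a \<open>\<tau>\<close>-shift-periodic function advances by \<open>2 * pi * n\<close> over the time \<open>n * \<tau>\<close>.\<close>

definition shift_periodic :: "nat \<Rightarrow> real \<Rightarrow> (real \<Rightarrow> real) \<Rightarrow> bool" where
  "shift_periodic n \<tau> \<psi> \<longleftrightarrow> (\<forall>t. \<psi> (t + \<tau>) = \<psi> t + 2 * pi * real n)"

definition periodic :: "real \<Rightarrow> (real \<Rightarrow> real) \<Rightarrow> bool" where
  "periodic \<tau> u \<longleftrightarrow> (\<forall>t. u (t + \<tau>) = u t)"

definition energy :: "(real \<Rightarrow> real) \<Rightarrow> (real \<Rightarrow> real) \<Rightarrow> real \<Rightarrow> real" where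
  "energy f \<psi> t = (deriv \<psi> t)\<^sup>2 / 2 - primitive f (\<psi> t)"

text \<open>The last conjunct says that the \<open>\<tau>\<close>-periodic solutions of the variational equation along
  \<open>\<psi>\<close> are exactly the scalar multiples of the derivative of \<open>\<psi>\<close>.\<close>

definition nondegenerate_shift_solution ::
    "(real \<Rightarrow> real) \<Rightarrow> real \<Rightarrow> (real \<Rightarrow> real) \<Rightarrow> bool" where
  "nondegenerate_shift_solution f \<tau> \<psi> \<longleftrightarrow>
     solves2 (\<lambda>t x y. f x) \<psi> \<and>
     shift_periodic 1 \<tau> \<psi> \<and>
     (\<forall>v. solves2 (\<lambda>t x y. deriv f (\<psi> t) * x) v \<and> periodic \<tau> v \<longleftrightarrow>
          (\<exists>k. v = (\<lambda>t. k * deriv \<psi> t)))"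

definition perturbed_rhs ::
    "(real \<Rightarrow> real) \<Rightarrow> (real \<Rightarrow> real) \<Rightarrow> (real \<Rightarrow> real) \<Rightarrow> real set \<Rightarrow> real \<Rightarrow> real
      \<Rightarrow> real \<Rightarrow> real \<Rightarrow> real \<Rightarrow> real" where
  "perturbed_rhs f h \<gamma> I d \<epsilon> t x y =
     f x + \<epsilon> * \<gamma> t * h (inv_into I (primitive h) (y\<^sup>2 / 2 - primitive f x - d))"

definition perturbed_solution ::
    "(real \<Rightarrow> real) \<Rightarrow> (real \<Rightarrow> real) \<Rightarrow> (real \<Rightarrow> real) \<Rightarrow> real set \<Rightarrow> real set \<Rightarrow> real \<Rightarrow> real
      \<Rightarrow> (real \<Rightarrow> real) \<Rightarrow> bool" where
  "perturbed_solution f h \<gamma> I J d \<epsilon> \<psi> \<longleftrightarrow>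
     solves2 (perturbed_rhs f h \<gamma> I d \<epsilon>) \<psi> \<and> (\<forall>t. energy f \<psi> t - d \<in> J)"

text \<open>The supremum is meaningful for bounded functions only. Below these norms are applied to
  differences of classical solutions with the same shift \<open>2 * pi * q\<close> over the same time \<open>p\<close>;
  such a difference and its first two derivatives are continuous and periodic, hence bounded.\<close>

definition norm0 :: "(real \<Rightarrow> real) \<Rightarrow> real" where
  "norm0 u = (SUP t. \<bar>u t\<bar>)"

definition norm2 :: "(real \<Rightarrow> real) \<Rightarrow> real" where
  "norm2 u = Max {norm0 u, norm0 (deriv u), norm0 (deriv (deriv u))}"

definition deviation :: "(real \<Rightarrow> real) \<Rightarrow> real \<Rightarrow> (real \<Rightarrow> real) \<Rightarrow> real \<Rightarrow> real" where
  "deviation \<psi>\<^sub>0 a \<phi> t = \<phi> t - \<psi>\<^sub>0 (t + a)"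

definition melnikov :: "(real \<Rightarrow> real) \<Rightarrow> (real \<Rightarrow> real) \<Rightarrow> real \<Rightarrow> real \<Rightarrow> real" where
  "melnikov \<psi>\<^sub>0 \<gamma> T \<alpha> = (LBINT t=0..T. deriv \<psi>\<^sub>0 (t + \<alpha>) * \<gamma> t)"

definition simple_zero :: "(real \<Rightarrow> real) \<Rightarrow> real \<Rightarrow> bool" where
  "simple_zero M a \<longleftrightarrow> M a = 0 \<and> (\<exists>D. (M has_real_derivative D) (at a) \<and> D \<noteq> 0)"

text \<open>Lyapunov-Schmidt normalization. Writing \<open>\<phi> = \<psi>\<^sub>0 (\<cdot> + a) + z\<close> determines the phase \<open>a\<close> only
  after a normalization of \<open>z\<close>: a solution close to \<open>\<psi>\<^sub>0 (\<cdot> + a)\<close> is also close to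
  \<open>\<psi>\<^sub>0 (\<cdot> + b)\<close> for all \<open>b\<close> near \<open>a\<close>. The normalization is that \<open>z\<close> is \<open>L\<^sup>2\<close>-orthogonal to
  the kernel of the self-adjoint linearization, which is spanned by the derivative of
  \<open>\<psi>\<^sub>0 (\<cdot> + a)\<close>.\<close>

definition phase_normalized :: "(real \<Rightarrow> real) \<Rightarrow> real \<Rightarrow> real \<Rightarrow> (real \<Rightarrow> real) \<Rightarrow> bool" where
  "phase_normalized \<psi>\<^sub>0 T a \<phi> \<longleftrightarrow>
     (LBINT t=0..T. deviation \<psi>\<^sub>0 a \<phi> t * deriv \<psi>\<^sub>0 (t + a)) = 0"

end

theory Submission
  imports Defs
begin

text \<open>An unperturbed shift-periodic solution rotates: its velocity never vanishes. Hence nearby solutions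
  can be parametrised by the angle \<open>x = \<psi>\<close>, and with \<open>z = H\<^sup>-\<^sup>1 (\<psi>'\<^sup>2 / 2 - F \<psi> - d)\<close> the perturbed equation becomes
  the system \<open>dt/dx = (2 (F x + d + H z)) powr (- 1 / 2)\<close>, \<open>dz/dx = \<epsilon> \<gamma> t\<close>. A solution is shift-periodic
  iff the time gained over \<open>[0, 2 \<pi> q]\<close> is \<open>p\<close> and, for \<open>\<epsilon> \<noteq> 0\<close>, the integral of \<open>\<gamma> t\<close> over
  this interval vanishes. The normalization of the phase \<open>a\<close> becomes the vanishing of the integral of
  \<open>\<psi>\<^sub>0 (t + a) - x\<close>. At \<open>\<epsilon> = 0\<close> the linearization of these three conditions is triangular: the period is
  strictly monotone in the energy, \<open>\<psi>\<^sub>0' > 0\<close> takes care of the normalization, and the last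
  diagonal entry is, up to sign, the derivative of the Melnikov function. The implicit function theorem in
  the Banach space of bounded continuous functions then gives the branch and its uniqueness.\<close>

section \<open>Oriented primitives and periodic functions\<close>

text \<open>Along a solution the energy \<open>\<psi>'\<^sup>2 / 2 - F \<psi>\<close> changes at the
  rate \<open>\<epsilon> \<gamma> h \<psi>'\<close>. The derivative \<open>1 / h\<close> of
  \<open>H\<^sup>-\<^sup>1\<close> cancels the factor \<open>h\<close>, and division by
  \<open>\<psi>'\<close> leaves \<open>\<epsilon> \<gamma> t\<close>; this is the gain of
  \<open>z\<close> over the energy. The period is strictly monotone because the derivative of
  \<open>dt/dx\<close> in \<open>z\<close> is \<open>- h z\<close> times a positive cube.
  Periodicity of \<open>z\<close> means that \<epsilon> times the integral of
  \<open>\<gamma> t\<close> vanishes, which is void at \<epsilon> = 0. The implicit function theorem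
  is applied to this condition divided by \<epsilon>, so its zeros account for all nearby solutions
  only if \<epsilon> \<noteq> 0. The normalization removes a genuine ambiguity: replacing phase
  \<open>a\<close> and time correction \<open>u\<close> by \<open>a + k\<close> and
  \<open>u + k\<close> describes the same solution. At the fixed phase
  \<open>\<alpha> \<epsilon>\<close> uniqueness holds without it: a competitor is recentred by a
  small \<open>k\<close>, and uniqueness of the normalized data forces \<open>k = 0\<close>. Data of
  class C2 give superposition operators with Lipschitz derivatives; this regularity is carried
  throughout and yields a C1 phase.\<close>

lemma primitive_has_derivative:
  assumes "continuous_on UNIV g"
  shows "(primitive g has_real_derivative g x) (at x)"
proof -
  define a where "a = min 0 x - 1"
  define b where "b = max 0 x + 1"
  have "((\<lambda>u. LBINT y=0..u. g y) has_vector_derivative g x) (at x within {a..b})"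
    using interval_integral_FTC2[of a 0 b g x] assms continuous_on_subset[OF assms]
    by (auto simp: a_def b_def zero_ereal_def)
  moreover have "at x within {a..b} = at x"
    by (rule at_within_interior) (auto simp: a_def b_def)
  ultimately show ?thesis
    by (simp add: has_real_derivative_iff_has_vector_derivative primitive_def[abs_def])
qed

lemma primitive_0 [simp]: "primitive g 0 = 0"
  by (simp add: primitive_def zero_ereal_def)

lemma primitive_eqI:
  assumes "continuous_on UNIV g" and "\<And>x. (G has_real_derivative g x) (at x)"
  shows "primitive g x = G x - G 0"
proof -
  have "((\<lambda>x. primitive g x - G x) has_real_derivative 0) (at y)" for y
    using DERIV_diff[OF primitive_has_derivative[OF assms(1)] assms(2)] by simp
  then have "primitive g x - G x = primitive g 0 - G 0"
    using DERIV_isconst_all[of "\<lambda>x. primitive g x - G x"] by blast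
  then show ?thesis by simp
qed

lemma primitive_add:
  assumes "continuous_on UNIV f" "continuous_on UNIV g"
  shows "primitive (\<lambda>x. f x + g x) y = primitive f y + primitive g y"
  using primitive_eqI[where G="\<lambda>x. primitive f x + primitive g x" and x=y,
      OF continuous_on_add[OF assms] DERIV_add[OF assms[THEN primitive_has_derivative]]] by simp

lemma primitive_diff:
  assumes "continuous_on UNIV f" "continuous_on UNIV g"
  shows "primitive (\<lambda>x. f x - g x) y = primitive f y - primitive g y"
  using primitive_eqI[where G="\<lambda>x. primitive f x - primitive g x" and x=y,
      OF continuous_on_diff[OF assms] DERIV_diff[OF assms[THEN primitive_has_derivative]]] by simp

lemma primitive_cmult:
  assumes "continuous_on UNIV f"
  shows "primitive (\<lambda>x. c * f x) y = c * primitive f y"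
  using primitive_eqI[where G="\<lambda>x. c * primitive f x" and x=y,
      OF continuous_on_mult_left[OF assms] DERIV_cmult[OF assms[THEN primitive_has_derivative]]] by simp

lemma primitive_const: "primitive (\<lambda>x. c) y = c * y"
  using primitive_eqI[of "\<lambda>x. c" "\<lambda>x. c * x" y]
  by (auto intro!: derivative_eq_intros)

lemma primitive_mean_value:
  assumes "continuous_on UNIV g" "y > 0"
  obtains \<xi> where "0 < \<xi>" "\<xi> < y" "primitive g y = y * g \<xi>"
  using MVT2[of 0 y "primitive g" g] assms primitive_has_derivative[OF assms(1)] by auto

lemma primitive_bound:
  assumes "continuous_on UNIV g" "y \<ge> 0" "\<And>x. \<bar>g x\<bar> \<le> C"
  shows "\<bar>primitive g y\<bar> \<le> C * y"
proof (cases "y = 0")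
  case False
  then obtain \<xi> where "primitive g y = y * g \<xi>"
    using primitive_mean_value assms(1,2) by (metis less_eq_real_def)
  then show ?thesis using assms(2) mult_left_mono[OF assms(3)[of \<xi>] assms(2)]
    by (simp add: abs_mult mult.commute)
qed auto

lemma continuous_primitive:
  assumes "continuous_on UNIV g" shows "continuous_on UNIV (primitive g)"
  using primitive_has_derivative[OF assms]
  by (meson DERIV_isCont continuous_at_imp_continuous_on)

lemma primitive_periodic:
  assumes "continuous_on UNIV g" "periodic L g"
  shows "primitive g (x + L) = primitive g x + primitive g L"
proof -
  have "((\<lambda>x. primitive g (x + L)) has_real_derivative g y) (at y)" for y
    using primitive_has_derivative[OF assms(1), of "y + L"] assms(2)
    by (auto simp: periodic_def DERIV_shift)
  from primitive_eqI[OF assms(1) this, of x] show ?thesis by (simp only: add_0 diff_eq_eq)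
qed

lemma primitive_substitution:
  assumes "continuous_on UNIV g" "\<And>x. (u has_real_derivative u' x) (at x)" "continuous_on UNIV u'"
  shows "primitive (\<lambda>t. g (u t) * u' t) x = primitive g (u x) - primitive g (u 0)"
proof -
  have cu: "continuous_on UNIV u"
    using assms(2) by (meson DERIV_isCont continuous_at_imp_continuous_on)
  have "continuous_on UNIV (\<lambda>t. g (u t) * u' t)"
    by (intro continuous_intros continuous_on_compose2[OF assms(1) cu] assms(3)) auto
  then show ?thesis
    by (rule primitive_eqI[where G="\<lambda>t. primitive g (u t)"])
      (rule DERIV_chain2[OF primitive_has_derivative[OF assms(1)] assms(2)])
qed

lemma periodic_of_int:
  assumes "periodic L g" shows "g (x + of_int n * L) = g x"
proof -
  have *: "g (x + of_nat m * L) = g x" for m x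
  proof (induction m)
    case (Suc m)
    have "g (x + of_nat (Suc m) * L) = g ((x + of_nat m * L) + L)"
      by (simp add: algebra_simps)
    then show ?case using Suc assms by (simp add: periodic_def)
  qed simp
  show ?thesis
  proof (cases "n \<ge> 0")
    case True then show ?thesis using *[of x "nat n"] by simp
  next
    case False then show ?thesis using *[of "x + of_int n * L" "nat (- n)"] by simp
  qed
qed

lemma periodic_continuous_range:
  fixes g :: "real \<Rightarrow> real"
  assumes "periodic L g" "L > 0" "continuous_on UNIV g"
  obtains m M where "\<And>x. g m \<le> g x" "\<And>x. g x \<le> g M"
proof -
  have red: "\<exists>y\<in>{0..L}. g y = g x" for x
  proof
    show "g (x + of_int (- \<lfloor>x / L\<rfloor>) * L) = g x" by (rule periodic_of_int[OF assms(1)])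
    have "of_int \<lfloor>x / L\<rfloor> * L \<le> x" "x \<le> (of_int \<lfloor>x / L\<rfloor> + 1) * L"
      using floor_divide_lower[OF assms(2), of x] floor_divide_upper[OF assms(2), of x] by auto
    then show "x + of_int (- \<lfloor>x / L\<rfloor>) * L \<in> {0..L}"
      by (simp add: algebra_simps)
  qed
  have c: "continuous_on {0..L} g" by (rule continuous_on_subset[OF assms(3)]) auto
  have ne: "compact {0..L}" "{0..L} \<noteq> {}" using assms(2) by auto
  obtain m where m: "\<forall>y\<in>{0..L}. g m \<le> g y"
    using continuous_attains_inf[OF ne c] by blast
  obtain M where M: "\<forall>y\<in>{0..L}. g y \<le> g M"
    using continuous_attains_sup[OF ne c] by blast
  show ?thesis
  proof
    show "g m \<le> g x" for x using m red[of x] by metis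
    show "g x \<le> g M" for x using M red[of x] by metis
  qed
qed

lemma periodic_continuous_bounded:
  fixes g :: "real \<Rightarrow> real"
  assumes "periodic L g" "L > 0" "continuous_on UNIV g"
  obtains C where "C \<ge> 0" "\<And>x. \<bar>g x\<bar> \<le> C"
proof -
  obtain m M where *: "\<And>x. g m \<le> g x" "\<And>x. g x \<le> g M"
    using periodic_continuous_range[OF assms] by blast
  show ?thesis
  proof (rule that[of "\<bar>g m\<bar> + \<bar>g M\<bar>"])
    show "\<bar>g x\<bar> \<le> \<bar>g m\<bar> + \<bar>g M\<bar>" for x using *[of x] by linarith
  qed auto
qed


section \<open>Maps with Lipschitz derivative and the implicit curve theorem\<close>

text \<open>All estimates compare two points of \<open>S\<close> with one common constant, so
  \<open>S\<close> may be a closed box and no interior point or limit enters the chain rule. The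
  quadratic remainder makes \<open>D\<close> a derivative relative to \<open>S\<close>; the last
  estimate makes it Lipschitz.\<close>

definition c11_on ::
    "'a::real_normed_vector set \<Rightarrow> ('a \<Rightarrow> 'b::real_normed_vector) \<Rightarrow> ('a \<Rightarrow> 'a \<Rightarrow> 'b) \<Rightarrow> bool" where
  "c11_on S f D \<longleftrightarrow> (\<forall>P\<in>S. bounded_linear (D P)) \<and>
     (\<exists>C\<ge>0. \<forall>P\<in>S. (\<forall>v. norm (D P v) \<le> C * norm v) \<and>
        (\<forall>Q\<in>S. norm (f Q - f P) \<le> C * norm (Q - P) \<and>
               norm (f Q - f P - D P (Q - P)) \<le> C * (norm (Q - P))\<^sup>2 \<and>
               (\<forall>v. norm (D Q v - D P v) \<le> C * norm (Q - P) * norm v)))"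

lemma c11_onI:
  assumes "\<And>P. P \<in> S \<Longrightarrow> bounded_linear (D P)" "C \<ge> 0"
    and "\<And>P v. P \<in> S \<Longrightarrow> norm (D P v) \<le> C * norm v"
    and "\<And>P Q. P \<in> S \<Longrightarrow> Q \<in> S \<Longrightarrow> norm (f Q - f P) \<le> C * norm (Q - P)"
    and "\<And>P Q. P \<in> S \<Longrightarrow> Q \<in> S \<Longrightarrow> norm (f Q - f P - D P (Q - P)) \<le> C * (norm (Q - P))\<^sup>2"
    and "\<And>P Q v. P \<in> S \<Longrightarrow> Q \<in> S \<Longrightarrow> norm (D Q v - D P v) \<le> C * norm (Q - P) * norm v"
  shows "c11_on S f D"
  using assms unfolding c11_on_def by blast

lemma c11_onE:
  assumes "c11_on S f D"
  obtains C where "C \<ge> 0" "\<And>P. P \<in> S \<Longrightarrow> bounded_linear (D P)"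
    and "\<And>P v. P \<in> S \<Longrightarrow> norm (D P v) \<le> C * norm v"
    and "\<And>P Q. P \<in> S \<Longrightarrow> Q \<in> S \<Longrightarrow> norm (f Q - f P) \<le> C * norm (Q - P)"
    and "\<And>P Q. P \<in> S \<Longrightarrow> Q \<in> S \<Longrightarrow> norm (f Q - f P - D P (Q - P)) \<le> C * (norm (Q - P))\<^sup>2"
    and "\<And>P Q v. P \<in> S \<Longrightarrow> Q \<in> S \<Longrightarrow> norm (D Q v - D P v) \<le> C * norm (Q - P) * norm v"
  using assms unfolding c11_on_def by blast

lemma c11_on_bounded_linear:
  assumes "bounded_linear T" shows "c11_on S T (\<lambda>P. T)"
proof -
  interpret T: bounded_linear T by fact
  obtain K where "K \<ge> 0" "\<And>x. norm (T x) \<le> norm x * K" using T.nonneg_bounded by blast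
  then show ?thesis
    by (intro c11_onI[where C=K]) (auto simp: T.diff[symmetric] assms mult.commute)
qed

lemma c11_on_compose:
  assumes "c11_on S f Df" "c11_on T g Dg" "f ` S \<subseteq> T"
  shows "c11_on S (\<lambda>P. g (f P)) (\<lambda>P v. Dg (f P) (Df P v))"
proof -
  obtain A where A: "A \<ge> 0" "\<And>P. P \<in> S \<Longrightarrow> bounded_linear (Df P)"
    "\<And>P v. P \<in> S \<Longrightarrow> norm (Df P v) \<le> A * norm v"
    "\<And>P Q. P \<in> S \<Longrightarrow> Q \<in> S \<Longrightarrow> norm (f Q - f P) \<le> A * norm (Q - P)"
    "\<And>P Q. P \<in> S \<Longrightarrow> Q \<in> S \<Longrightarrow> norm (f Q - f P - Df P (Q - P)) \<le> A * (norm (Q - P))\<^sup>2"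
    "\<And>P Q v. P \<in> S \<Longrightarrow> Q \<in> S \<Longrightarrow> norm (Df Q v - Df P v) \<le> A * norm (Q - P) * norm v"
    using assms(1) by (rule c11_onE) blast
  obtain B where B: "B \<ge> 0" "\<And>P. P \<in> T \<Longrightarrow> bounded_linear (Dg P)"
    "\<And>P v. P \<in> T \<Longrightarrow> norm (Dg P v) \<le> B * norm v"
    "\<And>P Q. P \<in> T \<Longrightarrow> Q \<in> T \<Longrightarrow> norm (g Q - g P) \<le> B * norm (Q - P)"
    "\<And>P Q. P \<in> T \<Longrightarrow> Q \<in> T \<Longrightarrow> norm (g Q - g P - Dg P (Q - P)) \<le> B * (norm (Q - P))\<^sup>2"
    "\<And>P Q v. P \<in> T \<Longrightarrow> Q \<in> T \<Longrightarrow> norm (Dg Q v - Dg P v) \<le> B * norm (Q - P) * norm v"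
    using assms(2) by (rule c11_onE) blast
  have fT: "f P \<in> T" if "P \<in> S" for P using assms(3) that by blast
  \<comment> \<open>\<open>B * A\<close> serves the increment and the derivative. In the Taylor
    estimate the remainder of \<open>g\<close> at the increment of \<open>f\<close> costs
    \<open>B * A\<^sup>2\<close>, and \<open>Dg\<close> applied to the remainder of \<open>f\<close>
    costs \<open>B * A\<close>; the difference of derivatives splits in the same way.\<close>
  define C where "C = B * A + (B * A\<^sup>2 + B * A)"
  have C: "C \<ge> 0" "B * A \<le> C" "B * A\<^sup>2 + B * A \<le> C"
    using A(1) B(1) by (auto simp: C_def)
  show ?thesis
  proof (rule c11_onI[where C=C])
    fix P assume P: "P \<in> S"
    show "bounded_linear (\<lambda>v. Dg (f P) (Df P v))"
      using bounded_linear_compose[OF B(2)[OF fT[OF P]] A(2)[OF P]] .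
    fix v
    have "norm (Dg (f P) (Df P v)) \<le> B * (A * norm v)"
      using B(3)[OF fT[OF P]] A(3)[OF P] B(1) by (meson mult_left_mono order_trans)
    also have "\<dots> \<le> C * norm v" using C(2) by (simp add: mult_right_mono mult.assoc[symmetric])
    finally show "norm (Dg (f P) (Df P v)) \<le> C * norm v" .
  next
    fix P Q assume PQ: "P \<in> S" "Q \<in> S"
    have "norm (g (f Q) - g (f P)) \<le> B * (A * norm (Q - P))"
      using B(4)[OF fT[OF PQ(1)] fT[OF PQ(2)]] A(4)[OF PQ] B(1) by (meson mult_left_mono order_trans)
    also have "\<dots> \<le> C * norm (Q - P)" using C(2) by (simp add: mult_right_mono mult.assoc[symmetric])
    finally show "norm (g (f Q) - g (f P)) \<le> C * norm (Q - P)" .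
    interpret Dg: bounded_linear "Dg (f P)" by (rule B(2)[OF fT[OF PQ(1)]])
    have "norm (g (f Q) - g (f P) - Dg (f P) (Df P (Q - P))) =
        norm ((g (f Q) - g (f P) - Dg (f P) (f Q - f P)) + Dg (f P) (f Q - f P - Df P (Q - P)))"
      by (simp add: Dg.diff)
    also have "\<dots> \<le> B * (norm (f Q - f P))\<^sup>2 + B * norm (f Q - f P - Df P (Q - P))"
      by (rule norm_triangle_le, rule add_mono[OF B(5)[OF fT[OF PQ(1)] fT[OF PQ(2)]] B(3)[OF fT[OF PQ(1)]]])
    also have "\<dots> \<le> B * (A * norm (Q - P))\<^sup>2 + B * (A * (norm (Q - P))\<^sup>2)"
      by (intro add_mono mult_left_mono power_mono A(4,5) PQ B(1) norm_ge_zero)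
    also have "\<dots> = (B * A\<^sup>2 + B * A) * (norm (Q - P))\<^sup>2"
      by (simp add: algebra_simps power2_eq_square)
    also have "\<dots> \<le> C * (norm (Q - P))\<^sup>2" using C(3) by (rule mult_right_mono) simp
    finally show "norm (g (f Q) - g (f P) - Dg (f P) (Df P (Q - P))) \<le> C * (norm (Q - P))\<^sup>2" .
    fix v
    have "norm (Dg (f Q) (Df Q v) - Dg (f P) (Df P v)) =
        norm ((Dg (f Q) (Df Q v) - Dg (f P) (Df Q v)) + Dg (f P) (Df Q v - Df P v))"
      by (simp add: Dg.diff)
    also have "\<dots> \<le> B * norm (f Q - f P) * norm (Df Q v) + B * norm (Df Q v - Df P v)"
      by (rule norm_triangle_le, rule add_mono[OF B(6)[OF fT[OF PQ(1)] fT[OF PQ(2)]] B(3)[OF fT[OF PQ(1)]]])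
    also have "\<dots> \<le> B * (A * norm (Q - P)) * (A * norm v) + B * (A * norm (Q - P) * norm v)"
      by (intro add_mono mult_mono mult_left_mono A(3,4,6) PQ B(1) norm_ge_zero mult_nonneg_nonneg A(1))
    also have "\<dots> = (B * A\<^sup>2 + B * A) * (norm (Q - P) * norm v)"
      by (simp add: algebra_simps power2_eq_square)
    also have "\<dots> \<le> C * (norm (Q - P) * norm v)" using C(3) by (rule mult_right_mono) simp
    finally show "norm (Dg (f Q) (Df Q v) - Dg (f P) (Df P v)) \<le> C * norm (Q - P) * norm v"
      by (simp add: mult.assoc)
  qed (rule C)
qed

lemma c11_on_linear_compose:
  assumes "bounded_linear T" "c11_on S f D"
  shows "c11_on S (\<lambda>P. T (f P)) (\<lambda>P v. T (D P v))"
  using c11_on_compose[OF assms(2) c11_on_bounded_linear[OF assms(1), of UNIV]] by simp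

lemma c11_on_Pair:
  assumes "c11_on S f Df" "c11_on S g Dg"
  shows "c11_on S (\<lambda>P. (f P, g P)) (\<lambda>P v. (Df P v, Dg P v))"
proof -
  obtain A where A: "A \<ge> 0" "\<And>P. P \<in> S \<Longrightarrow> bounded_linear (Df P)"
    "\<And>P v. P \<in> S \<Longrightarrow> norm (Df P v) \<le> A * norm v"
    "\<And>P Q. P \<in> S \<Longrightarrow> Q \<in> S \<Longrightarrow> norm (f Q - f P) \<le> A * norm (Q - P)"
    "\<And>P Q. P \<in> S \<Longrightarrow> Q \<in> S \<Longrightarrow> norm (f Q - f P - Df P (Q - P)) \<le> A * (norm (Q - P))\<^sup>2"
    "\<And>P Q v. P \<in> S \<Longrightarrow> Q \<in> S \<Longrightarrow> norm (Df Q v - Df P v) \<le> A * norm (Q - P) * norm v"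
    using assms(1) by (rule c11_onE) blast
  obtain B where B: "B \<ge> 0" "\<And>P. P \<in> S \<Longrightarrow> bounded_linear (Dg P)"
    "\<And>P v. P \<in> S \<Longrightarrow> norm (Dg P v) \<le> B * norm v"
    "\<And>P Q. P \<in> S \<Longrightarrow> Q \<in> S \<Longrightarrow> norm (g Q - g P) \<le> B * norm (Q - P)"
    "\<And>P Q. P \<in> S \<Longrightarrow> Q \<in> S \<Longrightarrow> norm (g Q - g P - Dg P (Q - P)) \<le> B * (norm (Q - P))\<^sup>2"
    "\<And>P Q v. P \<in> S \<Longrightarrow> Q \<in> S \<Longrightarrow> norm (Dg Q v - Dg P v) \<le> B * norm (Q - P) * norm v"
    using assms(2) by (rule c11_onE) blast
  have pr: "norm (x, y) \<le> (A + B) * t" if "norm x \<le> A * t" "norm y \<le> B * t"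
    for x :: 'b and y :: 'c and t
    using norm_Pair_le[of x y] that by (simp add: algebra_simps)
  show ?thesis
    by (rule c11_onI[where C="A + B"])
      (use A B in \<open>auto simp: mult.assoc intro!: pr bounded_linear_Pair\<close>)
qed

lemma c11_on_add:
  assumes "c11_on S f Df" "c11_on S g Dg"
  shows "c11_on S (\<lambda>P. f P + g P) (\<lambda>P v. Df P v + Dg P v)"
proof -
  have "bounded_linear (\<lambda>z::'b \<times> 'b. fst z + snd z)"
    by (intro bounded_linear_add bounded_linear_fst bounded_linear_snd)
  from c11_on_linear_compose[OF this c11_on_Pair[OF assms]] show ?thesis by simp
qed

text \<open>The product is bilinear, so its derivative is bounded only where both factors are;
  \<open>M\<close> cuts out such a box, and the claim is the chain rule for the pair followed by the
  product.\<close>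

lemma c11_on_scaleR:
  assumes "c11_on S e De" "c11_on S g Dg"
    and "\<And>P. P \<in> S \<Longrightarrow> \<bar>e P\<bar> \<le> M" "\<And>P. P \<in> S \<Longrightarrow> norm (g P) \<le> M" "M \<ge> 0"
  shows "c11_on S (\<lambda>P. e P *\<^sub>R g P) (\<lambda>P v. e P *\<^sub>R Dg P v + De P v *\<^sub>R g P)"
proof -
  define T :: "(real \<times> 'b) set" where "T = {z. \<bar>fst z\<bar> \<le> M \<and> norm (snd z) \<le> M}"
  have nf: "norm (fst v) \<le> norm v" "norm (snd v) \<le> norm v" for v :: "real \<times> 'b"
    by (metis norm_fst_le prod.collapse, metis norm_snd_le prod.collapse)
  have "c11_on T (\<lambda>z. fst z *\<^sub>R snd z) (\<lambda>z v. fst z *\<^sub>R snd v + fst v *\<^sub>R snd z)"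
  \<comment> \<open>\<open>2 * M\<close> serves the increment and the derivative. The summand 2
    serves the remainder, which is one product of increments, and the difference of derivatives,
    which has two such terms.\<close>
  proof (rule c11_onI[where C="2 * M + 2"])
    fix z assume z: "z \<in> T"
    show "bounded_linear (\<lambda>v. fst z *\<^sub>R snd v + fst v *\<^sub>R snd z)"
      by (intro bounded_linear_add bounded_linear_const_scaleR bounded_linear_scaleR_const
          bounded_linear_snd bounded_linear_fst)
    fix v :: "real \<times> 'b"
    have "norm (fst z *\<^sub>R snd v + fst v *\<^sub>R snd z) \<le> \<bar>fst z\<bar> * norm (snd v) + \<bar>fst v\<bar> * norm (snd z)"
      by (metis norm_scaleR norm_triangle_ineq)
    also have "\<dots> \<le> M * norm v + norm v * M"
      by (intro add_mono mult_mono) (use z nf[of v] assms(5) in \<open>auto simp: T_def\<close>)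
    also have "\<dots> \<le> (2 * M + 2) * norm v" by (simp add: algebra_simps)
    finally show "norm (fst z *\<^sub>R snd v + fst v *\<^sub>R snd z) \<le> (2 * M + 2) * norm v" .
  next
    fix z y assume zy: "z \<in> T" "y \<in> T"
    have "norm (fst y *\<^sub>R snd y - fst z *\<^sub>R snd z) = norm (fst y *\<^sub>R snd (y - z) + fst (y - z) *\<^sub>R snd z)"
      by (simp add: algebra_simps)
    also have "\<dots> \<le> \<bar>fst y\<bar> * norm (snd (y - z)) + \<bar>fst (y - z)\<bar> * norm (snd z)"
      by (metis norm_scaleR norm_triangle_ineq)
    also have "\<dots> \<le> M * norm (y - z) + norm (y - z) * M"
      by (intro add_mono mult_mono) (use zy nf[of "y - z"] assms(5) in \<open>auto simp: T_def\<close>)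
    also have "\<dots> \<le> (2 * M + 2) * norm (y - z)" by (simp add: algebra_simps)
    finally show "norm (fst y *\<^sub>R snd y - fst z *\<^sub>R snd z) \<le> (2 * M + 2) * norm (y - z)" .
    have "norm (fst y *\<^sub>R snd y - fst z *\<^sub>R snd z - (fst z *\<^sub>R snd (y - z) + fst (y - z) *\<^sub>R snd z)) =
        norm (fst (y - z) *\<^sub>R snd (y - z))"
      by (simp add: algebra_simps)
    also have "\<dots> \<le> norm (y - z) * norm (y - z)"
      unfolding norm_scaleR by (intro mult_mono) (use nf[of "y - z"] in auto)
    also have "\<dots> \<le> (2 * M + 2) * (norm (y - z))\<^sup>2"
      using assms(5) by (simp add: power2_eq_square[symmetric] mult_le_cancel_right1)
    finally show "norm (fst y *\<^sub>R snd y - fst z *\<^sub>R snd z - (fst z *\<^sub>R snd (y - z) + fst (y - z) *\<^sub>R snd z))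
        \<le> (2 * M + 2) * (norm (y - z))\<^sup>2" .
    fix v :: "real \<times> 'b"
    have "norm (fst y *\<^sub>R snd v + fst v *\<^sub>R snd y - (fst z *\<^sub>R snd v + fst v *\<^sub>R snd z)) =
        norm (fst (y - z) *\<^sub>R snd v + fst v *\<^sub>R snd (y - z))"
      by (simp add: algebra_simps)
    also have "\<dots> \<le> \<bar>fst (y - z)\<bar> * norm (snd v) + \<bar>fst v\<bar> * norm (snd (y - z))"
      by (metis norm_scaleR norm_triangle_ineq)
    also have "\<dots> \<le> norm (y - z) * norm v + norm v * norm (y - z)"
      by (intro add_mono mult_mono) (use nf[of "y - z"] nf[of v] in auto)
    also have "\<dots> \<le> (2 * M + 2) * norm (y - z) * norm v"
      using assms(5) by (simp add: algebra_simps)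
    finally show "norm (fst y *\<^sub>R snd v + fst v *\<^sub>R snd y - (fst z *\<^sub>R snd v + fst v *\<^sub>R snd z))
        \<le> (2 * M + 2) * norm (y - z) * norm v" .
  qed (use assms(5) in auto)
  from c11_on_compose[OF c11_on_Pair[OF assms(1,2)] this] assms(3,4)
  show ?thesis by (auto simp: T_def image_subset_iff)
qed

text \<open>\<open>B\<close> plays the inverse of the partial derivative in the second variable at
  the origin: a bounded left inverse with trivial kernel. Zeros of \<open>F (s, Y)\<close> are thus
  the fixed points of \<open>Y - B (F (s, Y))\<close>, a contraction with factor 1/2 on a small
  ball, and the Lipschitz derivative makes the fixed point continuously differentiable in
  \<open>s\<close>.\<close>

theorem implicit_curve:
  fixes F :: "real \<times> 'a::banach \<Rightarrow> 'a"
  assumes c11: "c11_on {P. \<bar>fst P\<bar> \<le> R \<and> norm (snd P) \<le> R} F D" and R: "R > 0"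
    and F0: "F 0 = 0"
    and B: "bounded_linear B" "\<And>v. B (D 0 (0, v)) = v" "\<And>y. B y = 0 \<Longrightarrow> y = 0"
  obtains r e X X' where "0 < r" "r \<le> R" "0 < e" "e \<le> R" "X 0 = 0"
    and "\<And>s. \<bar>s\<bar> < e \<Longrightarrow> norm (X s) \<le> r \<and> F (s, X s) = 0"
    and "\<And>s Y. \<bar>s\<bar> < e \<Longrightarrow> norm Y \<le> r \<Longrightarrow> F (s, Y) = 0 \<Longrightarrow> Y = X s"
    and "\<And>s. \<bar>s\<bar> < e \<Longrightarrow> (X has_vector_derivative X' s) (at s)"
    and "continuous_on {-e<..<e} X'"
proof -
  let ?S = "{P::real \<times> 'a. \<bar>fst P\<bar> \<le> R \<and> norm (snd P) \<le> R}"
  obtain C0 where C0: "C0 \<ge> 0" "\<And>P. P \<in> ?S \<Longrightarrow> bounded_linear (D P)"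
    "\<And>P v. P \<in> ?S \<Longrightarrow> norm (D P v) \<le> C0 * norm v"
    "\<And>P Q. P \<in> ?S \<Longrightarrow> Q \<in> ?S \<Longrightarrow> norm (F Q - F P) \<le> C0 * norm (Q - P)"
    "\<And>P Q. P \<in> ?S \<Longrightarrow> Q \<in> ?S \<Longrightarrow> norm (F Q - F P - D P (Q - P)) \<le> C0 * (norm (Q - P))\<^sup>2"
    "\<And>P Q v. P \<in> ?S \<Longrightarrow> Q \<in> ?S \<Longrightarrow> norm (D Q v - D P v) \<le> C0 * norm (Q - P) * norm v"
    using c11 by (rule c11_onE) blast
  interpret B: bounded_linear B by fact
  obtain K where K: "K \<ge> 0" "\<And>x. norm (B x) \<le> norm x * K" using B.nonneg_bounded by blast
  \<comment> \<open>\<open>K * C0\<close> bounds every estimate on \<open>F\<close> and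
    \<open>D\<close> after \<open>B\<close> has been applied; the summand 1 makes the constant
    positive, so that it can be divided by.\<close>
  define C where "C = K * C0 + 1"
  have C: "C > 0" using K(1) C0(1) by (simp add: C_def add_nonneg_pos)
  have BC: "norm (B x) \<le> C * t" if "norm x \<le> C0 * t" "t \<ge> 0" for x t
  proof -
    have "norm (B x) \<le> (C0 * t) * K"
      using K(2)[of x] that(1) K(1) by (meson mult_right_mono order_trans)
    also have "\<dots> \<le> C * t" using that(2) by (simp add: C_def algebra_simps)
    finally show ?thesis .
  qed
  have BD: "norm (B (D P v)) \<le> C * norm v" if "P \<in> ?S" for P v
    by (rule BC) (use C0(3) that in auto)
  have BF: "norm (B (F Q - F P)) \<le> C * norm (Q - P)" if "P \<in> ?S" "Q \<in> ?S" for P Q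
    by (rule BC) (use C0(4)[OF that] in auto)
  have BT: "norm (B (F Q - F P - D P (Q - P))) \<le> C * (norm (Q - P))\<^sup>2" if "P \<in> ?S" "Q \<in> ?S" for P Q
    by (rule BC) (use C0(5)[OF that] in auto)
  have BDD: "norm (B (D Q v - D P v)) \<le> C * (norm (Q - P) * norm v)" if "P \<in> ?S" "Q \<in> ?S" for P Q v
    by (rule BC) (use C0(6)[OF that] in \<open>auto simp: mult.assoc\<close>)
  have S0: "0 \<in> ?S" using R by simp
  \<comment> \<open>Points of the box have norm at most \<open>2 * r\<close>, so
    \<open>C * r \<le> 1 / 8\<close> makes both the change of the derivative and the quadratic
    remainder at most a quarter of the increment; together they give the factor 1/2.
    \<open>e\<close> keeps the image of 0 within \<open>r / 2\<close>, so the ball is mapped into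
    itself.\<close>
  define r where "r = min R (1 / (8 * C))"
  define e where "e = min r (r / (2 * C))"
  have r: "0 < r" "r \<le> R" "C * r \<le> 1 / 8"
    using R C by (auto simp: r_def min_def field_simps)
  have e: "0 < e" "e \<le> r" "C * e \<le> r / 2"
    using r C by (auto simp: e_def min_def field_simps)
  have inS: "(s, Y) \<in> ?S" if "\<bar>s\<bar> < e" "norm Y \<le> r" for s Y
    using that e r by auto
  have nrm: "norm (s, Y) \<le> 2 * r" if "\<bar>s\<bar> < e" "norm Y \<le> r" for s :: real and Y :: 'a
    using norm_Pair_le[of s Y] that e by simp
  have near_id: "norm (Z - B (D (s, Y) (0, Z))) \<le> norm Z / 4"
    if "\<bar>s\<bar> < e" "norm Y \<le> r" for s Y Z
  proof -
    interpret D: bounded_linear "D (s, Y)" by (rule C0(2)[OF inS[OF that]])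
    have "Z - B (D (s, Y) (0, Z)) = - B (D (s, Y) (0, Z) - D 0 (0, Z))"
      using B(2)[of Z] by (simp add: B.diff)
    then have "norm (Z - B (D (s, Y) (0, Z))) \<le> C * (norm ((s, Y) - 0) * norm (0::real, Z))"
      using BDD[OF S0 inS[OF that], of "(0, Z)"] by (simp only: norm_minus_cancel)
    also have "\<dots> \<le> C * ((2 * r) * norm Z)"
      using nrm[OF that] C r by (intro mult_left_mono mult_mono) (auto simp: norm_Pair)
    also have "\<dots> = 2 * (C * r) * norm Z" by simp
    also have "\<dots> \<le> 2 * (1 / 8) * norm Z" by (intro mult_mono r) (use r C in auto)
    finally show ?thesis by simp
  qed
  have bound_inv: "norm Z \<le> 2 * norm (B (D (s, Y) (0, Z)))"
    if "\<bar>s\<bar> < e" "norm Y \<le> r" for s Y Z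
    using near_id[OF that, of Z] norm_triangle_ineq2[of Z "B (D (s, Y) (0, Z))"]
      norm_ge_zero[of "B (D (s, Y) (0, Z))"] by linarith
  define T where "T s Y = Y - B (F (s, Y))" for s Y
  have contr: "norm (T s Z - T s Y) \<le> 1 / 2 * norm (Z - Y)"
    if "\<bar>s\<bar> < e" "norm Y \<le> r" "norm Z \<le> r" for s Y Z
  proof -
    have eq: "T s Z - T s Y = ((Z - Y) - B (D (s, Y) (0, Z - Y))) - B (F (s, Z) - F (s, Y) - D (s, Y) ((s, Z) - (s, Y)))"
      by (simp add: T_def B.diff)
    have "norm (T s Z - T s Y) \<le> norm (Z - Y) / 4 + C * (norm ((s, Z) - (s, Y)))\<^sup>2"
      unfolding eq
      by (rule norm_triangle_le_diff[OF add_mono[OF near_id[OF that(1,2)]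
            BT[OF inS[OF that(1,2)] inS[OF that(1,3)]]]])
    also have "C * (norm ((s, Z) - (s, Y)))\<^sup>2 = C * norm (Z - Y) * norm (Z - Y)"
      by (simp add: norm_Pair power2_eq_square)
    also have "\<dots> \<le> C * (2 * r) * norm (Z - Y)"
      using norm_triangle_ineq4[of Z Y] that(2,3) C by (intro mult_right_mono mult_left_mono) auto
    also have "\<dots> = 2 * (C * r) * norm (Z - Y)" by simp
    also have "\<dots> \<le> 2 * (1 / 8) * norm (Z - Y)" by (intro mult_mono r) (use r C in auto)
    finally show ?thesis by simp
  qed
  have ex1: "\<exists>!Y. norm Y \<le> r \<and> F (s, Y) = 0" if s: "\<bar>s\<bar> < e" for s
  proof -
    have "\<exists>!Y\<in>cball 0 r. T s Y = Y"
    proof (rule Banach_fix[of "cball 0 r" "1/2" "T s"])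
      have "norm (T s 0) \<le> r / 2"
      proof -
        have "norm (T s 0) = norm (B (F (s, 0) - F 0))" by (simp add: T_def F0)
        also have "\<dots> \<le> C * norm ((s, 0::'a) - 0)" by (rule BF[OF S0 inS]) (use s r in auto)
        also have "\<dots> = C * \<bar>s\<bar>" by (simp add: norm_Pair)
        also have "\<dots> \<le> C * e" using s C by simp
        finally show ?thesis using e by simp
      qed
      then show "T s ` cball 0 r \<subseteq> cball 0 r"
      proof (safe, goal_cases)
        case (1 _ Y)
        then have "norm (T s Y - T s 0) \<le> r / 2"
          using contr[OF s, of 0 Y] r by auto
        then show ?case using 1 norm_triangle_ineq2[of "T s Y" "T s 0"] by simp
      qed
      show "dist (T s Y) (T s Z) \<le> 1 / 2 * dist Y Z" if "Y \<in> cball 0 r" "Z \<in> cball 0 r" for Y Z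
        using contr[OF s, of Z Y] that by (auto simp: dist_norm)
    qed (use r in \<open>auto simp: complete_eq_closed\<close>)
    moreover have "T s Y = Y \<longleftrightarrow> F (s, Y) = 0" for Y
      using B(3) by (auto simp: T_def)
    ultimately show ?thesis by (auto simp: Bex_def)
  qed
  define X where "X s = (THE Y. norm Y \<le> r \<and> F (s, Y) = 0)" for s
  have X: "norm (X s) \<le> r" "F (s, X s) = 0" if "\<bar>s\<bar> < e" for s
    using theI'[OF ex1[OF that]] by (auto simp: X_def)
  have uniq: "Y = X s" if "\<bar>s\<bar> < e" "norm Y \<le> r" "F (s, Y) = 0" for s Y
    using ex1[OF that(1)] X[OF that(1)] that by blast
  have X0: "X 0 = 0" using uniq[of 0 0] e r F0 by (simp add: zero_prod_def)
  \<comment> \<open>Comparison of two fixed points: at the parameter \<open>s\<close> the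
    contraction halves their distance, and the change of parameter costs at most \<open>C\<close>
    times the distance of the parameters.\<close>
  have lip: "norm (X s - X t) \<le> 2 * C * \<bar>s - t\<bar>" if "\<bar>s\<bar> < e" "\<bar>t\<bar> < e" for s t
  proof -
    have eq: "X s - X t = (T s (X s) - T s (X t)) + (T s (X t) - T t (X t))"
      using X[OF that(1)] X[OF that(2)] by (simp add: T_def)
    have "norm (T s (X t) - T t (X t)) \<le> C * \<bar>s - t\<bar>"
      using BF[OF inS[OF that(1) X(1)[OF that(2)]] inS[OF that(2) X(1)[OF that(2)]]]
      by (simp add: T_def B.diff norm_Pair norm_minus_commute abs_minus_commute)
    moreover have "norm (T s (X s) - T s (X t)) \<le> 1 / 2 * norm (X s - X t)"
      by (rule contr) (use that X in auto)
    ultimately have "norm (X s - X t) \<le> 1 / 2 * norm (X s - X t) + C * \<bar>s - t\<bar>"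
      by (subst eq) (rule norm_triangle_le, linarith)
    then show ?thesis by simp
  qed
  have dP: "norm ((s, X s) - (t, X t)) \<le> (2 * C + 1) * \<bar>s - t\<bar>" if "\<bar>s\<bar> < e" "\<bar>t\<bar> < e" for s t
    using norm_Pair_le[of "s - t" "X s - X t"] lip[OF that] by (simp add: algebra_simps)
  \<comment> \<open>\<open>Q\<close> is the candidate for the derivative of the branch: it solves
    the equation differentiated along \<open>(s, X s)\<close>. It is again a fixed point, now of an
    affine map with factor 1/4 by \<open>near_id\<close>.\<close>
  have exQ: "\<exists>Q. B (D (s, X s) (1, Q)) = 0" if s: "\<bar>s\<bar> < e" for s
  proof -
    interpret D: bounded_linear "D (s, X s)" by (rule C0(2)[OF inS[OF s X(1)[OF s]]])
    define G where "G Q = Q - B (D (s, X s) (1, Q))" for Q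
    have "\<exists>!Q\<in>UNIV. G Q = Q"
    proof (rule Banach_fix[of UNIV "1/4"])
      show "dist (G Y) (G Z) \<le> 1 / 4 * dist Y Z" for Y Z
      proof -
        have "G Y - G Z = (Y - Z) - B (D (s, X s) ((1, Y) - (1, Z)))"
          unfolding G_def D.diff B.diff by simp
        then show ?thesis using near_id[OF s X(1)[OF s], of "Y - Z"] by (simp add: dist_norm)
      qed
    qed (auto simp: complete_UNIV)
    then show ?thesis by (auto simp: G_def)
  qed
  define X' where "X' s = (SOME Q. B (D (s, X s) (1, Q)) = 0)" for s
  have X': "B (D (s, X s) (1, X' s)) = 0" if "\<bar>s\<bar> < e" for s
    unfolding X'_def by (rule someI_ex[OF exQ[OF that]])
  have quad: "norm (X t - X s - (t - s) *\<^sub>R X' s) \<le> 2 * C * (2 * C + 1)\<^sup>2 * \<bar>t - s\<bar>\<^sup>2"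
    if s: "\<bar>s\<bar> < e" and t: "\<bar>t\<bar> < e" for s t
  proof -
    interpret D: bounded_linear "D (s, X s)" by (rule C0(2)[OF inS[OF s X(1)[OF s]]])
    let ?Z = "X t - X s - (t - s) *\<^sub>R X' s"
    \<comment> \<open>\<open>B\<close> composed with the derivative kills \<open>(1, X' s)\<close>,
      so only the increment remains. As \<open>F\<close> vanishes at both ends, this is minus the
      Taylor remainder, and \<open>bound_inv\<close> turns its bound into one for
      \<open>?Z\<close>.\<close>
    have eq: "(0, ?Z) = ((t, X t) - (s, X s)) - (t - s) *\<^sub>R (1, X' s)" by simp
    have "B (D (s, X s) (0, ?Z)) = B (D (s, X s) ((t, X t) - (s, X s)))"
      unfolding eq D.diff D.scaleR B.diff B.scaleR using X'[OF s] by simp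
    also have "\<dots> = - B (F (t, X t) - F (s, X s) - D (s, X s) ((t, X t) - (s, X s)))"
      using X(2)[OF s] X(2)[OF t] by (simp add: B.diff B.zero B.neg)
    finally have "norm (B (D (s, X s) (0, ?Z))) \<le> C * (norm ((t, X t) - (s, X s)))\<^sup>2"
      using BT[OF inS[OF s X(1)[OF s]] inS[OF t X(1)[OF t]]] by (simp only: norm_minus_cancel)
    also have "\<dots> \<le> C * ((2 * C + 1) * \<bar>t - s\<bar>)\<^sup>2"
      using dP[OF t s] C by (intro mult_left_mono power_mono) auto
    finally show ?thesis
      using bound_inv[OF s X(1)[OF s], of ?Z] by (simp add: power_mult_distrib)
  qed
  have deriv: "(X has_vector_derivative X' s) (at s)" if s: "\<bar>s\<bar> < e" for s
    unfolding has_vector_derivative_def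
  proof (rule has_derivativeI_sandwich[of "e - \<bar>s\<bar>" _ _ _ _ "\<lambda>t. 2 * C * (2 * C + 1)\<^sup>2 * \<bar>t - s\<bar>"])
    show "bounded_linear (\<lambda>x. x *\<^sub>R X' s)" by (rule bounded_linear_scaleR_left)
    show "((\<lambda>t. 2 * C * (2 * C + 1)\<^sup>2 * \<bar>t - s\<bar>) \<longlongrightarrow> 0) (at s)"
      by (auto intro!: tendsto_eq_intros)
    fix t assume t: "t \<in> UNIV" "t \<noteq> s" "dist t s < e - \<bar>s\<bar>"
    then have "\<bar>t\<bar> < e" by (simp add: dist_real_def)
    from quad[OF s this] t(2)
    show "norm (X t - X s - (t - s) *\<^sub>R X' s) / norm (t - s) \<le> 2 * C * (2 * C + 1)\<^sup>2 * \<bar>t - s\<bar>"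
      by (simp add: divide_le_eq power2_eq_square)
  qed (use s in auto)
  \<comment> \<open>The constant contains \<open>X' s\<close> and so depends on \<open>s\<close>;
    for fixed \<open>s\<close> this still gives continuity there.\<close>
  have X'lip: "norm (X' t - X' s) \<le> (2 * C * (2 * C + 1) * norm (1::real, X' s)) * \<bar>t - s\<bar>"
    if s: "\<bar>s\<bar> < e" and t: "\<bar>t\<bar> < e" for s t
  proof -
    interpret D: bounded_linear "D (t, X t)" by (rule C0(2)[OF inS[OF t X(1)[OF t]]])
    have eq: "(0, X' t - X' s) = (1::real, X' t) - (1, X' s)" by simp
    have "B (D (t, X t) (0, X' t - X' s)) = - B (D (t, X t) (1, X' s) - D (s, X s) (1, X' s))"
      unfolding eq D.diff B.diff using X'[OF s] X'[OF t] by simp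
    then have "norm (B (D (t, X t) (0, X' t - X' s))) \<le> C * (norm ((t, X t) - (s, X s)) * norm (1::real, X' s))"
      using BDD[OF inS[OF s X(1)[OF s]] inS[OF t X(1)[OF t]], of "(1, X' s)"] by (simp only: norm_minus_cancel)
    also have "\<dots> \<le> C * (((2 * C + 1) * \<bar>t - s\<bar>) * norm (1::real, X' s))"
      using dP[OF t s] C by (intro mult_left_mono mult_right_mono) auto
    finally have "norm (X' t - X' s) \<le> 2 * (C * (((2 * C + 1) * \<bar>t - s\<bar>) * norm (1::real, X' s)))"
      using bound_inv[OF t X(1)[OF t], of "X' t - X' s"] by linarith
    then show ?thesis by (simp only: mult_ac)
  qed
  have cont: "continuous_on {-e<..<e} X'"
    unfolding continuous_on_def
  proof
    fix s assume s: "s \<in> {-e<..<e}"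
    then have s': "\<bar>s\<bar> < e" by auto
    show "(X' \<longlongrightarrow> X' s) (at s within {-e<..<e})"
    proof (rule Lim_null[THEN iffD2], rule Lim_null_comparison)
      show "((\<lambda>t. (2 * C * (2 * C + 1) * norm (1::real, X' s)) * \<bar>t - s\<bar>) \<longlongrightarrow> 0) (at s within {-e<..<e})"
        by (auto intro!: tendsto_eq_intros)
      show "\<forall>\<^sub>F t in at s within {-e<..<e}. norm (X' t - X' s) \<le> (2 * C * (2 * C + 1) * norm (1::real, X' s)) * \<bar>t - s\<bar>"
        unfolding eventually_at_filter by (intro always_eventually allI impI X'lip s') auto
    qed
  qed
  show ?thesis
    by (rule that[of r e X X']) (use r e X0 X uniq deriv cont in auto)
qed


section \<open>Superposition and integral operators on bounded continuous functions\<close>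

instance bcontfun :: (metric_space, banach) banach ..

lemma bcontfun_real_bound: "\<bar>apply_bcontfun (u :: real \<Rightarrow>\<^sub>C real) x\<bar> \<le> norm u"
  using norm_bounded[of u x] by simp

lemma apply_Bcontfun_real:
  fixes w :: "real \<Rightarrow> real"
  assumes "continuous_on UNIV w" "\<And>x. \<bar>w x\<bar> \<le> C"
  shows "apply_bcontfun (Bcontfun w) = w"
  using bcontfun_normI[of w C] assms by (simp add: Bcontfun_inverse)

lemma bounded_linear_const_bcontfun: "bounded_linear (\<lambda>c. const_bcontfun c :: real \<Rightarrow>\<^sub>C real)"
proof (rule bounded_linear_intro[where K=1])
  show "norm (const_bcontfun c :: real \<Rightarrow>\<^sub>C real) \<le> norm c * 1" for c :: real
    by (rule norm_bound) simp
qed (auto intro!: bcontfun_eqI)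

lemma bounded_linear_eval_bcontfun: "bounded_linear (\<lambda>u :: real \<Rightarrow>\<^sub>C real. apply_bcontfun u x)"
  by (rule bounded_linear_intro[where K=1]) (auto simp: bcontfun_real_bound)

lemma primitive_bcontfun_bound:
  fixes u :: "real \<Rightarrow>\<^sub>C real"
  assumes "y \<ge> 0" shows "\<bar>primitive (apply_bcontfun u) y\<bar> \<le> norm u * y"
  by (rule primitive_bound[OF continuous_on_apply_bcontfun assms bcontfun_real_bound])

lemma bounded_linear_primitive_bcontfun:
  assumes "L \<ge> 0"
  shows "bounded_linear (\<lambda>u :: real \<Rightarrow>\<^sub>C real. primitive (apply_bcontfun u) L)"
proof (rule bounded_linear_intro[where K=L])
  fix u v :: "real \<Rightarrow>\<^sub>C real" and c :: real
  show "primitive (apply_bcontfun (u + v)) L = primitive (apply_bcontfun u) L + primitive (apply_bcontfun v) L"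
    using primitive_add[of "apply_bcontfun u" "apply_bcontfun v" L]
    by simp
  show "primitive (apply_bcontfun (c *\<^sub>R u)) L = c *\<^sub>R primitive (apply_bcontfun u) L"
    using primitive_cmult[of "apply_bcontfun u" c L] by simp
  show "norm (primitive (apply_bcontfun u) L) \<le> norm u * L"
    using primitive_bcontfun_bound[OF assms, of u] by simp
qed

section \<open>Integration followed by periodic folding\<close>

lemma continuous_on_fold:
  fixes W :: "real \<Rightarrow> real"
  assumes W: "continuous_on UNIV W" "W 0 = W L" and L: "L > 0"
  shows "continuous_on UNIV (\<lambda>x. W (x - L * of_int \<lfloor>x / L\<rfloor>))"
proof (rule continuous_at_imp_continuous_on, rule ballI)
  fix x :: real
  define n where "n = \<lfloor>x / L\<rfloor>"
  \<comment> \<open>The cell of \<open>x\<close> is \<open>[b, c)\<close>. Since \<open>x\<close>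
    may be its left end \<open>b\<close>, the preceding cell \<open>[a, b]\<close> is joined to it;
    the two pieces agree at \<open>b\<close> because \<open>W 0 = W L\<close>.\<close>
  define a b c where "a = L * (of_int n - 1)" and "b = L * of_int n" and "c = L * (of_int n + 1)"
  have ab: "b = a + L" "c = b + L" by (auto simp: a_def b_def c_def algebra_simps)
  have x: "b \<le> x" "x < c"
    using floor_divide_lower[OF L, of x] floor_divide_upper[OF L, of x]
    by (auto simp: n_def b_def c_def mult.commute)
  have fl: "\<lfloor>y / L\<rfloor> = m" if "L * of_int m \<le> y" "y < L * (of_int m + 1)" for y m
    using that L by (intro floor_unique) (auto simp: field_simps)
  have "continuous_on ({a..b} \<union> {b..c}) (\<lambda>y. if y \<le> b then W (y - a) else W (y - b))"
    by (rule continuous_on_If)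
      (auto intro!: continuous_on_compose2[OF W(1)] continuous_intros simp: W(2) ab)
  then have "continuous_on {a<..<c} (\<lambda>y. if y \<le> b then W (y - a) else W (y - b))"
    by (rule continuous_on_subset) (use ab L in auto)
  moreover have "(if y \<le> b then W (y - a) else W (y - b)) = W (y - L * of_int \<lfloor>y / L\<rfloor>)"
    if "y \<in> {a<..<c}" for y
  proof (cases "y < b")
    case True
    then have "\<lfloor>y / L\<rfloor> = n - 1" using that
      by (intro fl) (auto simp: a_def b_def algebra_simps)
    then show ?thesis using True by (simp add: a_def)
  next
    case False
    then have "\<lfloor>y / L\<rfloor> = n" using that
      by (intro fl) (auto simp: c_def b_def)
    then show ?thesis using False W(2) ab by (auto simp: b_def)
  qed
  ultimately have "continuous_on {a<..<c} (\<lambda>y. W (y - L * of_int \<lfloor>y / L\<rfloor>))"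
    by (rule continuous_on_eq)
  then show "isCont (\<lambda>y. W (y - L * of_int \<lfloor>y / L\<rfloor>)) x"
    using x ab L by (simp add: continuous_on_eq_continuous_at)
qed

text \<open>Folding the argument into \<open>[0, L)\<close> makes the image of an arbitrary bounded continuous
  function \<open>L\<close>-periodic; no closed subspace of periodic functions is then needed.\<close>

definition periodic_integral :: "real \<Rightarrow> (real \<Rightarrow>\<^sub>C real) \<Rightarrow> (real \<Rightarrow>\<^sub>C real)" where
  "periodic_integral L u = Bcontfun (\<lambda>x. let y = x - L * of_int \<lfloor>x / L\<rfloor> in
     primitive (apply_bcontfun u) y - y / L * primitive (apply_bcontfun u) L)"

lemma fold_bounds:
  assumes "L > 0" shows "0 \<le> x - L * of_int \<lfloor>x / L\<rfloor>" "x - L * of_int \<lfloor>x / L\<rfloor> \<le> (L::real)"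
  using floor_divide_lower[OF assms, of x] floor_divide_upper[OF assms, of x]
  by (auto simp: algebra_simps)

lemma periodic_integral_bound:
  fixes u :: "real \<Rightarrow>\<^sub>C real"
  assumes "L > 0" "0 \<le> y" "y \<le> L"
  shows "\<bar>primitive (apply_bcontfun u) y - y / L * primitive (apply_bcontfun u) L\<bar> \<le> norm u * (2 * L)"
proof -
  have "\<bar>y / L * primitive (apply_bcontfun u) L\<bar> \<le> 1 * (norm u * L)"
    unfolding abs_mult using assms primitive_bcontfun_bound[of L u]
    by (intro mult_mono) auto
  moreover have "\<bar>primitive (apply_bcontfun u) y\<bar> \<le> norm u * y"
    by (rule primitive_bcontfun_bound[OF assms(2)])
  moreover have "norm u * y \<le> norm u * L" using assms by (intro mult_left_mono) auto
  ultimately show ?thesis by argo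
qed

lemma apply_periodic_integral:
  fixes u :: "real \<Rightarrow>\<^sub>C real"
  assumes "L > 0"
  shows "apply_bcontfun (periodic_integral L u) x = (let y = x - L * of_int \<lfloor>x / L\<rfloor> in
     primitive (apply_bcontfun u) y - y / L * primitive (apply_bcontfun u) L)"
proof -
  let ?W = "\<lambda>y. primitive (apply_bcontfun u) y - y / L * primitive (apply_bcontfun u) L"
  have "apply_bcontfun (Bcontfun (\<lambda>x. ?W (x - L * of_int \<lfloor>x / L\<rfloor>))) = (\<lambda>x. ?W (x - L * of_int \<lfloor>x / L\<rfloor>))"
  proof (rule apply_Bcontfun_real)
    show "continuous_on UNIV (\<lambda>x. ?W (x - L * of_int \<lfloor>x / L\<rfloor>))"
      by (rule continuous_on_fold[where W="?W"])
        (use assms in \<open>auto intro!: continuous_intros continuous_primitive\<close>)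
    show "\<bar>?W (x - L * of_int \<lfloor>x / L\<rfloor>)\<bar> \<le> norm u * (2 * L)" for x
      by (rule periodic_integral_bound[OF assms fold_bounds[OF assms]])
  qed
  then show ?thesis unfolding periodic_integral_def Let_def by simp
qed

lemma norm_periodic_integral:
  assumes "L > 0" shows "norm (periodic_integral L u) \<le> norm u * (2 * L)"
  by (rule norm_bound)
    (simp add: apply_periodic_integral[OF assms] Let_def
      periodic_integral_bound[OF assms fold_bounds[OF assms], unfolded times_divide_eq_left])

lemma bounded_linear_periodic_integral:
  assumes "L > 0" shows "bounded_linear (periodic_integral L)"
proof (rule bounded_linear_intro[where K="2 * L"])
  note [simp] = apply_periodic_integral[OF assms] Let_def
  fix u v :: "real \<Rightarrow>\<^sub>C real" and c :: real
  show "periodic_integral L (u + v) = periodic_integral L u + periodic_integral L v"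
    by (rule bcontfun_eqI) (simp add: primitive_add distrib_left)
  show "periodic_integral L (c *\<^sub>R u) = c *\<^sub>R periodic_integral L u"
    by (rule bcontfun_eqI) (simp add: primitive_cmult right_diff_distrib)
  show "norm (periodic_integral L u) \<le> norm u * (2 * L)" by (rule norm_periodic_integral[OF assms])
qed

lemma periodic_integral_0 [simp]: "L > 0 \<Longrightarrow> apply_bcontfun (periodic_integral L u) 0 = 0"
  by (simp add: apply_periodic_integral)

lemma periodic_periodic_integral: "L > 0 \<Longrightarrow> periodic L (apply_bcontfun (periodic_integral L u))"
  by (simp add: periodic_def apply_periodic_integral add_divide_distrib Let_def algebra_simps)

text \<open>For periodic \<open>u\<close> the unfolded expression is periodic already, so folding
  changes nothing. If the integral over a period also vanishes, the linear term drops and the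
  ordinary primitive remains; this is the form met on actual solutions.\<close>

lemma apply_periodic_integral_periodic:
  fixes u :: "real \<Rightarrow>\<^sub>C real"
  assumes "L > 0" "periodic L (apply_bcontfun u)"
  shows "apply_bcontfun (periodic_integral L u) x =
    primitive (apply_bcontfun u) x - x / L * primitive (apply_bcontfun u) L"
proof -
  let ?W = "\<lambda>y. primitive (apply_bcontfun u) y - y / L * primitive (apply_bcontfun u) L"
  have "periodic L ?W"
    using primitive_periodic[OF continuous_on_apply_bcontfun assms(2)] assms(1)
    by (simp add: periodic_def field_simps)
  from periodic_of_int[OF this, of x "- \<lfloor>x / L\<rfloor>"] show ?thesis
    by (simp only: apply_periodic_integral[OF assms(1)] Let_def of_int_minus mult_minus_left
        add_uminus_conv_diff mult.commute[of L])
qed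

section \<open>Superposition operators\<close>

definition nemytskii :: "(real \<Rightarrow> real \<Rightarrow> real) \<Rightarrow> (real \<Rightarrow>\<^sub>C real) \<Rightarrow> (real \<Rightarrow>\<^sub>C real)" where
  "nemytskii g u = Bcontfun (\<lambda>x. g x (apply_bcontfun u x))"

text \<open>The first bound is the mean value inequality for \<open>g y - g1 v * y\<close> on the
  segment from \<open>v\<close> to \<open>w\<close>: its derivative \<open>g1 y - g1 v\<close> is at
  most \<open>C\<close> times the length of the segment. The sharp constant \<open>C / 2\<close> is
  not sought.\<close>

lemma quadratic_remainder_bound:
  fixes g :: "real \<Rightarrow> real"
  assumes "convex V" "v \<in> V" "w \<in> V"
    and "\<And>y. y \<in> V \<Longrightarrow> (g has_real_derivative g1 y) (at y)"
    and "\<And>y. y \<in> V \<Longrightarrow> (g1 has_real_derivative g2 y) (at y)"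
    and "\<And>y. y \<in> V \<Longrightarrow> \<bar>g2 y\<bar> \<le> C"
  shows "\<bar>g w - g v - g1 v * (w - v)\<bar> \<le> C * (w - v)\<^sup>2" "\<bar>g1 w - g1 v\<bar> \<le> C * \<bar>w - v\<bar>"
proof -
  have C: "C \<ge> 0" using assms(6)[OF assms(2)] by linarith
  have lip: "\<bar>g1 y - g1 v\<bar> \<le> C * \<bar>y - v\<bar>" if "y \<in> V" for y
    using field_differentiable_bound[OF assms(1), of g1 g2 C y v] assms(2,5,6) that
    by (auto intro: has_field_derivative_at_within)
  then show "\<bar>g1 w - g1 v\<bar> \<le> C * \<bar>w - v\<bar>" using assms(3) .
  have seg: "closed_segment v w \<subseteq> V"
    using assms(1-3) by (simp add: closed_segment_subset)
  have "norm ((g w - g1 v * w) - (g v - g1 v * v)) \<le> C * \<bar>w - v\<bar> * norm (w - v)"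
  proof (rule field_differentiable_bound[where S="closed_segment v w" and f'="\<lambda>y. g1 y - g1 v"])
    fix y assume y: "y \<in> closed_segment v w"
    then have "y \<in> V" using seg by blast
    show "((\<lambda>y. g y - g1 v * y) has_field_derivative g1 y - g1 v) (at y within closed_segment v w)"
      by (rule has_field_derivative_at_within)
        (auto intro!: derivative_eq_intros assms(4) \<open>y \<in> V\<close>)
    have "\<bar>y - v\<bar> \<le> \<bar>w - v\<bar>" using y by (auto simp: closed_segment_eq_real_ivl split: if_splits)
    then show "norm (g1 y - g1 v) \<le> C * \<bar>w - v\<bar>"
      using lip[OF \<open>y \<in> V\<close>] C by (simp add: mult_left_mono order_trans[OF _ mult_left_mono])
  qed auto
  then show "\<bar>g w - g v - g1 v * (w - v)\<bar> \<le> C * (w - v)\<^sup>2"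
    by (simp add: algebra_simps power2_eq_square abs_mult_self_eq flip: abs_mult)
qed

text \<open>Bounds are uniform in \<open>x\<close>, and continuity is asked along continuous
  \<open>u\<close>, because exactly these compositions must be bounded continuous functions.
  \<open>V\<close> restricts the values: \<open>slow_diff\<close> is well behaved only while its
  radicand stays positive. The point 0 is the base from which \<open>g\<close> itself is
  bounded.\<close>

locale nemytskii_c2 =
  fixes g g1 g2 :: "real \<Rightarrow> real \<Rightarrow> real" and V :: "real set" and C :: real
  assumes V: "convex V" "0 \<in> V"
    and d1: "\<And>x v. v \<in> V \<Longrightarrow> (g x has_real_derivative g1 x v) (at v)"
    and d2: "\<And>x v. v \<in> V \<Longrightarrow> (g1 x has_real_derivative g2 x v) (at v)"
    and b0: "\<And>x. \<bar>g x 0\<bar> \<le> C"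
    and b1: "\<And>x v. v \<in> V \<Longrightarrow> \<bar>g1 x v\<bar> \<le> C"
    and b2: "\<And>x v. v \<in> V \<Longrightarrow> \<bar>g2 x v\<bar> \<le> C"
    and c0: "\<And>u. continuous_on UNIV u \<Longrightarrow> (\<And>x. u x \<in> V) \<Longrightarrow> continuous_on UNIV (\<lambda>x. g x (u x))"
    and c1: "\<And>u. continuous_on UNIV u \<Longrightarrow> (\<And>x. u x \<in> V) \<Longrightarrow> continuous_on UNIV (\<lambda>x. g1 x (u x))"
begin

abbreviation dom :: "(real \<Rightarrow>\<^sub>C real) set" where
  "dom \<equiv> {u. \<forall>x. apply_bcontfun u x \<in> V}"

lemma C_nonneg: "C \<ge> 0" using b0[of 0] by linarith

lemma lipschitz: "v \<in> V \<Longrightarrow> w \<in> V \<Longrightarrow> \<bar>g x w - g x v\<bar> \<le> C * \<bar>w - v\<bar>"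
  using field_differentiable_bound[OF V(1), of "g x" "g1 x" C w v] d1[of _ x] b1[of _ x]
  by (auto intro: has_field_derivative_at_within)

lemma apply_nemytskii:
  assumes "u \<in> dom" shows "apply_bcontfun (nemytskii g u) x = g x (apply_bcontfun u x)"
proof -
  have "apply_bcontfun (nemytskii g u) = (\<lambda>x. g x (apply_bcontfun u x))"
    unfolding nemytskii_def
  proof (rule apply_Bcontfun_real)
    show "continuous_on UNIV (\<lambda>x. g x (apply_bcontfun u x))"
      by (rule c0) (use assms in auto)
    fix x
    have "\<bar>g x (apply_bcontfun u x) - g x 0\<bar> \<le> C * \<bar>apply_bcontfun u x - 0\<bar>"
      by (rule lipschitz) (use assms V in auto)
    also have "\<dots> \<le> C * norm u" using C_nonneg bcontfun_real_bound by (simp add: mult_left_mono)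
    finally show "\<bar>g x (apply_bcontfun u x)\<bar> \<le> C + C * norm u"
      using b0[of x] by linarith
  qed
  then show ?thesis by simp
qed

definition "D u v = Bcontfun (\<lambda>x. g1 x (apply_bcontfun u x) * apply_bcontfun v x)"

lemma apply_D:
  assumes "u \<in> dom" shows "apply_bcontfun (D u v) x = g1 x (apply_bcontfun u x) * apply_bcontfun v x"
proof -
  have "apply_bcontfun (D u v) = (\<lambda>x. g1 x (apply_bcontfun u x) * apply_bcontfun v x)"
    unfolding D_def
  proof (rule apply_Bcontfun_real)
    show "continuous_on UNIV (\<lambda>x. g1 x (apply_bcontfun u x) * apply_bcontfun v x)"
      by (intro continuous_intros c1) (use assms in auto)
    show "\<bar>g1 x (apply_bcontfun u x) * apply_bcontfun v x\<bar> \<le> C * norm v" for x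
      unfolding abs_mult by (intro mult_mono b1 bcontfun_real_bound) (use assms C_nonneg in auto)
  qed
  then show ?thesis by simp
qed

text \<open>Taylor estimates that hold at each \<open>x\<close> with the same constant pass to the
  supremum norm unchanged, the derivative being multiplication by \<open>g1 x (u x)\<close>.\<close>

lemma c11: "c11_on dom (nemytskii g) D"
proof (rule c11_onI[where C=C])
  fix u :: "real \<Rightarrow>\<^sub>C real" assume u: "u \<in> dom"
  have nD: "norm (D u v) \<le> C * norm v" for v
    by (rule norm_bound)
      (use u b1 C_nonneg in \<open>auto simp: apply_D[OF u] abs_mult bcontfun_real_bound intro!: mult_mono\<close>)
  then show "norm (D u v) \<le> C * norm v" for v .
  show "bounded_linear (D u)"
    by (rule bounded_linear_intro[where K=C])
      (use nD in \<open>auto intro!: bcontfun_eqI simp: apply_D[OF u] algebra_simps\<close>)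
  fix w :: "real \<Rightarrow>\<^sub>C real" assume w: "w \<in> dom"
  have uw: "\<bar>apply_bcontfun w x - apply_bcontfun u x\<bar> \<le> norm (w - u)" for x
    using bcontfun_real_bound[of "w - u" x] by simp
  have V': "apply_bcontfun u x \<in> V" "apply_bcontfun w x \<in> V" for x using u w by auto
  note app = apply_nemytskii[OF u] apply_nemytskii[OF w] apply_D[OF u] apply_D[OF w]
  have Taylor: "\<bar>g x (apply_bcontfun w x) - g x (apply_bcontfun u x)
        - g1 x (apply_bcontfun u x) * (apply_bcontfun w x - apply_bcontfun u x)\<bar>
      \<le> C * (apply_bcontfun w x - apply_bcontfun u x)\<^sup>2"
    "\<bar>g1 x (apply_bcontfun w x) - g1 x (apply_bcontfun u x)\<bar> \<le> C * \<bar>apply_bcontfun w x - apply_bcontfun u x\<bar>" for x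
    by (rule quadratic_remainder_bound[OF V(1) V' d1 d2 b2]; assumption)+
  show "norm (nemytskii g w - nemytskii g u) \<le> C * norm (w - u)"
  proof (rule norm_bound)
    show "norm (apply_bcontfun (nemytskii g w - nemytskii g u) x) \<le> C * norm (w - u)" for x
      using lipschitz[OF V'[of x], of x] mult_left_mono[OF uw[of x] C_nonneg]
      by (simp add: app)
  qed
  show "norm (nemytskii g w - nemytskii g u - D u (w - u)) \<le> C * (norm (w - u))\<^sup>2"
  proof (rule norm_bound)
    fix x
    have "(apply_bcontfun w x - apply_bcontfun u x)\<^sup>2 \<le> (norm (w - u))\<^sup>2"
      using power_mono[OF uw, of x 2] by simp
    then show "norm (apply_bcontfun (nemytskii g w - nemytskii g u - D u (w - u)) x) \<le> C * (norm (w - u))\<^sup>2"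
      using Taylor(1)[of x] mult_left_mono[of _ _ C] C_nonneg by (fastforce simp: app)
  qed
  fix v
  show "norm (D w v - D u v) \<le> C * norm (w - u) * norm v"
  proof (rule norm_bound)
    fix x
    have "\<bar>g1 x (apply_bcontfun w x) - g1 x (apply_bcontfun u x)\<bar> \<le> C * norm (w - u)"
      using Taylor(2)[of x] mult_left_mono[OF uw[of x] C_nonneg] by linarith
    then have "\<bar>g1 x (apply_bcontfun w x) - g1 x (apply_bcontfun u x)\<bar> * \<bar>apply_bcontfun v x\<bar> \<le> C * norm (w - u) * norm v"
      by (intro mult_mono bcontfun_real_bound) (use C_nonneg in auto)
    then show "norm (apply_bcontfun (D w v - D u v) x) \<le> C * norm (w - u) * norm v"
      by (simp add: app left_diff_distrib[symmetric] abs_mult)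
  qed
qed (rule C_nonneg)

end


section \<open>Shift-periodic solutions rotate\<close>

lemma C1_differentiable_on_UNIV_D:
  fixes f :: "real \<Rightarrow> real"
  assumes "f C1_differentiable_on UNIV"
  shows "(f has_real_derivative deriv f x) (at x)" "continuous_on UNIV (deriv f)"
proof -
  obtain D where D: "\<And>x. (f has_real_derivative D x) (at x)" "continuous_on UNIV D"
    using assms by (auto simp: C1_differentiable_on_def has_real_derivative_iff_has_vector_derivative)
  then have "deriv f = D" by (auto intro!: ext DERIV_imp_deriv)
  with D show "(f has_real_derivative deriv f x) (at x)" "continuous_on UNIV (deriv f)" by auto
qed

lemma C2_D:
  assumes "C2 f"
  shows "(f has_real_derivative deriv f x) (at x)"
    "(deriv f has_real_derivative deriv (deriv f) x) (at x)"
    "continuous_on UNIV f" "continuous_on UNIV (deriv f)" "continuous_on UNIV (deriv (deriv f))"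
proof -
  show *: "(f has_real_derivative deriv f x) (at x)"
    "(deriv f has_real_derivative deriv (deriv f) x) (at x)" for x
    using assms C1_differentiable_on_UNIV_D(1) by (auto simp: C2_def)
  show "continuous_on UNIV f" "continuous_on UNIV (deriv f)"
    using * by (meson DERIV_isCont continuous_at_imp_continuous_on)+
  show "continuous_on UNIV (deriv (deriv f))"
    using assms C1_differentiable_on_UNIV_D(2) by (auto simp: C2_def)
qed

lemma periodic_derivative:
  assumes "periodic L f" "\<And>x. (f has_real_derivative g x) (at x)"
  shows "periodic L g"
proof -
  have "f = (\<lambda>x. f (x + L))" using assms(1) by (auto simp: periodic_def)
  then have d: "(f has_real_derivative g (x + L)) (at x)" for x
    using assms(2)[of "x + L"] DERIV_shift[of f "g (x + L)" x L] by simp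
  show ?thesis unfolding periodic_def using DERIV_unique[OF d assms(2)] by blast
qed

lemma lipschitz_of_derivative_bound:
  fixes f :: "real \<Rightarrow> real"
  assumes "\<And>x. (f has_real_derivative g x) (at x)" "\<And>x. \<bar>g x\<bar> \<le> C"
  shows "\<bar>f x - f y\<bar> \<le> C * \<bar>x - y\<bar>"
  using field_differentiable_bound[of UNIV f g C x y] assms by (auto intro: has_field_derivative_at_within)

section \<open>Functions advancing by a fixed amount per period\<close>

lemma shift_of_nat:
  assumes "\<And>t. \<phi> (t + P) = \<phi> t + (L::real)"
  shows "\<phi> (t + of_nat n * P) = \<phi> t + of_nat n * L"
proof (induction n)
  case (Suc n)
  have "\<phi> (t + of_nat (Suc n) * P) = \<phi> ((t + of_nat n * P) + P)" by (simp add: algebra_simps)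
  then show ?case using Suc by (simp only: assms) (simp add: algebra_simps)
qed simp

lemma shift_surj:
  fixes \<phi> :: "real \<Rightarrow> real"
  assumes "continuous_on UNIV \<phi>" "\<And>t. \<phi> (t + P) = \<phi> t + L" "P > 0" "L > 0"
  obtains t where "\<phi> t = y"
proof -
  obtain n :: nat where n: "\<bar>y - \<phi> 0\<bar> / L < of_nat n" using reals_Archimedean2 by blast
  then have n': "\<bar>y - \<phi> 0\<bar> < of_nat n * L" using assms(4) by (simp add: field_simps)
  have "\<phi> (of_nat n * P) = \<phi> 0 + of_nat n * L"
    using shift_of_nat[of \<phi> P L 0 n] assms(2) by simp
  moreover have "\<phi> 0 = \<phi> (- (of_nat n * P)) + of_nat n * L"
    using shift_of_nat[of \<phi> P L "- (of_nat n * P)" n] assms(2) by simp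
  ultimately have "\<phi> (- (of_nat n * P)) \<le> y" "y \<le> \<phi> (of_nat n * P)" using n' by linarith+
  then have "\<exists>x. - (of_nat n * P) \<le> x \<and> x \<le> of_nat n * P \<and> \<phi> x = y"
    by (rule IVT') (use assms in \<open>auto intro: continuous_on_subset\<close>)
  then show ?thesis using that by blast
qed

text \<open>Serves in both directions, with period and advance exchanged: it turns a solution into
  its time as a function of the angle, and a time function back into a solution.\<close>

lemma shift_inverse:
  fixes \<phi> :: "real \<Rightarrow> real"
  assumes d: "\<And>t. (\<phi> has_real_derivative \<phi>' t) (at t)" and pos: "\<And>t. \<phi>' t > 0"
    and sh: "\<And>t. \<phi> (t + P) = \<phi> t + L" and PL: "P > 0" "L > 0"
  obtains s where "\<And>t. s (\<phi> t) = t" "\<And>x. \<phi> (s x) = x" "\<And>x. s (x + L) = s x + P"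
    "\<And>x. (s has_real_derivative 1 / \<phi>' (s x)) (at x)"
proof -
  have mono: "\<phi> a < \<phi> b" if "a < b" for a b
    by (rule DERIV_pos_imp_increasing[OF that]) (use d pos in blast)
  then have inj: "inj \<phi>" by (metis injI linorder_neqE less_irrefl)
  have cont: "isCont \<phi> t" for t using d by (rule DERIV_isCont)
  then have con: "continuous_on UNIV \<phi>" by (simp add: continuous_at_imp_continuous_on)
  have "\<exists>t. \<phi> t = y" for y by (rule shift_surj[of \<phi> P L y, OF con sh PL]) blast
  then have surj: "surj \<phi>" by (metis surjI)
  define s where "s = inv \<phi>"
  have s1: "s (\<phi> t) = t" for t unfolding s_def by (rule inv_f_f[OF inj])
  have s2: "\<phi> (s x) = x" for x unfolding s_def by (rule surj_f_inv_f[OF surj])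
  have "s (x + L) = s x + P" for x
    using s1[of "s x + P"] by (simp add: sh s2)
  moreover have "(s has_real_derivative 1 / \<phi>' (s x)) (at x)" for x
  proof -
    have "isCont s (\<phi> (s x))" by (rule isCont_inverse_function[of 1]) (auto simp: s1 cont)
    then have "(s has_real_derivative inverse (\<phi>' (s x))) (at x)"
      by (intro DERIV_inverse_function[OF d, of _ _ "x - 1" "x + 1"]) (use pos[of "s x"] in \<open>auto simp: s2\<close>)
    then show ?thesis by (simp add: inverse_eq_divide)
  qed
  ultimately show ?thesis using that s1 s2 by blast
qed

text \<open>The solution passes through every angle, so \<open>F + c = v\<^sup>2 / 2\<close> is nonnegative on the whole line.
  A zero of the velocity would thus be a minimum of \<open>F\<close>, that is an equilibrium, and by Gronwall the
  solution would stay there.\<close>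

lemma rotation_velocity_pos:
  fixes f F \<psi> v :: "real \<Rightarrow> real"
  assumes F: "\<And>x. (F has_real_derivative f x) (at x)"
    and lip: "\<And>x y. \<bar>f x - f y\<bar> \<le> K * \<bar>x - y\<bar>"
    and \<psi>: "\<And>t. (\<psi> has_real_derivative v t) (at t)" "\<And>t. isCont v t"
    and en: "\<And>t. (v t)\<^sup>2 / 2 - F (\<psi> t) = c"
    and sh: "\<And>t. \<psi> (t + P) = \<psi> t + L" and PL: "P > 0" "L > 0"
  shows "v t > 0"
proof -
  have K: "K \<ge> 0" using lip[of 1 0] by simp
  have c\<psi>: "continuous_on UNIV \<psi>" using \<psi>(1) by (meson DERIV_isCont continuous_at_imp_continuous_on)
  have nz: "v t \<noteq> 0" for t
  proof
    assume v0: "v t = 0"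
    define x0 where "x0 = \<psi> t"
    have min: "F x0 \<le> F x" for x
    proof -
      obtain s where "\<psi> s = x" using shift_surj[OF c\<psi> sh PL] .
      then have "F x - F x0 = (v s)\<^sup>2 / 2" using en[of s] en[of t] v0 by (simp add: x0_def)
      then show ?thesis using zero_le_power2[of "v s"] by linarith
    qed
    have f0: "f x0 = 0"
      by (rule DERIV_local_min[OF F, of 1]) (use min in auto)
    have quad: "F x - F x0 \<le> K * (x - x0)\<^sup>2" for x
    proof -
      have "norm (F x - F x0) \<le> K * \<bar>x - x0\<bar> * norm (x - x0)"
      proof (rule field_differentiable_bound[where S="closed_segment x0 x" and f'=f])
        fix y assume "y \<in> closed_segment x0 x"
        then have "\<bar>y - x0\<bar> \<le> \<bar>x - x0\<bar>" by (auto simp: closed_segment_eq_real_ivl split: if_splits)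
        then show "norm (f y) \<le> K * \<bar>x - x0\<bar>"
          using lip[of y x0] mult_left_mono[OF _ K, of "\<bar>y - x0\<bar>"] by (fastforce simp: f0)
      qed (auto intro: has_field_derivative_at_within F)
      then show ?thesis by (simp add: power2_eq_square abs_mult_self_eq mult.assoc)
    qed
    \<comment> \<open>The energy and the quadratic bound give
      \<open>(v s)\<^sup>2 \<le> 2 * K * (\<psi> s - x0)\<^sup>2\<close>; with
      \<open>2 * a * b \<le> a\<^sup>2 + b\<^sup>2\<close> the squared distance from
      \<open>x0\<close> grows at most at the rate \<open>1 + 2 * K\<close>.\<close>
    define N where "N = 1 + 2 * K"
    have vb: "(v s)\<^sup>2 \<le> 2 * K * (\<psi> s - x0)\<^sup>2" for s
      using quad[of "\<psi> s"] en[of s] en[of t] v0 by (simp add: x0_def)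
    have grow: "2 * (\<psi> s - x0) * v s \<le> N * (\<psi> s - x0)\<^sup>2" for s
      unfolding N_def distrib_right
      using vb[of s] sum_squares_bound[of "\<psi> s - x0" "v s"] by linarith
    define W where "W s = (\<psi> s - x0)\<^sup>2 * exp (- N * s)" for s
    have dW: "(W has_real_derivative (2 * (\<psi> s - x0) * v s - N * (\<psi> s - x0)\<^sup>2) * exp (- N * s)) (at s)" for s
      unfolding W_def by (auto intro!: derivative_eq_intros \<psi> simp: algebra_simps)
    have "W (t + P) \<le> W t"
    proof (rule DERIV_nonpos_imp_nonincreasing[of t "t + P" W])
      show "\<exists>y. (W has_real_derivative y) (at s) \<and> y \<le> 0" for s
        by (rule exI, rule conjI[OF dW]) (use grow[of s] in \<open>simp add: mult_nonpos_nonneg\<close>)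
    qed (use PL in simp)
    \<comment> \<open>\<open>W t\<close> is 0, so the solution would still be at \<open>x0\<close>
      after the time \<open>P\<close>, although it advances by \<open>L > 0\<close>.\<close>
    then have "(\<psi> (t + P) - x0)\<^sup>2 * exp (- N * (t + P)) \<le> 0" by (simp add: W_def x0_def)
    then show False using PL sh[of t] by (simp add: x0_def mult_le_0_iff)
  qed
  obtain s where s: "v s > 0"
  proof -
    obtain z where "\<psi> P - \<psi> 0 = (P - 0) * v z" using MVT2[of 0 P \<psi> v] PL \<psi> by blast
    then have "v z > 0" using sh[of 0] PL by (simp add: zero_less_mult_iff)
    then show ?thesis using that by blast
  qed
  show ?thesis
  proof (rule ccontr)
    assume "\<not> v t > 0"
    then have vt: "v t \<le> 0" by simp
    have "\<exists>x. v x = 0"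
    proof (cases "s \<le> t")
      case True
      then show ?thesis using IVT2[of v t 0 s] s vt \<psi>(2) by auto
    next
      case False
      then show ?thesis using IVT[of v t 0 s] s vt \<psi>(2) by auto
    qed
    then show False using nz by blast
  qed
qed


section \<open>The rotating solution parametrised by its angle\<close>

text \<open>\<open>L\<close> and \<open>P\<close> stand for \<open>2 * pi * q\<close> and
  \<open>p\<close>, \<open>s0\<close> is the inverse of \<open>\<psi>\<close>, and \<open>z0\<close>
  is the value of \<open>H\<^sup>-\<^sup>1\<close> at the unperturbed energy minus \<open>d\<close>.
  On the interval of radius \<open>R1\<close> about \<open>z0\<close> half the squared velocity
  stays above \<open>m\<close>. The last two assumptions are the conditions on the Melnikov function
  after the substitution \<open>x = \<psi> (t + \<alpha>0)\<close>.\<close>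

locale rotator =
  fixes f h \<gamma> \<psi> v s0 :: "real \<Rightarrow> real" and I J :: "real set"
    and d c z0 \<alpha>0 L P R1 m :: real
  assumes L: "L > 0" and P: "P > 0"
    and f: "C2 f" and h: "C2 h" and \<gamma>: "C2 \<gamma>" and per_\<gamma>: "periodic P \<gamma>"
    and per_f: "periodic L f" and per_F: "periodic L (primitive f)"
    and \<psi>: "\<And>t. (\<psi> has_real_derivative v t) (at t)"
    and v: "\<And>t. (v has_real_derivative f (\<psi> t)) (at t)"
    and v_pos: "\<And>t. v t > 0"
    and energy_\<psi>: "\<And>t. (v t)\<^sup>2 / 2 - primitive f (\<psi> t) = c"
    and shift_\<psi>: "\<And>t. \<psi> (t + P) = \<psi> t + L"
    and s0_\<psi>: "\<And>t. s0 (\<psi> t) = t" and \<psi>_s0: "\<And>x. \<psi> (s0 x) = x"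
    and shift_s0: "\<And>x. s0 (x + L) = s0 x + P"
    and s0: "\<And>x. (s0 has_real_derivative 1 / v (s0 x)) (at x)"
    and R1: "R1 > 0" and in_I: "\<And>z. \<bar>z - z0\<bar> \<le> R1 \<Longrightarrow> z \<in> I"
    and m: "m > 0"
    and m_le: "\<And>x w. \<bar>w\<bar> \<le> R1 \<Longrightarrow> m \<le> primitive f x + d + primitive h (z0 + w)"
    and H_z0: "primitive h z0 = c - d" and h_nz: "\<And>z. z \<in> I \<Longrightarrow> h z \<noteq> 0"
    and bij_H: "bij_betw (primitive h) I J"
    and inv_H_deriv: "\<And>y. y \<in> J \<Longrightarrow>
      (inv_into I (primitive h) has_real_derivative 1 / h (inv_into I (primitive h) y)) (at y)"
    and melnikov_zero: "primitive (\<lambda>x. \<gamma> (s0 x - \<alpha>0)) L = 0"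
    and melnikov_simple: "primitive (\<lambda>x. deriv \<gamma> (s0 x - \<alpha>0)) L \<noteq> 0"
begin

abbreviation "F \<equiv> primitive f"
abbreviation "H \<equiv> primitive h"

lemma DF: "(F has_real_derivative f x) (at x)" and DH: "(H has_real_derivative h x) (at x)"
  using primitive_has_derivative C2_D(3) f h by blast+

lemma cont [continuous_intros]:
  assumes "continuous_on S u"
  shows "continuous_on S (\<lambda>x. f (u x))" "continuous_on S (\<lambda>x. F (u x))"
    "continuous_on S (\<lambda>x. h (u x))" "continuous_on S (\<lambda>x. H (u x))"
    "continuous_on S (\<lambda>x. \<gamma> (u x))" "continuous_on S (\<lambda>x. deriv \<gamma> (u x))"
    "continuous_on S (\<lambda>x. \<psi> (u x))" "continuous_on S (\<lambda>x. v (u x))" "continuous_on S (\<lambda>x. s0 (u x))"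
proof -
  have "continuous_on UNIV \<psi>" "continuous_on UNIV v" "continuous_on UNIV s0"
    "continuous_on UNIV F" "continuous_on UNIV H"
    using \<psi> v s0 DF DH by (meson DERIV_isCont continuous_at_imp_continuous_on)+
  then show "continuous_on S (\<lambda>x. f (u x))" "continuous_on S (\<lambda>x. F (u x))"
    "continuous_on S (\<lambda>x. h (u x))" "continuous_on S (\<lambda>x. H (u x))"
    "continuous_on S (\<lambda>x. \<gamma> (u x))" "continuous_on S (\<lambda>x. deriv \<gamma> (u x))"
    "continuous_on S (\<lambda>x. \<psi> (u x))" "continuous_on S (\<lambda>x. v (u x))" "continuous_on S (\<lambda>x. s0 (u x))"
    using C2_D(3,4) f h \<gamma> by (auto intro!: continuous_on_compose2[OF _ assms, of UNIV])
qed

lemma per_\<gamma>1: "periodic P (deriv \<gamma>)" and per_\<gamma>2: "periodic P (deriv (deriv \<gamma>))"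
  using periodic_derivative per_\<gamma> C2_D(1,2)[OF \<gamma>] by blast+

lemma per_v: "periodic P v"
proof -
  have "((\<lambda>t. \<psi> (t + P) - L) has_real_derivative v (t + P)) (at t)" for t
    using DERIV_shift[of \<psi> "v (t + P)" t P] \<psi>[of "t + P"]
    by (auto intro!: derivative_eq_intros)
  moreover have "(\<lambda>t. \<psi> (t + P) - L) = \<psi>" using shift_\<psi> by auto
  ultimately have "(\<psi> has_real_derivative v (t + P)) (at t)" for t by simp
  then show ?thesis unfolding periodic_def using DERIV_unique[OF _ \<psi>] by blast
qed

lemma v_s0: "v (s0 x) = sqrt (2 * (F x + c))"
proof -
  have "(v (s0 x))\<^sup>2 = 2 * (F x + c)" using energy_\<psi>[of "s0 x"] by (simp add: \<psi>_s0)
  then show ?thesis using v_pos[of "s0 x"] by (simp add: real_sqrt_unique)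
qed

text \<open>One constant dominates all data: periodicity bounds \<open>f\<close>,
  \<open>\<gamma>\<close>, \<open>v\<close> and the derivatives involved, and compactness bounds
  \<open>h\<close> and \<open>deriv h\<close> near \<open>z0\<close>. Fixing it by choice makes it
  available to every estimate below.\<close>

definition bound :: real where
  "bound = (SOME B. B > 0 \<and> (\<forall>x. \<bar>\<gamma> x\<bar> \<le> B \<and> \<bar>deriv \<gamma> x\<bar> \<le> B \<and> \<bar>deriv (deriv \<gamma>) x\<bar> \<le> B \<and>
      \<bar>f x\<bar> \<le> B \<and> \<bar>deriv f x\<bar> \<le> B \<and> v x \<le> B) \<and>
    (\<forall>w. \<bar>w\<bar> \<le> R1 \<longrightarrow> \<bar>h (z0 + w)\<bar> \<le> B \<and> \<bar>deriv h (z0 + w)\<bar> \<le> B))"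

lemma bound:
  shows "bound > 0" "\<bar>\<gamma> x\<bar> \<le> bound" "\<bar>deriv \<gamma> x\<bar> \<le> bound" "\<bar>deriv (deriv \<gamma>) x\<bar> \<le> bound"
    "\<bar>f x\<bar> \<le> bound" "\<bar>deriv f x\<bar> \<le> bound" "v x \<le> bound"
    "\<bar>w\<bar> \<le> R1 \<Longrightarrow> \<bar>h (z0 + w)\<bar> \<le> bound" "\<bar>w\<bar> \<le> R1 \<Longrightarrow> \<bar>deriv h (z0 + w)\<bar> \<le> bound"
proof -
  obtain B1 where B1: "B1 \<ge> 0" "\<And>x. \<bar>\<gamma> x\<bar> \<le> B1"
    using periodic_continuous_bounded[OF per_\<gamma> P C2_D(3)[OF \<gamma>]] by blast
  obtain B2 where B2: "B2 \<ge> 0" "\<And>x. \<bar>deriv \<gamma> x\<bar> \<le> B2"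
    using periodic_continuous_bounded[OF per_\<gamma>1 P C2_D(4)[OF \<gamma>]] by blast
  obtain B3 where B3: "B3 \<ge> 0" "\<And>x. \<bar>deriv (deriv \<gamma>) x\<bar> \<le> B3"
    using periodic_continuous_bounded[OF per_\<gamma>2 P C2_D(5)[OF \<gamma>]] by blast
  obtain B4 where B4: "B4 \<ge> 0" "\<And>x. \<bar>f x\<bar> \<le> B4"
    using periodic_continuous_bounded[OF per_f L C2_D(3)[OF f]] by blast
  obtain B5 where B5: "B5 \<ge> 0" "\<And>x. \<bar>deriv f x\<bar> \<le> B5"
    using periodic_continuous_bounded[OF periodic_derivative[OF per_f C2_D(1)[OF f]] L C2_D(4)[OF f]] by blast
  obtain B6 where B6: "B6 \<ge> 0" "\<And>t. \<bar>v t\<bar> \<le> B6"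
    using periodic_continuous_bounded[OF per_v P cont(8)[OF continuous_on_id]] by blast
  have "compact {z0 - R1..z0 + R1}" by simp
  then have "bounded (h ` {z0 - R1..z0 + R1})" "bounded (deriv h ` {z0 - R1..z0 + R1})"
    using C2_D(3,4)[OF h] by (meson compact_continuous_image compact_imp_bounded continuous_on_subset subset_UNIV)+
  then obtain B7 B8 where B7: "\<And>z. z \<in> {z0 - R1..z0 + R1} \<Longrightarrow> \<bar>h z\<bar> \<le> B7"
    and B8: "\<And>z. z \<in> {z0 - R1..z0 + R1} \<Longrightarrow> \<bar>deriv h z\<bar> \<le> B8"
    unfolding bounded_iff by (metis image_eqI real_norm_def)
  have B78: "B7 \<ge> 0" "B8 \<ge> 0" using B7[of z0] B8[of z0] R1 by auto
  define B where "B = 1 + B1 + B2 + B3 + B4 + B5 + B6 + B7 + B8"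
  have B': "B1 \<le> B" "B2 \<le> B" "B3 \<le> B" "B4 \<le> B" "B5 \<le> B" "B6 \<le> B" "B7 \<le> B" "B8 \<le> B" "0 < B"
    using B1(1) B2(1) B3(1) B4(1) B5(1) B6(1) B78 by (simp_all add: B_def)
  have 1: "\<bar>\<gamma> x\<bar> \<le> B \<and> \<bar>deriv \<gamma> x\<bar> \<le> B \<and> \<bar>deriv (deriv \<gamma>) x\<bar> \<le> B \<and>
      \<bar>f x\<bar> \<le> B \<and> \<bar>deriv f x\<bar> \<le> B \<and> v x \<le> B" for x
    using B1(2)[of x] B2(2)[of x] B3(2)[of x] B4(2)[of x] B5(2)[of x] B6(2)[of x] B' by linarith
  have 2: "\<bar>h (z0 + w)\<bar> \<le> B \<and> \<bar>deriv h (z0 + w)\<bar> \<le> B" if "\<bar>w\<bar> \<le> R1" for w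
    using B7[of "z0 + w"] B8[of "z0 + w"] B' that by (force simp: abs_le_iff)
  have all: "bound > 0 \<and> (\<forall>x. \<bar>\<gamma> x\<bar> \<le> bound \<and> \<bar>deriv \<gamma> x\<bar> \<le> bound \<and> \<bar>deriv (deriv \<gamma>) x\<bar> \<le> bound \<and>
      \<bar>f x\<bar> \<le> bound \<and> \<bar>deriv f x\<bar> \<le> bound \<and> v x \<le> bound) \<and>
    (\<forall>w. \<bar>w\<bar> \<le> R1 \<longrightarrow> \<bar>h (z0 + w)\<bar> \<le> bound \<and> \<bar>deriv h (z0 + w)\<bar> \<le> bound)"
    unfolding bound_def by (rule someI[of _ B]) (use 1 2 B' in blast)
  show "bound > 0" "\<bar>\<gamma> x\<bar> \<le> bound" "\<bar>deriv \<gamma> x\<bar> \<le> bound" "\<bar>deriv (deriv \<gamma>) x\<bar> \<le> bound"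
    "\<bar>f x\<bar> \<le> bound" "\<bar>deriv f x\<bar> \<le> bound" "v x \<le> bound"
    using all by blast+
  show "\<bar>h (z0 + w)\<bar> \<le> bound" "\<bar>deriv h (z0 + w)\<bar> \<le> bound" if "\<bar>w\<bar> \<le> R1"
    using all that by blast+
qed

text \<open>\<open>slow x w\<close> is \<open>dt/dx\<close> at the angle \<open>x\<close> when \<open>z = z0 + w\<close>.\<close>

definition "slow x w = 1 / sqrt (2 * (F x + d + H (z0 + w)))"

text \<open>\<open>slow1\<close> and \<open>slow2\<close> are the first and second derivatives of
  \<open>slow\<close> in \<open>w\<close>, written through \<open>slow\<close> itself.\<close>

definition "slow1 x w = - h (z0 + w) * (slow x w) ^ 3"

definition "slow2 x w = - deriv h (z0 + w) * (slow x w) ^ 3 - 3 * h (z0 + w) * (slow x w)\<^sup>2 * slow1 x w"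

lemma radicand_pos: "\<bar>w\<bar> \<le> R1 \<Longrightarrow> 0 < 2 * (F x + d + H (z0 + w))"
  using m_le[of w x] m by simp

lemma slow_pos: "\<bar>w\<bar> \<le> R1 \<Longrightarrow> 0 < slow x w"
  using radicand_pos by (simp add: slow_def)

lemma slow_0: "slow x 0 = 1 / v (s0 x)"
  by (simp add: slow_def v_s0 H_z0)

lemma slow_le:
  assumes "\<bar>w\<bar> \<le> R1" shows "\<bar>slow x w\<bar> \<le> 1 / sqrt (2 * m)"
proof -
  have "sqrt (2 * m) \<le> sqrt (2 * (F x + d + H (z0 + w)))"
    using m_le[OF assms, of x] by simp
  then show ?thesis using slow_pos[OF assms, of x] m by (simp add: slow_def frac_le)
qed

lemma slow_deriv:
  assumes "\<bar>w\<bar> \<le> R1"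
  shows "(slow x has_real_derivative slow1 x w) (at w)" "(slow1 x has_real_derivative slow2 x w) (at w)"
proof -
  have DHw: "((\<lambda>w. H (z0 + w)) has_real_derivative h (z0 + w)) (at w)"
    by (rule DERIV_chain2[OF DH, where g="\<lambda>w. z0 + w", THEN DERIV_cong]) (auto intro!: derivative_eq_intros)
  have Dhw: "((\<lambda>w. h (z0 + w)) has_real_derivative deriv h (z0 + w)) (at w)"
    by (rule DERIV_chain2[OF C2_D(1)[OF h], where g="\<lambda>w. z0 + w", THEN DERIV_cong]) (auto intro!: derivative_eq_intros)
  have q: "0 < 2 * (F x + d + H (z0 + w))" by (rule radicand_pos[OF assms])
  have sq: "((\<lambda>w. sqrt (2 * (F x + d + H (z0 + w)))) has_real_derivative h (z0 + w) / sqrt (2 * (F x + d + H (z0 + w)))) (at w)"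
  proof -
    have "((\<lambda>w. 2 * (F x + d + H (z0 + w))) has_real_derivative 2 * (0 + h (z0 + w))) (at w)"
      by (intro DERIV_cmult DERIV_add DERIV_const DHw)
    from DERIV_chain2[where f=sqrt and g="\<lambda>w. 2 * (F x + d + H (z0 + w))", OF DERIV_real_sqrt[OF q] this]
    show ?thesis by (rule DERIV_cong) (simp only: divide_inverse, simp)
  qed
  show 1: "(slow x has_real_derivative slow1 x w) (at w)"
    unfolding slow_def[abs_def] slow1_def
    by (rule DERIV_cong[OF DERIV_divide[OF DERIV_const sq]]) (use q in \<open>auto simp: power3_eq_cube\<close>)
  show "(slow1 x has_real_derivative slow2 x w) (at w)"
    unfolding slow1_def[abs_def]
    by (auto intro!: derivative_eq_intros Dhw 1 simp: slow2_def slow1_def[symmetric] power2_eq_square)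
qed

text \<open>The rate at which the time correction changes with the angle: \<open>s0\<close> already
  runs at the rate \<open>slow x 0\<close>, so only the difference is left.\<close>

definition "slow_diff x w = slow x w - slow x 0"

definition "forcing x w = \<gamma> (s0 x - \<alpha>0 + w)"

text \<open>At \<open>x = \<phi> t\<close> and \<open>w = u x\<close> this is
  \<open>\<psi> (t + a) - \<phi> t\<close>, that is minus the deviation, seen as a function of the
  angle.\<close>

definition "angle_defect x w = \<psi> (s0 x + w) - x"

lemma continuous_slow:
  assumes "continuous_on UNIV u" "\<And>x. \<bar>u x\<bar> \<le> R1"
  shows "continuous_on UNIV (\<lambda>x. slow x (u x))"
  unfolding slow_def
  by (intro continuous_intros assms)
    (metis radicand_pos[OF assms(2)] less_irrefl real_sqrt_eq_zero_cancel_iff)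

lemma nemytskii_slow: obtains C where "nemytskii_c2 slow_diff slow1 slow2 {-R1..R1} C"
proof -
  obtain B where B: "B > 0" and
    B7: "\<And>w. \<bar>w\<bar> \<le> R1 \<Longrightarrow> \<bar>h (z0 + w)\<bar> \<le> B" "\<And>w. \<bar>w\<bar> \<le> R1 \<Longrightarrow> \<bar>deriv h (z0 + w)\<bar> \<le> B"
    by (rule that[of bound]) (rule bound, assumption?)+
  define k where "k = 1 / sqrt (2 * m)"
  have k: "k \<ge> 0" using m by (simp add: k_def)
  have sk: "\<bar>slow x w\<bar> ^ n \<le> k ^ n" if "\<bar>w\<bar> \<le> R1" for x w n
    using slow_le[OF that, of x] by (simp add: k_def power_mono)
  define C1 where "C1 = B * k ^ 3"
  define C2 where "C2 = B * k ^ 3 + 3 * B * k\<^sup>2 * C1"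
  have C12: "C1 \<ge> 0" "C2 \<ge> 0" using B k by (auto simp: C1_def C2_def)
  have s1: "\<bar>slow1 x w\<bar> \<le> C1" if "\<bar>w\<bar> \<le> R1" for x w
    unfolding slow1_def C1_def abs_mult abs_minus_cancel power_abs
    by (intro mult_mono B7 sk that) (use B k in auto)
  have s2: "\<bar>slow2 x w\<bar> \<le> C2" if "\<bar>w\<bar> \<le> R1" for x w
  proof -
    have "\<bar>slow2 x w\<bar> \<le> \<bar>deriv h (z0 + w) * (slow x w) ^ 3\<bar> + \<bar>3 * h (z0 + w) * (slow x w)\<^sup>2 * slow1 x w\<bar>"
      unfolding slow2_def by simp
    also have "\<dots> \<le> C2"
      unfolding C2_def abs_mult power_abs abs_numeral
      by (intro add_mono mult_mono B7 sk s1 that) (use B k in auto)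
    finally show ?thesis .
  qed
  have "nemytskii_c2 slow_diff slow1 slow2 {-R1..R1} (C1 + C2)"
  proof
    show "(slow_diff x has_real_derivative slow1 x w) (at w)"
      "(slow1 x has_real_derivative slow2 x w) (at w)" if "w \<in> {-R1..R1}" for x w
      unfolding slow_diff_def[abs_def] using slow_deriv[of w x] that
      by (auto intro!: derivative_eq_intros)
    show "\<bar>slow1 x w\<bar> \<le> C1 + C2" "\<bar>slow2 x w\<bar> \<le> C1 + C2" if "w \<in> {-R1..R1}" for x w
      using s1[of w x] s2[of w x] C12 that by (auto simp: abs_le_iff)
    fix u :: "real \<Rightarrow> real" assume u: "continuous_on UNIV u" and "\<And>x. u x \<in> {-R1..R1}"
    then have uR: "\<bar>u x\<bar> \<le> R1" for x by (metis abs_le_iff atLeastAtMost_iff minus_le_iff)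
    have z: "\<bar>0\<bar> \<le> R1" using R1 by simp
    show "continuous_on UNIV (\<lambda>x. slow_diff x (u x))"
      unfolding slow_diff_def by (intro continuous_on_diff continuous_slow u uR z continuous_on_const)
    show "continuous_on UNIV (\<lambda>x. slow1 x (u x))"
      unfolding slow1_def by (intro continuous_intros continuous_slow u uR)
  qed (use R1 C12 in \<open>auto simp: slow_diff_def\<close>)
  then show ?thesis by (rule that)
qed

lemma nemytskii_forcing:
  obtains C where "nemytskii_c2 forcing (\<lambda>x w. deriv \<gamma> (s0 x - \<alpha>0 + w)) (\<lambda>x w. deriv (deriv \<gamma>) (s0 x - \<alpha>0 + w)) UNIV C"
proof -
  obtain B where B: "B > 0" "\<And>x. \<bar>\<gamma> x\<bar> \<le> B" "\<And>x. \<bar>deriv \<gamma> x\<bar> \<le> B" "\<And>x. \<bar>deriv (deriv \<gamma>) x\<bar> \<le> B"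
    by (rule that[of bound]) (rule bound, assumption?)+
  have "nemytskii_c2 forcing (\<lambda>x w. deriv \<gamma> (s0 x - \<alpha>0 + w)) (\<lambda>x w. deriv (deriv \<gamma>) (s0 x - \<alpha>0 + w)) UNIV B"
  proof
    show "(forcing x has_real_derivative deriv \<gamma> (s0 x - \<alpha>0 + w)) (at w)" for x w
      unfolding forcing_def[abs_def]
      by (rule DERIV_chain2[OF C2_D(1)[OF \<gamma>], THEN DERIV_cong]) (auto intro!: derivative_eq_intros)
    show "((\<lambda>w. deriv \<gamma> (s0 x - \<alpha>0 + w)) has_real_derivative deriv (deriv \<gamma>) (s0 x - \<alpha>0 + w)) (at w)" for x w
      by (rule DERIV_chain2[OF C2_D(2)[OF \<gamma>], THEN DERIV_cong]) (auto intro!: derivative_eq_intros)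
  qed (use B in \<open>auto simp: forcing_def intro!: continuous_intros\<close>)
  then show ?thesis by (rule that)
qed

lemma nemytskii_angle_defect:
  obtains C where "nemytskii_c2 angle_defect (\<lambda>x w. v (s0 x + w)) (\<lambda>x w. f (\<psi> (s0 x + w))) UNIV C"
proof -
  obtain B where B: "B > 0" "\<And>x. \<bar>f x\<bar> \<le> B" "\<And>t. v t \<le> B"
    by (rule that[of bound]) (rule bound, assumption?)+
  have "nemytskii_c2 angle_defect (\<lambda>x w. v (s0 x + w)) (\<lambda>x w. f (\<psi> (s0 x + w))) UNIV B"
  proof
    show "(angle_defect x has_real_derivative v (s0 x + w)) (at w)" for x w
      unfolding angle_defect_def[abs_def]
      by (auto intro!: derivative_eq_intros DERIV_chain2[OF \<psi>, THEN DERIV_cong])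
    show "((\<lambda>w. v (s0 x + w)) has_real_derivative f (\<psi> (s0 x + w))) (at w)" for x w
      by (rule DERIV_chain2[OF v, THEN DERIV_cong]) (auto intro!: derivative_eq_intros)
    show "\<bar>v (s0 x + w)\<bar> \<le> B" for x w using B(3) v_pos by (simp add: less_imp_le)
  qed (use B in \<open>auto simp: angle_defect_def \<psi>_s0 intro!: continuous_intros\<close>)
  then show ?thesis by (rule that)
qed

end


section \<open>The branch of solutions in angle coordinates\<close>

lemma bounded_linear_components:
  shows "bounded_linear (\<lambda>P::'a::real_normed_vector \<times> 'b::real_normed_vector \<times>
      'c::real_normed_vector \<times> 'd::real_normed_vector. fst (snd P))"
    "bounded_linear (\<lambda>P::'a \<times> 'b \<times> 'c \<times> 'd. fst (snd (snd P)))"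
    "bounded_linear (\<lambda>P::'a \<times> 'b \<times> 'c \<times> 'd. snd (snd (snd P)))"
  by (intro bounded_linear_compose[OF bounded_linear_fst]
      bounded_linear_compose[OF bounded_linear_snd] bounded_linear_snd)+

context rotator
begin

text \<open>For a solution \<open>\<phi>\<close> that is compared with the phase \<open>a\<close>, the unknowns are the correction \<open>u\<close> of the
  inverse function, \<open>t + a = s0 x + u x\<close> for \<open>x = \<phi> t\<close>, and \<open>disp\<close>, the difference of
  \<open>H\<^sup>-\<^sup>1 (energy - d)\<close> to its unperturbed value \<open>z0\<close>, whose value at the angle 0 is \<open>z\<close>. The
  predicate \<open>centred\<close> is the phase normalization.\<close>

definition "disp \<epsilon> u a z x = z + \<epsilon> * primitive (\<lambda>x. \<gamma> (s0 x + u x - a)) x"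

text \<open>The angle system in integrated form. Periodicity of \<open>u\<close> says that the time
  gained over \<open>L\<close> is exactly \<open>P\<close>. The integral of the forcing is kept
  without its factor \<open>\<epsilon>\<close>: for \<open>\<epsilon> \<noteq> 0\<close> its
  vanishing is the periodicity of \<open>disp\<close>, and for \<open>\<epsilon> = 0\<close> it
  still constrains the phase.\<close>

definition "branch \<epsilon> u a z \<longleftrightarrow> continuous_on UNIV u \<and> periodic L u \<and>
  primitive (\<lambda>x. \<gamma> (s0 x + u x - a)) L = 0 \<and> (\<forall>x. \<bar>disp \<epsilon> u a z x\<bar> \<le> R1) \<and>
  (\<forall>x. u x = u 0 + primitive (\<lambda>x. slow_diff x (disp \<epsilon> u a z x)) x)"

definition "centred u \<longleftrightarrow> primitive (\<lambda>x. angle_defect x (u x)) L = 0"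

lemma periodic_\<gamma>_s0:
  assumes "periodic L u" shows "periodic L (\<lambda>x. \<gamma> (s0 x + u x - a))"
proof -
  have "s0 (x + L) + u (x + L) - a = s0 x + u x - a + P" for x
    using assms by (simp add: shift_s0 periodic_def)
  then show ?thesis using per_\<gamma> by (simp only: periodic_def simp_thms)
qed

lemma periodic_slow_diff: "periodic L w \<Longrightarrow> periodic L (\<lambda>x. slow_diff x (w x))"
  using per_F by (simp add: periodic_def slow_diff_def slow_def)

text \<open>\<open>implicit_curve\<close> with parameter \<epsilon> and unknown
  \<open>(u, b, z)\<close>, where \<open>b = a - \<alpha>0\<close>. The correction \<open>u\<close>
  ranges over all bounded continuous functions; its periodicity comes out of the equation, because
  \<open>periodic_integral\<close> produces only periodic functions.\<close>

lemma solution_curve: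
  obtains r e \<alpha> U \<zeta> \<alpha>' where "r > 0" "e > 0" "\<alpha> 0 = \<alpha>0"
    "\<forall>\<epsilon>. \<bar>\<epsilon>\<bar> < e \<longrightarrow> branch \<epsilon> (apply_bcontfun (U \<epsilon>)) (\<alpha> \<epsilon>) (\<zeta> \<epsilon>) \<and>
      centred (apply_bcontfun (U \<epsilon>)) \<and> (\<alpha> has_vector_derivative \<alpha>' \<epsilon>) (at \<epsilon>)"
    "\<forall>\<epsilon> u a z. \<bar>\<epsilon>\<bar> < e \<and> (\<forall>x. \<bar>u x\<bar> \<le> r) \<and> \<bar>a - \<alpha>0\<bar> \<le> r \<and> \<bar>z\<bar> \<le> r \<and>
      branch \<epsilon> u a z \<and> centred u \<longrightarrow> u = apply_bcontfun (U \<epsilon>) \<and> a = \<alpha> \<epsilon>"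
    "continuous_on {-e<..<e} \<alpha>'"
    "((\<lambda>\<epsilon>. norm (U \<epsilon>)) \<longlongrightarrow> 0) (at 0)" "(\<zeta> \<longlongrightarrow> 0) (at 0)"
proof -
  obtain Cs where "nemytskii_c2 slow_diff slow1 slow2 {-R1..R1} Cs" using nemytskii_slow .
  then interpret sl: nemytskii_c2 slow_diff slow1 slow2 "{-R1..R1}" Cs .
  obtain Cf where "nemytskii_c2 forcing (\<lambda>x w. deriv \<gamma> (s0 x - \<alpha>0 + w)) (\<lambda>x w. deriv (deriv \<gamma>) (s0 x - \<alpha>0 + w)) UNIV Cf"
    using nemytskii_forcing .
  then interpret fo: nemytskii_c2 forcing "\<lambda>x w. deriv \<gamma> (s0 x - \<alpha>0 + w)" "\<lambda>x w. deriv (deriv \<gamma>) (s0 x - \<alpha>0 + w)" UNIV Cf .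
  obtain Ca where "nemytskii_c2 angle_defect (\<lambda>x w. v (s0 x + w)) (\<lambda>x w. f (\<psi> (s0 x + w))) UNIV Ca"
    using nemytskii_angle_defect .
  then interpret an: nemytskii_c2 angle_defect "\<lambda>x w. v (s0 x + w)" "\<lambda>x w. f (\<psi> (s0 x + w))" UNIV Ca .
  let ?J = "periodic_integral L"
  let ?I = "\<lambda>u :: real \<Rightarrow>\<^sub>C real. primitive (apply_bcontfun u) L"
  let ?c = "const_bcontfun :: real \<Rightarrow> real \<Rightarrow>\<^sub>C real"
  have blI: "bounded_linear ?I" using bounded_linear_primitive_bcontfun L by simp
  have blJ: "bounded_linear ?J" using bounded_linear_periodic_integral L by simp
  note blc = bounded_linear_const_bcontfun
  obtain B where B: "B > 0" "\<And>x. \<bar>\<gamma> x\<bar> \<le> B" by (rule that[of bound]) (rule bound, assumption?)+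
  \<comment> \<open>\<open>norm (G P)\<close> is at most \<open>B * (2 * L)\<close>, so on the box
    \<open>w P\<close> is bounded by \<open>R * (B * (2 * L)) + R \<le> R1\<close> and the radicand
    of \<open>slow\<close> stays positive.\<close>
  define R where "R = min 1 (R1 / (1 + B * (2 * L)))"
  have BL: "1 + B * (2 * L) > 0" using B L by (simp add: add_pos_pos)
  have "R \<le> R1 / (1 + B * (2 * L))" by (simp add: R_def)
  then have R: "R > 0" "R \<le> 1" "R * (1 + B * (2 * L)) \<le> R1"
    using R1 BL unfolding pos_le_divide_eq[OF BL] by (simp_all add: R_def)
  let ?S = "{P::real \<times> (real \<Rightarrow>\<^sub>C real) \<times> real \<times> real. \<bar>fst P\<bar> \<le> R \<and> norm (snd P) \<le> R}"
  define lin where "lin P = fst (snd P) - ?c (fst (snd (snd P)))"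
    for P :: "real \<times> (real \<Rightarrow>\<^sub>C real) \<times> real \<times> real"
  define G where "G P = ?J (nemytskii forcing (lin P))" for P
  \<comment> \<open>\<open>w\<close> stands in for \<open>disp\<close> and is periodic even off the
    solution set, thanks to folding and the removal of the mean. For periodic \<open>u\<close> and
    forcing with zero integral over \<open>L\<close> the two agree.\<close>
  define w where "w P = fst P *\<^sub>R G P + ?c (snd (snd (snd P)))" for P
  \<comment> \<open>\<open>u - u 0\<close> loses the constants, so the scalar centring condition is
    put back as a constant function. The two conditions can be separated again, since at the angle 0
    all other terms vanish.\<close>
  define F1 where "F1 P = (fst (snd P) - ?c (apply_bcontfun (fst (snd P)) 0))
      + (- ?J (nemytskii slow_diff (w P)) + ?c (?I (nemytskii angle_defect (fst (snd P)))))" for P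
  define FF where "FF P = (F1 P, ?I (nemytskii slow_diff (w P)), ?I (nemytskii forcing (lin P)))" for P
  have G_le: "norm (G P) \<le> B * (2 * L)" for P
  proof -
    have "norm (nemytskii forcing (lin P)) \<le> B"
      by (rule norm_bound) (simp add: fo.apply_nemytskii forcing_def B)
    then have "norm (nemytskii forcing (lin P)) * (2 * L) \<le> B * (2 * L)"
      using L by (intro mult_right_mono) auto
    then show ?thesis unfolding G_def using norm_periodic_integral[OF L] order_trans by blast
  qed
  have w_dom: "w P \<in> sl.dom" if "P \<in> ?S" for P
  proof -
    have "norm (w P) \<le> \<bar>fst P\<bar> * norm (G P) + \<bar>snd (snd (snd P))\<bar>"
    proof -
      have "norm (?c z) \<le> \<bar>z\<bar>" for z by (rule norm_bound) simp
      then show ?thesis unfolding w_def by (intro norm_triangle_le add_mono) auto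
    qed
    also have "\<bar>fst P\<bar> * norm (G P) \<le> R * (B * (2 * L))"
      by (intro mult_mono G_le) (use that R in auto)
    also have "\<bar>snd (snd (snd P))\<bar> \<le> R"
      using that norm_snd_le[of "snd (snd P)"] norm_snd_le[of "snd P"]
      by (metis (mono_tags, lifting) mem_Collect_eq norm_snd_le order_trans prod.collapse real_norm_def)
    finally have "norm (w P) \<le> R1" using R(3) by (simp add: algebra_simps)
    then have "\<bar>apply_bcontfun (w P) x\<bar> \<le> R1" for x using bcontfun_real_bound order_trans by blast
    then show ?thesis by (auto simp: abs_le_iff) (metis minus_le_iff)
  qed
  have bl_lin: "bounded_linear lin"
    unfolding lin_def by (intro bounded_linear_sub bounded_linear_components bounded_linear_compose[OF blc])
  let ?DG = "\<lambda>P dP. ?J (fo.D (lin P) (lin dP))"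
  have c11G: "c11_on ?S G ?DG"
    unfolding G_def
    by (intro c11_on_linear_compose[OF blJ] c11_on_compose[OF c11_on_bounded_linear[OF bl_lin] fo.c11]) auto
  let ?Dw = "\<lambda>P dP. (fst P *\<^sub>R ?DG P dP + fst dP *\<^sub>R G P) + ?c (snd (snd (snd dP)))"
  have BL0: "B * (2 * L) \<ge> 0" using B L by simp
  have MB: "\<bar>fst P\<bar> \<le> 1 + B * (2 * L)" "norm (G P) \<le> 1 + B * (2 * L)" if "P \<in> ?S" for P
    using that R(2) BL0 G_le[of P] by auto
  have c11w: "c11_on ?S w ?Dw"
    unfolding w_def
    by (intro c11_on_add c11_on_scaleR[OF c11_on_bounded_linear[OF bounded_linear_fst] c11G, where M="1 + B * (2 * L)"]
        c11_on_bounded_linear bounded_linear_compose[OF blc] bounded_linear_components)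
      (use MB BL in auto)
  let ?Dsl = "\<lambda>P dP. sl.D (w P) (?Dw P dP)"
  have c11sl: "c11_on ?S (\<lambda>P. nemytskii slow_diff (w P)) ?Dsl"
    by (rule c11_on_compose[OF c11w sl.c11]) (use w_dom in blast)
  let ?Dan = "\<lambda>P dP. an.D (fst (snd P)) (fst (snd dP))"
  have c11an: "c11_on ?S (\<lambda>P. nemytskii angle_defect (fst (snd P))) ?Dan"
    by (rule c11_on_compose[OF c11_on_bounded_linear[OF bounded_linear_components(1)] an.c11]) auto
  let ?D = "\<lambda>P dP. ((fst (snd dP) - ?c (apply_bcontfun (fst (snd dP)) 0))
      + (- ?J (?Dsl P dP) + ?c (?I (?Dan P dP))), ?I (?Dsl P dP), ?I (fo.D (lin P) (lin dP)))"
  have c11: "c11_on ?S FF ?D"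
    unfolding FF_def F1_def
    by (intro c11_on_Pair c11_on_add c11_on_linear_compose[OF bounded_linear_minus[OF blJ] c11sl]
        c11_on_linear_compose[OF bounded_linear_compose[OF blc blI] c11an]
        c11_on_linear_compose[OF blI c11sl]
        c11_on_linear_compose[OF blI c11_on_compose[OF c11_on_bounded_linear[OF bl_lin] fo.c11]]
        c11_on_bounded_linear bounded_linear_sub bounded_linear_components
        bounded_linear_compose[OF blc] bounded_linear_compose[OF bounded_linear_eval_bcontfun])
      auto
  have zero_dom: "(0 :: real \<Rightarrow>\<^sub>C real) \<in> sl.dom" using R1 by auto
  have lin0 [simp]: "lin 0 = 0" by (simp add: lin_def)
  have w0 [simp]: "w 0 = 0" by (simp add: w_def)
  have FF0: "FF 0 = 0"
  proof -
    have "nemytskii slow_diff 0 = 0"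
      by (rule bcontfun_eqI) (simp add: sl.apply_nemytskii[OF zero_dom] slow_diff_def)
    moreover have "nemytskii angle_defect 0 = 0"
      by (rule bcontfun_eqI) (simp add: an.apply_nemytskii angle_defect_def \<psi>_s0)
    moreover have "apply_bcontfun (nemytskii forcing 0) = (\<lambda>x. \<gamma> (s0 x - \<alpha>0))"
      by (rule ext) (simp add: fo.apply_nemytskii forcing_def)
    moreover have "?J 0 = 0" "?I 0 = 0" "?c 0 = 0"
      using blJ primitive_const[of 0 L] by (auto simp: linear_simps)
    ultimately show ?thesis
      by (simp add: FF_def F1_def melnikov_zero) (simp add: zero_prod_def)
  qed
  \<comment> \<open>Entries of the linearization at the origin: \<open>Pa\<close> and
    \<open>Pf\<close> are the responses to \<open>u\<close> of the centring integral and of the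
    forcing integral; \<open>K\<close> and \<open>\<kappa>\<close> are the responses to
    \<open>z\<close> of the periodic part of the time and of the period.\<close>
  define Pa where "Pa u = ?I (an.D 0 u)" for u
  define Pf where "Pf u = ?I (fo.D 0 u)" for u
  define K where "K = ?J (sl.D 0 (?c 1))"
  define \<kappa> where "\<kappa> = ?I (sl.D 0 (?c 1))"
  have blPa: "bounded_linear Pa" unfolding Pa_def
    by (rule bounded_linear_compose[OF blI]) (use an.c11 in \<open>simp add: c11_on_def\<close>)
  have blPf: "bounded_linear Pf" unfolding Pf_def
    by (rule bounded_linear_compose[OF blI]) (use fo.c11 in \<open>simp add: c11_on_def\<close>)
  have blsl: "bounded_linear (sl.D 0)" using sl.c11 zero_dom by (simp add: c11_on_def)
  have \<kappa>: "\<kappa> \<noteq> 0"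
  proof -
    obtain \<xi> where "\<kappa> = L * apply_bcontfun (sl.D 0 (?c 1)) \<xi>"
      unfolding \<kappa>_def using primitive_mean_value[OF continuous_on_apply_bcontfun L] by metis
    moreover have "apply_bcontfun (sl.D 0 (?c 1)) \<xi> = - h z0 * (slow \<xi> 0) ^ 3"
      by (simp add: sl.apply_D[OF zero_dom] slow1_def)
    moreover have "slow \<xi> 0 > 0" using R1 by (intro slow_pos) auto
    ultimately show ?thesis using L h_nz[OF in_I[of z0]] R1 by simp
  qed
  have Pa1: "Pa (?c 1) \<noteq> 0"
  proof -
    obtain \<xi> where "Pa (?c 1) = L * apply_bcontfun (an.D 0 (?c 1)) \<xi>"
      unfolding Pa_def using primitive_mean_value[OF continuous_on_apply_bcontfun L] by metis
    then show ?thesis using L v_pos[of "s0 \<xi>"] by (simp add: an.apply_D)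
  qed
  have Pf1: "Pf (?c 1) \<noteq> 0"
  proof -
    have "apply_bcontfun (fo.D 0 (?c 1)) = (\<lambda>x. deriv \<gamma> (s0 x - \<alpha>0))"
      by (rule ext) (simp add: fo.apply_D)
    then show ?thesis using melnikov_simple by (simp add: Pf_def)
  qed
  have c_eq: "?c x = x *\<^sub>R ?c 1" for x by (rule bcontfun_eqI) simp
  \<comment> \<open>Back substitution in the triangular system. The second component gives
    \<open>z\<close>, which removes \<open>K\<close> from the first; what is left is
    \<open>u - u 0\<close>, called \<open>q\<close>. The first component has the value
    \<open>Pa u\<close> at the angle 0, which fixes the constant \<open>u 0\<close> because
    \<open>Pa (?c 1) \<noteq> 0\<close>; the third component then yields the phase.\<close>
  define q where "q y = fst y - ?c (apply_bcontfun (fst y) 0) + (fst (snd y) / \<kappa>) *\<^sub>R K"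
    for y :: "(real \<Rightarrow>\<^sub>C real) \<times> real \<times> real"
  define uu where "uu y = q y + ?c ((apply_bcontfun (fst y) 0 - Pa (q y)) / Pa (?c 1))" for y
  define BB where "BB y = (uu y, (Pf (uu y) - snd (snd y)) / Pf (?c 1), fst (snd y) / \<kappa>)" for y
  have bl_fs: "bounded_linear (\<lambda>y::(real \<Rightarrow>\<^sub>C real) \<times> real \<times> real. fst (snd y))"
    "bounded_linear (\<lambda>y::(real \<Rightarrow>\<^sub>C real) \<times> real \<times> real. snd (snd y))"
    by (intro bounded_linear_compose[OF bounded_linear_fst bounded_linear_snd]
        bounded_linear_compose[OF bounded_linear_snd bounded_linear_snd])+
  have bl_div: "bounded_linear (\<lambda>y. T y / t)" if "bounded_linear T"
    for T :: "(real \<Rightarrow>\<^sub>C real) \<times> real \<times> real \<Rightarrow> real" and t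
    unfolding divide_inverse by (rule bounded_linear_mult_const[OF that])
  have bl_q: "bounded_linear q" unfolding q_def
    by (intro bounded_linear_add bounded_linear_sub bounded_linear_fst bounded_linear_compose[OF blc]
        bounded_linear_compose[OF bounded_linear_eval_bcontfun] bounded_linear_scaleR_const bl_div bl_fs)
  have bl_uu: "bounded_linear uu" unfolding uu_def
    by (intro bounded_linear_add bounded_linear_sub bounded_linear_fst bounded_linear_compose[OF blc]
        bounded_linear_compose[OF bounded_linear_eval_bcontfun] bounded_linear_compose[OF blPa] bl_q bl_div)
  have bl_BB: "bounded_linear BB" unfolding BB_def
    by (intro bounded_linear_Pair bl_uu bl_div bl_fs bounded_linear_sub bounded_linear_compose[OF blPf])
  have K0: "apply_bcontfun K 0 = 0" by (simp add: K_def L)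
  have BBD: "BB (?D 0 (0, y)) = y" for y
  proof -
    obtain u b z where y: "y = (u, b, z)" by (metis prod.collapse)
    have sl_z: "sl.D 0 (?c z) = z *\<^sub>R sl.D 0 (?c 1)"
      by (subst c_eq) (use blsl in \<open>simp add: linear_simps\<close>)
    have D: "?D 0 (0, y) = (u - ?c (apply_bcontfun u 0) + (- (z *\<^sub>R K) + ?c (Pa u)), z * \<kappa>, Pf u - b * Pf (?c 1))"
    proof -
      have "?J (sl.D 0 (?c z)) = z *\<^sub>R K" unfolding sl_z K_def using blJ by (simp add: linear_simps)
      moreover have "?I (sl.D 0 (?c z)) = z * \<kappa>" unfolding sl_z \<kappa>_def by (simp add: primitive_cmult)
      moreover have "?I (fo.D 0 (u - ?c b)) = Pf u - b * Pf (?c 1)"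
        unfolding Pf_def[symmetric] using blPf by (subst c_eq) (simp add: linear_simps)
      ultimately show ?thesis by (simp add: y Pa_def lin_def)
    qed
    have q: "q (?D 0 (0, y)) = u - ?c (apply_bcontfun u 0)"
      unfolding D q_def by (rule bcontfun_eqI) (simp add: K0 \<kappa>)
    have "Pa (q (?D 0 (0, y))) = Pa u - apply_bcontfun u 0 * Pa (?c 1)"
      unfolding q using blPa by (subst c_eq) (simp add: linear_simps)
    then have u: "uu (?D 0 (0, y)) = u"
      unfolding uu_def q unfolding D by (intro bcontfun_eqI) (simp add: K0 Pa1)
    show ?thesis
      unfolding BB_def u unfolding D by (simp add: y \<kappa> Pf1)
  qed
  have BB0: "y = 0" if "BB y = 0" for y
  proof -
    obtain g n k where y: "y = (g, n, k)" by (metis prod.collapse)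
    have n: "n = 0" using that \<kappa> by (simp add: BB_def y zero_prod_def)
    have uu0: "uu y = 0" using that by (simp add: BB_def zero_prod_def)
    have "(Pf (uu y) - snd (snd y)) / Pf (?c 1) = 0" using that unfolding BB_def zero_prod_def by blast
    then have "Pf (uu y) = k" using Pf1 by (simp add: y)
    then have k: "k = 0" using blPf by (simp add: uu0 linear_simps)
    define t where "t = (apply_bcontfun g 0 - Pa (q y)) / Pa (?c 1)"
    have qx: "apply_bcontfun (q y) x = apply_bcontfun g x - apply_bcontfun g 0" for x
      by (simp add: q_def y n)
    have "apply_bcontfun (uu y) x = 0" for x using uu0 by simp
    then have *: "apply_bcontfun g x - apply_bcontfun g 0 + t = 0" for x
      by (simp add: uu_def qx t_def) (simp add: y)
    have t0: "t = 0" using *[of 0] by simp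
    then have "q y = 0" using * qx by (intro bcontfun_eqI) simp
    then have "apply_bcontfun g 0 = 0" using t0 Pa1 blPa by (simp add: t_def linear_simps)
    then have "g = 0" using * t0 by (intro bcontfun_eqI) simp
    then show ?thesis by (simp add: y n k zero_prod_def)
  qed
  obtain r e X X' where X: "0 < r" "r \<le> R" "0 < e" "e \<le> R" "X 0 = 0"
    "\<And>s. \<bar>s\<bar> < e \<Longrightarrow> norm (X s) \<le> r \<and> FF (s, X s) = 0"
    "\<And>s Y. \<bar>s\<bar> < e \<Longrightarrow> norm Y \<le> r \<Longrightarrow> FF (s, Y) = 0 \<Longrightarrow> Y = X s"
    "\<And>s. \<bar>s\<bar> < e \<Longrightarrow> (X has_vector_derivative X' s) (at s)"
    "continuous_on {-e<..<e} X'"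
    by (rule implicit_curve[where F=FF and D="?D" and B=BB, OF c11 R(1) FF0 bl_BB BBD BB0]) blast+
  have app: "apply_bcontfun (nemytskii forcing u) = (\<lambda>x. forcing x (apply_bcontfun u x))"
    "apply_bcontfun (nemytskii angle_defect u) = (\<lambda>x. angle_defect x (apply_bcontfun u x))" for u
    by (auto simp: fo.apply_nemytskii an.apply_nemytskii)
  have forcing_lin: "forcing x (apply_bcontfun (lin (\<epsilon>, u, b, z)) x) = \<gamma> (s0 x + apply_bcontfun u x - (\<alpha>0 + b))"
    for x \<epsilon> u b z by (simp add: forcing_def lin_def algebra_simps)
  have w_disp: "apply_bcontfun (w (\<epsilon>, u, b, z)) x = disp \<epsilon> (apply_bcontfun u) (\<alpha>0 + b) z x"
    if "periodic L (apply_bcontfun u)" "primitive (\<lambda>x. \<gamma> (s0 x + apply_bcontfun u x - (\<alpha>0 + b))) L = 0"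
    for \<epsilon> u b z x
  proof -
    let ?n = "nemytskii forcing (lin (\<epsilon>, u, b, z))"
    have n: "apply_bcontfun ?n = (\<lambda>x. \<gamma> (s0 x + apply_bcontfun u x - (\<alpha>0 + b)))"
      by (simp add: app forcing_lin)
    have "apply_bcontfun (?J ?n) x = primitive (apply_bcontfun ?n) x"
      using apply_periodic_integral_periodic[OF L, of ?n x] periodic_\<gamma>_s0[OF that(1)] that(2)
      by (simp add: n)
    then show ?thesis by (simp add: w_def G_def disp_def n)
  qed
  have equiv: "FF (\<epsilon>, u, b, z) = 0 \<longleftrightarrow> branch \<epsilon> (apply_bcontfun u) (\<alpha>0 + b) z \<and> centred (apply_bcontfun u)"
    if S: "(\<epsilon>, u, b, z) \<in> ?S" for \<epsilon> u b z
  proof -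
    let ?P = "(\<epsilon>, u, b, z)"
    let ?n = "nemytskii slow_diff (w ?P)"
    have n: "apply_bcontfun ?n = (\<lambda>x. slow_diff x (apply_bcontfun (w ?P) x))"
      using sl.apply_nemytskii[OF w_dom[OF S]] by auto
    have f3: "?I (nemytskii forcing (lin ?P)) = primitive (\<lambda>x. \<gamma> (s0 x + apply_bcontfun u x - (\<alpha>0 + b))) L"
      by (simp add: app forcing_lin)
    have a: "?I (nemytskii angle_defect u) = primitive (\<lambda>x. angle_defect x (apply_bcontfun u x)) L"
      by (simp add: app)
    have F1x: "apply_bcontfun (F1 ?P) x = apply_bcontfun u x - apply_bcontfun u 0 - apply_bcontfun (?J ?n) x
        + primitive (\<lambda>x. angle_defect x (apply_bcontfun u x)) L" for x
      by (simp add: F1_def a)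
    have wR: "\<bar>apply_bcontfun (w ?P) x\<bar> \<le> R1" for x using w_dom[OF S] by (auto simp: abs_le_iff) (metis minus_le_iff)
    \<comment> \<open>Both periodic integrals become ordinary primitives here, because their
      arguments are periodic and integrate to zero over \<open>L\<close>.\<close>
    have key: "apply_bcontfun (?J ?n) x = primitive (\<lambda>x. slow_diff x (disp \<epsilon> (apply_bcontfun u) (\<alpha>0 + b) z x)) x"
      if "periodic L (apply_bcontfun u)" "primitive (\<lambda>x. \<gamma> (s0 x + apply_bcontfun u x - (\<alpha>0 + b))) L = 0"
        "primitive (\<lambda>x. slow_diff x (disp \<epsilon> (apply_bcontfun u) (\<alpha>0 + b) z x)) L = 0" for x
    proof -
      have w': "apply_bcontfun (w ?P) = disp \<epsilon> (apply_bcontfun u) (\<alpha>0 + b) z"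
        using w_disp[OF that(1,2)] by auto
      have "periodic L (apply_bcontfun (w ?P))"
        using periodic_periodic_integral[OF L] by (simp add: w_def G_def periodic_def)
      then have "periodic L (apply_bcontfun ?n)" unfolding n by (rule periodic_slow_diff)
      from apply_periodic_integral_periodic[OF L this] that(3) show ?thesis
        by (simp add: n w')
    qed
    show ?thesis
    proof
      assume "FF ?P = 0"
      then have F: "F1 ?P = 0" "?I ?n = 0" "?I (nemytskii forcing (lin ?P)) = 0"
        by (auto simp: FF_def zero_prod_def)
      \<comment> \<open>At 0 the terms with \<open>u\<close> cancel and the periodic integral
        vanishes, which isolates the centring integral.\<close>
      have cen: "primitive (\<lambda>x. angle_defect x (apply_bcontfun u x)) L = 0"
        using F1x[of 0] F(1) L by simp
      have ux: "apply_bcontfun u x = apply_bcontfun u 0 + apply_bcontfun (?J ?n) x" for x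
        using F1x[of x] F(1) cen by simp
      have per: "periodic L (apply_bcontfun u)"
        unfolding periodic_def
      proof
        show "apply_bcontfun u (t + L) = apply_bcontfun u t" for t
          using ux[of t] ux[of "t + L"] periodic_periodic_integral[OF L, of ?n] by (simp add: periodic_def)
      qed
      note f30 = F(3)[unfolded f3]
      have w': "apply_bcontfun (w ?P) = disp \<epsilon> (apply_bcontfun u) (\<alpha>0 + b) z"
        using w_disp[OF per f30] by auto
      have F2: "primitive (\<lambda>x. slow_diff x (disp \<epsilon> (apply_bcontfun u) (\<alpha>0 + b) z x)) L = 0"
        using F(2) by (simp add: n w')
      show "branch \<epsilon> (apply_bcontfun u) (\<alpha>0 + b) z \<and> centred (apply_bcontfun u)"
        unfolding branch_def centred_def
      proof (intro conjI allI)
        show "\<bar>disp \<epsilon> (apply_bcontfun u) (\<alpha>0 + b) z x\<bar> \<le> R1" for x using wR[of x] by (simp add: w')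
        show "apply_bcontfun u x = apply_bcontfun u 0 +
            primitive (\<lambda>x. slow_diff x (disp \<epsilon> (apply_bcontfun u) (\<alpha>0 + b) z x)) x" for x
          using ux[of x] key[OF per f30 F2, of x] by simp
      qed (use per f30 cen in auto)
    next
      assume "branch \<epsilon> (apply_bcontfun u) (\<alpha>0 + b) z \<and> centred (apply_bcontfun u)"
      then have per: "periodic L (apply_bcontfun u)"
        and f30: "primitive (\<lambda>x. \<gamma> (s0 x + apply_bcontfun u x - (\<alpha>0 + b))) L = 0"
        and ux: "\<And>x. apply_bcontfun u x = apply_bcontfun u 0 +
            primitive (\<lambda>x. slow_diff x (disp \<epsilon> (apply_bcontfun u) (\<alpha>0 + b) z x)) x"
        and cen: "primitive (\<lambda>x. angle_defect x (apply_bcontfun u x)) L = 0"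
        unfolding branch_def centred_def by blast+
      have F2: "primitive (\<lambda>x. slow_diff x (disp \<epsilon> (apply_bcontfun u) (\<alpha>0 + b) z x)) L = 0"
        using ux[of L] per[unfolded periodic_def, rule_format, of 0] by simp
      have "apply_bcontfun (F1 ?P) x = 0" for x
        unfolding F1x key[OF per f30 F2] using ux[of x] cen by simp
      then have "F1 ?P = 0" by (intro bcontfun_eqI) simp
      moreover have "?I ?n = 0" using F2 w_disp[OF per f30] by (simp add: n)
      ultimately show "FF ?P = 0" by (simp add: FF_def f3 f30 zero_prod_def)
    qed
  qed
  define U b \<zeta> where "U s = fst (X s)" and "b s = fst (snd (X s))" and "\<zeta> s = snd (snd (X s))" for s
  have X_eq: "X s = (U s, b s, \<zeta> s)" for s by (simp add: U_def b_def \<zeta>_def)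
  have main: "branch s (apply_bcontfun (U s)) (\<alpha>0 + b s) (\<zeta> s) \<and> centred (apply_bcontfun (U s))"
    if "\<bar>s\<bar> < e" for s
    by (rule equiv[THEN iffD1]) (use X(6)[OF that] X(2,4) that in \<open>auto simp: X_eq\<close>)
  have a0: "\<alpha>0 + b 0 = \<alpha>0" by (simp add: b_def X(5))
  have br: "branch s (apply_bcontfun (U s)) (\<alpha>0 + b s) (\<zeta> s)"
    and ce: "centred (apply_bcontfun (U s))"
    if "\<bar>s\<bar> < e" for s using main[OF that] by blast+
  \<comment> \<open>The norm of the triple is at most the sum of the three norms, hence the radius
    \<open>r / 3\<close>.\<close>
  have un: "u = apply_bcontfun (U s) \<and> a = \<alpha>0 + b s"
    if s: "\<bar>s\<bar> < e" and u: "\<And>x. \<bar>u x\<bar> \<le> r / 3" and a: "\<bar>a - \<alpha>0\<bar> \<le> r / 3" and z: "\<bar>z\<bar> \<le> r / 3"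
      and br: "branch s u a z" and ce: "centred u" for s u a z
  proof -
    have cu: "continuous_on UNIV u" using br unfolding branch_def by blast
    define u' where "u' = Bcontfun u"
    have u': "apply_bcontfun u' = u" unfolding u'_def by (rule apply_Bcontfun_real[OF cu u])
    have "norm u' \<le> r / 3" by (rule norm_bound) (simp only: u' real_norm_def u)
    then have n: "norm (u', a - \<alpha>0, z) \<le> r"
      using norm_Pair_le[of u' "(a - \<alpha>0, z)"] norm_Pair_le[of "a - \<alpha>0" z] a z by simp
    have "FF (s, u', a - \<alpha>0, z) = 0"
      by (rule equiv[THEN iffD2]) (use n s X(2,4) br ce in \<open>auto simp: u'\<close>)
    from X(7)[OF s n this] show ?thesis by (auto simp: X_eq u'[symmetric])
  qed
  have de: "((\<lambda>s. \<alpha>0 + b s) has_vector_derivative fst (snd (X' s))) (at s)" if "\<bar>s\<bar> < e" for s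
  proof -
    have "((\<lambda>s. fst (snd (X s))) has_vector_derivative fst (snd (X' s))) (at s)"
      by (rule bounded_linear.has_vector_derivative[OF _ X(8)[OF that]])
        (intro bounded_linear_compose[OF bounded_linear_fst bounded_linear_snd])
    then show ?thesis unfolding b_def by (auto intro!: derivative_eq_intros)
  qed
  have co: "continuous_on {-e<..<e} (\<lambda>s. fst (snd (X' s)))"
    by (intro continuous_intros X(9))
  have "isCont X 0"
    using X(8)[of 0] X(3) by (auto intro: has_vector_derivative_continuous)
  then have "(X \<longlongrightarrow> 0) (at 0)" by (simp add: isCont_def X(5))
  then have t1: "((\<lambda>s. norm (U s)) \<longlongrightarrow> 0) (at 0)" and t2: "(\<zeta> \<longlongrightarrow> 0) (at 0)"
    unfolding U_def \<zeta>_def by (auto intro!: tendsto_eq_intros)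
  have r3: "r / 3 > 0" using X(1) by simp
  show ?thesis
  proof (rule that[of "r / 3" e "\<lambda>s. \<alpha>0 + b s" U \<zeta> "\<lambda>s. fst (snd (X' s))"])
    show "\<forall>s. \<bar>s\<bar> < e \<longrightarrow> branch s (apply_bcontfun (U s)) (\<alpha>0 + b s) (\<zeta> s) \<and>
      centred (apply_bcontfun (U s)) \<and> ((\<lambda>s. \<alpha>0 + b s) has_vector_derivative fst (snd (X' s))) (at s)"
      using br ce de by blast
    show "\<forall>s u a z. \<bar>s\<bar> < e \<and> (\<forall>x. \<bar>u x\<bar> \<le> r / 3) \<and> \<bar>a - \<alpha>0\<bar> \<le> r / 3 \<and> \<bar>z\<bar> \<le> r / 3 \<and>
      branch s u a z \<and> centred u \<longrightarrow> u = apply_bcontfun (U s) \<and> a = \<alpha>0 + b s"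
      using un by blast
  qed (fact r3, fact X(3), fact a0, fact co, fact t1, fact t2)
qed

end


section \<open>From angle coordinates to the second order equation\<close>

text \<open>A vanishing integral over a period makes the primitive periodic, so the bound on one
  period holds on the whole line.\<close>

lemma primitive_zero_mean_bound:
  assumes "continuous_on UNIV g" "periodic L g" "L > 0" "primitive g L = 0" "\<And>x. \<bar>g x\<bar> \<le> C"
  shows "\<bar>primitive g x\<bar> \<le> C * L"
proof -
  have "periodic L (primitive g)"
    using primitive_periodic[OF assms(1,2)] assms(4) by (simp add: periodic_def)
  from periodic_of_int[OF this, of x "- \<lfloor>x / L\<rfloor>"]
  have "primitive g x = primitive g (x - L * of_int \<lfloor>x / L\<rfloor>)" by (simp add: mult.commute)
  moreover have "\<bar>primitive g (x - L * of_int \<lfloor>x / L\<rfloor>)\<bar> \<le> C * (x - L * of_int \<lfloor>x / L\<rfloor>)"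
    by (rule primitive_bound[OF assms(1) fold_bounds(1)[OF assms(3)] assms(5)])
  moreover have "C \<ge> 0" using assms(5)[of 0] by linarith
  ultimately show ?thesis using mult_left_mono[OF fold_bounds(2)[OF assms(3), of x]] by fastforce
qed

lemma abs_sqrt_diff_le:
  assumes "x \<ge> m" "y \<ge> m" "m > 0"
  shows "\<bar>sqrt x - sqrt y\<bar> \<le> \<bar>x - y\<bar> / sqrt m"
proof -
  have "(sqrt x - sqrt y) * (sqrt x + sqrt y) = x - y"
    using assms by (simp add: algebra_simps)
  then have "\<bar>x - y\<bar> = \<bar>sqrt x - sqrt y\<bar> * (sqrt x + sqrt y)"
    using assms by (metis abs_mult abs_of_nonneg add_nonneg_nonneg real_sqrt_ge_zero less_imp_le order_trans)
  also have "\<dots> \<ge> \<bar>sqrt x - sqrt y\<bar> * sqrt m"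
    using assms real_sqrt_le_mono[OF assms(1)] by (intro mult_left_mono add_increasing2) auto
  finally show ?thesis using assms(3) by (simp add: pos_le_divide_eq)
qed

lemma norm0_le: "(\<And>t. \<bar>u t\<bar> \<le> C) \<Longrightarrow> norm0 u \<le> C"
  unfolding norm0_def by (rule cSUP_least) auto

lemma abs_le_norm0:
  assumes "\<And>t. \<bar>u t\<bar> \<le> C" shows "\<bar>u t\<bar> \<le> norm0 u"
  unfolding norm0_def by (rule cSUP_upper) (use assms in \<open>auto intro!: bdd_aboveI\<close>)

context rotator
begin

definition follows :: "(real \<Rightarrow> real) \<Rightarrow> (real \<Rightarrow> real) \<Rightarrow> real \<Rightarrow> bool" where
  "follows \<phi> u a \<longleftrightarrow> (\<forall>x. \<phi> (s0 x + u x - a) = x) \<and> (\<forall>t. s0 (\<phi> t) + u (\<phi> t) - a = t)"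

lemma z0_in_I: "z0 \<in> I" using in_I[of z0] R1 by simp

lemma deriv_\<psi>: "deriv \<psi> = v" using \<psi> by (auto intro: DERIV_imp_deriv)

lemma follows_unique: "follows \<phi> u a \<Longrightarrow> follows \<phi>' u a \<Longrightarrow> \<phi> = \<phi>'"
  unfolding follows_def by (metis ext)

lemma branch_D:
  assumes "branch \<epsilon> u a z"
  shows "continuous_on UNIV u" "periodic L u" "primitive (\<lambda>x. \<gamma> (s0 x + u x - a)) L = 0"
    "\<bar>disp \<epsilon> u a z x\<bar> \<le> R1" "u x = u 0 + primitive (\<lambda>x. slow_diff x (disp \<epsilon> u a z x)) x"
  using assms unfolding branch_def by blast+

lemma disp_deriv:
  assumes "continuous_on UNIV u"
  shows "(disp \<epsilon> u a z has_real_derivative \<epsilon> * \<gamma> (s0 x + u x - a)) (at x)"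
proof -
  have "(primitive (\<lambda>x. \<gamma> (s0 x + u x - a)) has_real_derivative \<gamma> (s0 x + u x - a)) (at x)"
    by (rule primitive_has_derivative) (intro continuous_intros assms)
  then show ?thesis unfolding disp_def[abs_def] by (auto intro!: derivative_eq_intros)
qed

lemma continuous_disp:
  assumes "continuous_on UNIV u" shows "continuous_on UNIV (disp \<epsilon> u a z)"
  using disp_deriv[OF assms] by (meson DERIV_isCont continuous_at_imp_continuous_on)

lemma branch_time_deriv:
  assumes br: "branch \<epsilon> u a z"
  shows "((\<lambda>x. s0 x + u x - a) has_real_derivative slow x (disp \<epsilon> u a z x)) (at x)"
proof -
  note bd = branch_D[OF br]
  have z: "\<bar>0\<bar> \<le> R1" using R1 by simp
  have c: "continuous_on UNIV (\<lambda>x. slow_diff x (disp \<epsilon> u a z x))"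
    unfolding slow_diff_def
    by (intro continuous_on_diff continuous_slow continuous_disp bd continuous_on_const z)
  have eq: "u = (\<lambda>x. u 0 + primitive (\<lambda>x. slow_diff x (disp \<epsilon> u a z x)) x)"
    using bd(5) by blast
  have "((\<lambda>x. u 0 + primitive (\<lambda>x. slow_diff x (disp \<epsilon> u a z x)) x)
      has_real_derivative slow_diff x (disp \<epsilon> u a z x)) (at x)"
    using DERIV_add[OF DERIV_const primitive_has_derivative[OF c]] by simp
  then have "(u has_real_derivative slow_diff x (disp \<epsilon> u a z x)) (at x)"
    using eq by metis
  from DERIV_diff[OF DERIV_add[OF s0 this] DERIV_const] show ?thesis
    by (simp add: slow_diff_def slow_0)
qed

lemma inverse_slow:
  "\<bar>w\<bar> \<le> R1 \<Longrightarrow> 1 / slow x w = sqrt (2 * (F x + d + H (z0 + w)))"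
  by (simp add: slow_def)

text \<open>The time \<open>s0 x + u x - a\<close> is inverted. The squared velocity is then
  \<open>Q (\<phi> t)\<close>, and differentiating its root gives
  \<open>f + \<epsilon> * \<gamma> * h\<close>. Since the energy minus \<open>d\<close> equals
  \<open>H (z0 + disp)\<close>, the inverse of \<open>H\<close> in the equation returns exactly
  \<open>z0 + disp\<close>.\<close>

lemma branch_solution:
  assumes br: "branch \<epsilon> u a z"
  obtains \<phi> where "follows \<phi> u a" "perturbed_solution f h \<gamma> I J d \<epsilon> \<phi>"
    "\<forall>t. \<phi> (t + P) = \<phi> t + L"
    "\<forall>t. (\<phi> has_real_derivative deriv \<phi> t) (at t) \<and>
      deriv \<phi> t = 1 / slow (\<phi> t) (disp \<epsilon> u a z (\<phi> t)) \<and>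
      (deriv \<phi> has_real_derivative f (\<phi> t) + \<epsilon> * \<gamma> t * h (z0 + disp \<epsilon> u a z (\<phi> t))) (at t)"
proof -
  note bd = branch_D[OF br]
  let ?w = "disp \<epsilon> u a z"
  have pos: "slow x (?w x) > 0" for x by (rule slow_pos[OF bd(4)])
  have sh: "s0 (x + L) + u (x + L) - a = (s0 x + u x - a) + P" for x
    using bd(2) by (simp add: shift_s0 periodic_def)
  obtain \<phi> where \<phi>: "\<And>x. \<phi> (s0 x + u x - a) = x" "\<And>t. s0 (\<phi> t) + u (\<phi> t) - a = t"
    "\<And>t. \<phi> (t + P) = \<phi> t + L"
    "\<And>t. (\<phi> has_real_derivative 1 / slow (\<phi> t) (?w (\<phi> t))) (at t)"
    using shift_inverse[OF branch_time_deriv[OF br] pos sh L P] by blast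
  have d\<phi>: "deriv \<phi> t = 1 / slow (\<phi> t) (?w (\<phi> t))" for t
    by (rule DERIV_imp_deriv[OF \<phi>(4)])
  define Q where "Q x = 2 * (F x + d + H (z0 + ?w x))" for x
  have Q: "Q x > 0" "1 / slow x (?w x) = sqrt (Q x)" for x
    using radicand_pos[OF bd(4)] inverse_slow[OF bd(4)] by (auto simp: Q_def)
  have d\<phi>': "deriv \<phi> = (\<lambda>t. sqrt (Q (\<phi> t)))" using d\<phi> Q(2) by auto
  have DQ: "(Q has_real_derivative 2 * (f x + h (z0 + ?w x) * (\<epsilon> * \<gamma> (s0 x + u x - a)))) (at x)" for x
  proof -
    have "((\<lambda>x. H (z0 + ?w x)) has_real_derivative h (z0 + ?w x) * (0 + \<epsilon> * \<gamma> (s0 x + u x - a))) (at x)"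
      by (rule DERIV_chain2[where f=H and g="\<lambda>x. z0 + ?w x", OF DH DERIV_add[OF DERIV_const disp_deriv[OF bd(1)]]])
    from DERIV_cmult[OF DERIV_add[OF DERIV_add[OF DF DERIV_const[of d]] this], of 2]
    show ?thesis unfolding Q_def[abs_def] by simp
  qed
  have dd: "(deriv \<phi> has_real_derivative f (\<phi> t) + \<epsilon> * \<gamma> t * h (z0 + ?w (\<phi> t))) (at t)" for t
  proof -
    have 1: "((\<lambda>t. Q (\<phi> t)) has_real_derivative
        2 * (f (\<phi> t) + h (z0 + ?w (\<phi> t)) * (\<epsilon> * \<gamma> (s0 (\<phi> t) + u (\<phi> t) - a))) * (1 / slow (\<phi> t) (?w (\<phi> t)))) (at t)"
      by (rule DERIV_chain2[where f=Q and g=\<phi>, OF DQ \<phi>(4)])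
    have "((\<lambda>t. sqrt (Q (\<phi> t))) has_real_derivative inverse (sqrt (Q (\<phi> t))) / 2 *
        (2 * (f (\<phi> t) + h (z0 + ?w (\<phi> t)) * (\<epsilon> * \<gamma> (s0 (\<phi> t) + u (\<phi> t) - a))) * (1 / slow (\<phi> t) (?w (\<phi> t))))) (at t)"
      by (rule DERIV_chain2[where f=sqrt and g="\<lambda>t. Q (\<phi> t)", OF DERIV_real_sqrt[OF Q(1)] 1])
    then show ?thesis unfolding d\<phi>' \<phi>(2) Q(2)
      by (rule DERIV_cong) (use Q(1)[of "\<phi> t"] in \<open>simp add: field_simps\<close>)
  qed
  have inI: "z0 + ?w x \<in> I" for x by (rule in_I) (simp add: bd(4))
  have en: "(deriv \<phi> t)\<^sup>2 / 2 - F (\<phi> t) - d = H (z0 + ?w (\<phi> t))" for t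
    using Q(1)[of "\<phi> t"] by (simp add: d\<phi>' Q_def less_imp_le add_divide_distrib)
  have rhs: "perturbed_rhs f h \<gamma> I d \<epsilon> t (\<phi> t) (deriv \<phi> t) = f (\<phi> t) + \<epsilon> * \<gamma> t * h (z0 + ?w (\<phi> t))" for t
    unfolding perturbed_rhs_def en bij_betw_inv_into_left[OF bij_H inI] ..
  have "perturbed_solution f h \<gamma> I J d \<epsilon> \<phi>"
    unfolding perturbed_solution_def solves2_def energy_def rhs en
  proof (intro conjI allI)
    show "\<phi> differentiable at t" for t using \<phi>(4) real_differentiable_def by blast
    show "H (z0 + ?w (\<phi> t)) \<in> J" for t using bij_betwE[OF bij_H] inI by blast
  qed (rule dd)
  moreover have "follows \<phi> u a" unfolding follows_def using \<phi>(1,2) by blast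
  moreover have "(\<phi> has_real_derivative deriv \<phi> t) (at t)" for t unfolding d\<phi> by (rule \<phi>(4))
  ultimately show ?thesis using that \<phi>(3) d\<phi> dd by blast
qed

text \<open>At the angle \<open>x = \<phi> t\<close> one has \<open>t + a = s0 x + u x\<close>, so
  \<open>\<phi>\<close> and \<open>\<psi>\<close> reach this angle at times differing by
  \<open>u x\<close>. Lipschitz bounds control the deviation and its velocity, and the equations
  control the second derivative. \<open>C\<close> does not depend on \<epsilon>, which the limit
  requires.\<close>

lemma branch_deviation_bound:
  obtains C where "C > 0"
    "\<forall>\<epsilon> u a z \<phi> \<eta>. branch \<epsilon> u a z \<and> follows \<phi> u a \<and>
      (\<forall>t. (\<phi> has_real_derivative deriv \<phi> t) (at t) \<and>
        deriv \<phi> t = 1 / slow (\<phi> t) (disp \<epsilon> u a z (\<phi> t)) \<and>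
        (deriv \<phi> has_real_derivative f (\<phi> t) + \<epsilon> * \<gamma> t * h (z0 + disp \<epsilon> u a z (\<phi> t))) (at t)) \<and>
      (\<forall>x. \<bar>u x\<bar> \<le> \<eta>) \<longrightarrow>
      0 \<le> norm2 (deviation \<psi> a \<phi>) \<and> norm2 (deviation \<psi> a \<phi>) \<le> C * (\<eta> + \<bar>z\<bar> + \<bar>\<epsilon>\<bar>)"
proof -
  obtain B where B: "B > 0" "\<And>x. \<bar>\<gamma> x\<bar> \<le> B" "\<And>x. \<bar>f x\<bar> \<le> B" "\<And>x. \<bar>deriv f x\<bar> \<le> B" "\<And>t. v t \<le> B"
    "\<And>w. \<bar>w\<bar> \<le> R1 \<Longrightarrow> \<bar>h (z0 + w)\<bar> \<le> B"
    by (rule that[of bound]) (rule bound, assumption?)+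
  have B': "B \<ge> 0" using B(1) by simp
  have lip\<psi>: "\<bar>\<psi> x - \<psi> y\<bar> \<le> B * \<bar>x - y\<bar>" for x y
    by (rule lipschitz_of_derivative_bound[OF \<psi>]) (use B(5) v_pos in \<open>simp add: less_imp_le\<close>)
  have lipv: "\<bar>v x - v y\<bar> \<le> B * \<bar>x - y\<bar>" for x y
    by (rule lipschitz_of_derivative_bound[OF v]) (use B(3) in simp)
  have lipf: "\<bar>f x - f y\<bar> \<le> B * \<bar>x - y\<bar>" for x y
    by (rule lipschitz_of_derivative_bound[OF C2_D(1)[OF f]]) (use B(4) in simp)
  \<comment> \<open>The radicand is at least \<open>2 * m\<close>, where the square root has
    Lipschitz constant at most \<open>1 / sqrt (2 * m)\<close>, and it changes by at most
    \<open>2 * B\<close> times the change of \<open>w\<close>.\<close>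
  define k where "k = 2 * B / sqrt (2 * m)"
  have k: "k \<ge> 0" using B(1) m by (simp add: k_def)
  have lips: "\<bar>1 / slow x w - v (s0 x)\<bar> \<le> k * \<bar>w\<bar>" if w: "\<bar>w\<bar> \<le> R1" for x w
  proof -
    have eqs: "1 / slow x w = sqrt (2 * (F x + d + H (z0 + w)))" "v (s0 x) = sqrt (2 * (F x + d + H (z0 + 0)))"
      using inverse_slow[OF w] by (auto simp: v_s0 H_z0)
    have "norm (H (z0 + w) - H z0) \<le> B * norm (z0 + w - z0)"
    proof (rule field_differentiable_bound[where S="{z0 - R1..z0 + R1}" and f'=h])
      fix y assume "y \<in> {z0 - R1..z0 + R1}"
      then have "\<bar>y - z0\<bar> \<le> R1" by (auto simp: abs_le_iff)
      then show "norm (h y) \<le> B" using B(6)[of "y - z0"] by simp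
    qed (use DH w R1 in \<open>auto intro: has_field_derivative_at_within simp: abs_le_iff\<close>)
    then have "\<bar>2 * (F x + d + H (z0 + w)) - 2 * (F x + d + H (z0 + 0))\<bar> \<le> 2 * B * \<bar>w\<bar>"
      by simp
    then have "\<bar>2 * (F x + d + H (z0 + w)) - 2 * (F x + d + H (z0 + 0))\<bar> / sqrt (2 * m) \<le> 2 * B * \<bar>w\<bar> / sqrt (2 * m)"
      by (rule divide_right_mono) (use m in simp)
    moreover have "\<bar>sqrt (2 * (F x + d + H (z0 + w))) - sqrt (2 * (F x + d + H (z0 + 0)))\<bar>
        \<le> \<bar>2 * (F x + d + H (z0 + w)) - 2 * (F x + d + H (z0 + 0))\<bar> / sqrt (2 * m)"
      by (rule abs_sqrt_diff_le) (use m_le[OF w, of x] m_le[of 0 x] R1 m in auto)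
    ultimately show ?thesis unfolding eqs k_def by simp
  qed
  define C where "C = B + B * B + B * B + k + k * (B * L) + 1"
  have kBL: "0 \<le> k * (B * L)" using k B' L by simp
  have C: "C > 0" "B \<le> C" "B * B \<le> C" "k + B \<le> C" "k * (B * L) \<le> C" "k \<le> C"
    using B' k kBL by (simp_all add: C_def add_nonneg_pos)
  show ?thesis
  proof (rule that[OF C(1)], intro allI impI, elim conjE)
    fix \<epsilon> u a z \<phi> \<eta>
    assume br: "branch \<epsilon> u a z" and fo: "follows \<phi> u a" and u': "\<forall>x. \<bar>u x\<bar> \<le> \<eta>"
      and ds: "\<forall>t. (\<phi> has_real_derivative deriv \<phi> t) (at t) \<and>
        deriv \<phi> t = 1 / slow (\<phi> t) (disp \<epsilon> u a z (\<phi> t)) \<and>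
        (deriv \<phi> has_real_derivative f (\<phi> t) + \<epsilon> * \<gamma> t * h (z0 + disp \<epsilon> u a z (\<phi> t))) (at t)"
    have d1: "(\<phi> has_real_derivative deriv \<phi> t) (at t)"
      and d1': "deriv \<phi> t = 1 / slow (\<phi> t) (disp \<epsilon> u a z (\<phi> t))"
      and d2: "(deriv \<phi> has_real_derivative f (\<phi> t) + \<epsilon> * \<gamma> t * h (z0 + disp \<epsilon> u a z (\<phi> t))) (at t)" for t
      using ds by blast+
    have u: "\<bar>u x\<bar> \<le> \<eta>" for x using u' by blast
    note bd = branch_D[OF br]
    let ?w = "disp \<epsilon> u a z"
    let ?N = "\<eta> + \<bar>z\<bar> + \<bar>\<epsilon>\<bar>"
    have \<eta>: "\<eta> \<ge> 0" using u[of 0] by linarith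
    have ta: "t + a = s0 (\<phi> t) + u (\<phi> t)" for t using fo unfolding follows_def by (metis diff_add_cancel)
    have w: "\<bar>?w x\<bar> \<le> \<bar>z\<bar> + \<bar>\<epsilon>\<bar> * (B * L)" for x
    proof -
      have "\<bar>primitive (\<lambda>x. \<gamma> (s0 x + u x - a)) x\<bar> \<le> B * L"
        by (rule primitive_zero_mean_bound[OF _ periodic_\<gamma>_s0[OF bd(2)] L bd(3) B(2)])
          (intro continuous_intros bd(1))
      then have "\<bar>\<epsilon> * primitive (\<lambda>x. \<gamma> (s0 x + u x - a)) x\<bar> \<le> \<bar>\<epsilon>\<bar> * (B * L)"
        unfolding abs_mult by (rule mult_left_mono) simp
      then show ?thesis unfolding disp_def using abs_triangle_ineq[of z] by (meson add_left_mono order_trans)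
    qed
    have e0: "\<bar>deviation \<psi> a \<phi> t\<bar> \<le> B * \<eta>" for t
    proof -
      have "deviation \<psi> a \<phi> t = \<psi> (s0 (\<phi> t)) - \<psi> (s0 (\<phi> t) + u (\<phi> t))"
        by (simp add: deviation_def ta \<psi>_s0)
      then show ?thesis using lip\<psi>[of "s0 (\<phi> t)" "s0 (\<phi> t) + u (\<phi> t)"] mult_left_mono[OF u B', of "\<phi> t"] by simp
    qed
    have D1: "deriv (deviation \<psi> a \<phi>) = (\<lambda>t. deriv \<phi> t - v (t + a))"
      unfolding deviation_def[abs_def]
      using \<psi> by (intro ext DERIV_imp_deriv DERIV_diff d1) (simp add: DERIV_shift[symmetric])
    have D2: "deriv (\<lambda>t. deriv \<phi> t - v (t + a)) =
        (\<lambda>t. f (\<phi> t) + \<epsilon> * \<gamma> t * h (z0 + ?w (\<phi> t)) - f (\<psi> (t + a)))"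
      using v by (intro ext DERIV_imp_deriv DERIV_diff d2) (simp add: DERIV_shift[symmetric])
    have e1: "\<bar>deriv \<phi> t - v (t + a)\<bar> \<le> k * (\<bar>z\<bar> + \<bar>\<epsilon>\<bar> * (B * L)) + B * \<eta>" for t
    proof -
      have "\<bar>deriv \<phi> t - v (s0 (\<phi> t))\<bar> \<le> k * (\<bar>z\<bar> + \<bar>\<epsilon>\<bar> * (B * L))"
        unfolding d1' using lips[OF bd(4)] mult_left_mono[OF w k] by (rule order_trans)
      moreover have "\<bar>v (s0 (\<phi> t)) - v (t + a)\<bar> \<le> B * \<eta>"
        using lipv[of "s0 (\<phi> t)" "t + a"] mult_left_mono[OF u B', of "\<phi> t"] by (simp add: ta)
      ultimately show ?thesis by linarith
    qed
    have e2: "\<bar>f (\<phi> t) + \<epsilon> * \<gamma> t * h (z0 + ?w (\<phi> t)) - f (\<psi> (t + a))\<bar> \<le> B * (B * \<eta>) + \<bar>\<epsilon>\<bar> * (B * B)" for t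
    proof -
      have "\<bar>f (\<phi> t) - f (\<psi> (t + a))\<bar> \<le> B * (B * \<eta>)"
        using lipf[of "\<phi> t" "\<psi> (t + a)"] mult_left_mono[OF e0[unfolded deviation_def] B', of t] by linarith
      moreover have "\<bar>\<epsilon> * \<gamma> t * h (z0 + ?w (\<phi> t))\<bar> \<le> \<bar>\<epsilon>\<bar> * (B * B)"
        unfolding abs_mult mult.assoc
        by (intro mult_mono mult_left_mono B(2) B(6) bd(4)) (use B' in auto)
      ultimately show ?thesis by linarith
    qed
    have N: "B * \<eta> \<le> C * ?N" "k * (\<bar>z\<bar> + \<bar>\<epsilon>\<bar> * (B * L)) + B * \<eta> \<le> C * ?N"
      "B * (B * \<eta>) + \<bar>\<epsilon>\<bar> * (B * B) \<le> C * ?N"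
    proof -
      have c: "B * \<eta> \<le> C * \<eta>" "k * \<bar>z\<bar> \<le> C * \<bar>z\<bar>" "(k * (B * L)) * \<bar>\<epsilon>\<bar> \<le> C * \<bar>\<epsilon>\<bar>"
        "(B * B) * \<eta> \<le> C * \<eta>" "(B * B) * \<bar>\<epsilon>\<bar> \<le> C * \<bar>\<epsilon>\<bar>" "0 \<le> C * \<bar>z\<bar>" "0 \<le> C * \<bar>\<epsilon>\<bar>"
        using C \<eta> by (simp_all add: mult_right_mono)
      have eqs: "C * ?N = C * \<eta> + C * \<bar>z\<bar> + C * \<bar>\<epsilon>\<bar>"
        "k * (\<bar>z\<bar> + \<bar>\<epsilon>\<bar> * (B * L)) = k * \<bar>z\<bar> + (k * (B * L)) * \<bar>\<epsilon>\<bar>"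
        "B * (B * \<eta>) = (B * B) * \<eta>" "\<bar>\<epsilon>\<bar> * (B * B) = (B * B) * \<bar>\<epsilon>\<bar>"
        by (simp_all add: algebra_simps)
      show "B * \<eta> \<le> C * ?N" "k * (\<bar>z\<bar> + \<bar>\<epsilon>\<bar> * (B * L)) + B * \<eta> \<le> C * ?N"
        "B * (B * \<eta>) + \<bar>\<epsilon>\<bar> * (B * B) \<le> C * ?N"
        unfolding eqs using c by linarith+
    qed
    have n0: "norm0 (deviation \<psi> a \<phi>) \<le> C * ?N" using norm0_le[of "deviation \<psi> a \<phi>", OF e0] N(1) by linarith
    have n1: "norm0 (deriv (deviation \<psi> a \<phi>)) \<le> C * ?N"
      unfolding D1 using norm0_le[of "\<lambda>t. deriv \<phi> t - v (t + a)", OF e1] N(2) by linarith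
    have n2: "norm0 (deriv (deriv (deviation \<psi> a \<phi>))) \<le> C * ?N"
      unfolding D1 D2
      using norm0_le[of "\<lambda>t. f (\<phi> t) + \<epsilon> * \<gamma> t * h (z0 + ?w (\<phi> t)) - f (\<psi> (t + a))", OF e2] N(3)
      by linarith
    have "0 \<le> norm0 (deviation \<psi> a \<phi>)" using abs_le_norm0[of "deviation \<psi> a \<phi>", OF e0, of 0] by linarith
    then show "0 \<le> norm2 (deviation \<psi> a \<phi>) \<and> norm2 (deviation \<psi> a \<phi>) \<le> C * ?N"
      using n0 n1 n2 by (simp add: norm2_def)
  qed
qed

section \<open>From the second order equation to angle coordinates\<close>


text \<open>Closeness of the velocities makes \<open>\<phi>\<close> strictly increasing, hence
  invertible; its time at the angle \<open>x\<close> defines \<open>u\<close>, and the inverse of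
  \<open>H\<close> at the energy minus \<open>d\<close> defines the displacement.
  \<open>\<rho>\<close> is uniform in the phase and in \<epsilon>.\<close>

lemma solution_branch:
  assumes "\<eta> > 0"
  obtains \<rho> where "\<rho> > 0"
    "\<forall>\<epsilon> a \<phi>. \<epsilon> \<noteq> 0 \<and> perturbed_solution f h \<gamma> I J d \<epsilon> \<phi> \<and>
      (\<forall>t. \<phi> (t + P) = \<phi> t + L \<and> \<bar>\<phi> t - \<psi> (t + a)\<bar> \<le> \<rho> \<and> \<bar>deriv \<phi> t - v (t + a)\<bar> \<le> \<rho>) \<longrightarrow>
      (\<exists>u z. branch \<epsilon> u a z \<and> follows \<phi> u a \<and> (\<forall>x. \<bar>u x\<bar> \<le> \<eta>) \<and> \<bar>z\<bar> \<le> \<eta>)"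
proof -
  obtain B where B: "B > 0" "\<And>x. \<bar>f x\<bar> \<le> B" "\<And>t. v t \<le> B" by (rule that[of bound]) (rule bound, assumption?)+
  have cv: "continuous_on UNIV v" by (intro continuous_intros)
  have "\<exists>vm>0. \<forall>t. vm \<le> v t"
  proof (rule periodic_continuous_range[OF per_v P cv])
    fix tm assume "\<And>t. v tm \<le> v t"
    then show ?thesis using v_pos[of tm] by blast
  qed
  then obtain vm where vm: "vm > 0" "\<And>t. vm \<le> v t" by blast
  let ?K = "inv_into I H"
  have K0: "?K (c - d) = z0" using bij_betw_inv_into_left[OF bij_H z0_in_I] by (simp add: H_z0)
  have cJ: "c - d \<in> J" using bij_betwE[OF bij_H] z0_in_I H_z0 by metis
  obtain \<delta> where \<delta>: "\<delta> > 0" "\<And>y. \<bar>y - (c - d)\<bar> < \<delta> \<Longrightarrow> \<bar>?K y - z0\<bar> < min \<eta> R1"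
  proof -
    have "isCont ?K (c - d)" by (rule DERIV_isCont[OF inv_H_deriv[OF cJ]])
    then have "\<exists>\<delta>>0. \<forall>y. dist y (c - d) < \<delta> \<longrightarrow> dist (?K y) (?K (c - d)) < min \<eta> R1"
      unfolding continuous_at_eps_delta using assms R1 by (metis min_less_iff_conj)
    then show ?thesis using that by (auto simp: dist_real_def K0)
  qed
  \<comment> \<open>In this order: 1 keeps the sum of the velocities below \<open>2 * B + 1\<close>;
    \<open>vm / 2\<close> keeps the velocity of \<open>\<phi>\<close> positive;
    \<open>vm * \<eta>\<close> bounds the time correction by \<open>\<eta>\<close>; the last entry
    keeps the energy within \<open>\<delta>\<close> of \<open>c\<close>.\<close>
  define \<rho> where "\<rho> = min (min 1 (vm / 2)) (min (vm * \<eta>) (\<delta> / (2 * (2 * B + 1))))"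
  have \<rho>: "\<rho> \<le> 1" "\<rho> \<le> vm / 2" "\<rho> \<le> vm * \<eta>" "\<rho> \<le> \<delta> / (2 * (2 * B + 1))"
    unfolding \<rho>_def by (meson min.cobounded1 min.cobounded2 order_trans)+
  have "\<rho> > 0" using vm(1) assms \<delta>(1) B(1) by (simp add: \<rho>_def)
  note \<rho> = this \<rho>
  have \<rho>\<delta>: "\<rho> * (2 * B + 1) < \<delta>"
  proof -
    have "\<rho> * (2 * (2 * B + 1)) \<le> \<delta>" using \<rho>(5) B(1) by (simp add: pos_le_divide_eq)
    moreover have "\<rho> * (2 * B + 1) > 0" using \<rho>(1) B(1) by simp
    ultimately show ?thesis by linarith
  qed
  have lip\<psi>: "\<bar>F x - F y\<bar> \<le> B * \<bar>x - y\<bar>" for x y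
    by (rule lipschitz_of_derivative_bound[OF DF B(2)])
  show ?thesis
  proof (rule that[OF \<rho>(1)], intro allI impI, elim conjE)
    fix \<epsilon> a \<phi>
    assume \<epsilon>: "\<epsilon> \<noteq> 0" and ps: "perturbed_solution f h \<gamma> I J d \<epsilon> \<phi>"
      and all: "\<forall>t. \<phi> (t + P) = \<phi> t + L \<and> \<bar>\<phi> t - \<psi> (t + a)\<bar> \<le> \<rho> \<and> \<bar>deriv \<phi> t - v (t + a)\<bar> \<le> \<rho>"
    have sh: "\<phi> (t + P) = \<phi> t + L" and n0: "\<bar>\<phi> t - \<psi> (t + a)\<bar> \<le> \<rho>"
      and n1: "\<bar>deriv \<phi> t - v (t + a)\<bar> \<le> \<rho>" for t
      using all by blast+
    have d1: "(\<phi> has_real_derivative deriv \<phi> t) (at t)" for t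
      using ps unfolding perturbed_solution_def solves2_def
      by (meson DERIV_deriv_iff_real_differentiable)
    define e where "e t = energy f \<phi> t - d" for t
    define zt where "zt t = ?K (e t)" for t
    have eJ: "e t \<in> J" for t using ps by (simp add: perturbed_solution_def e_def)
    have d2: "(deriv \<phi> has_real_derivative f (\<phi> t) + \<epsilon> * \<gamma> t * h (zt t)) (at t)" for t
      using ps by (simp add: perturbed_solution_def solves2_def perturbed_rhs_def zt_def e_def energy_def)
    have pos: "deriv \<phi> t > 0" for t
      using n1[of t] vm(2)[of "t + a"] \<rho>(3) vm(1) by linarith
    have per_d: "deriv \<phi> (t + P) = deriv \<phi> t" for t
    proof -
      have "((\<lambda>t. \<phi> (t + P) - L) has_real_derivative deriv \<phi> (t + P) - 0) (at t)"
        using DERIV_diff[OF DERIV_shift[THEN iffD1, OF d1] DERIV_const] .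
      then have "(\<phi> has_real_derivative deriv \<phi> (t + P)) (at t)" using sh by simp
      then show ?thesis using DERIV_unique d1 by blast
    qed
    have inI: "zt t \<in> I" for t
      unfolding zt_def using bij_betwE[OF bij_betw_inv_into[OF bij_H]] eJ by blast
    have Hz: "H (zt t) = e t" for t
      unfolding zt_def by (rule bij_betw_inv_into_right[OF bij_H eJ])
    have e_eq: "e t = (deriv \<phi> t)\<^sup>2 / 2 - F (\<phi> t) - d" for t by (simp add: e_def energy_def)
    have ec: "\<bar>e t - (c - d)\<bar> < \<delta>" for t
    proof -
      have "(deriv \<phi> t - v (t + a)) * (deriv \<phi> t + v (t + a)) = (deriv \<phi> t)\<^sup>2 - (v (t + a))\<^sup>2"
        by (simp add: power2_eq_square algebra_simps)
      then have "e t - (c - d) = (deriv \<phi> t - v (t + a)) * (deriv \<phi> t + v (t + a)) / 2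
          - (F (\<phi> t) - F (\<psi> (t + a)))"
        using energy_\<psi>[of "t + a"] e_eq[of t] by (simp add: diff_divide_distrib)
      moreover have "\<bar>(deriv \<phi> t - v (t + a)) * (deriv \<phi> t + v (t + a))\<bar> \<le> \<rho> * (2 * B + 1)"
        unfolding abs_mult
        by (rule mult_mono[OF n1]) (use n1[of t] \<rho>(1,2) B(1) B(3)[of "t + a"] v_pos[of "t + a"] in \<open>auto simp: abs_le_iff\<close>)
      moreover have "\<bar>F (\<phi> t) - F (\<psi> (t + a))\<bar> \<le> B * \<rho>"
        using lip\<psi>[of "\<phi> t" "\<psi> (t + a)"] mult_left_mono[OF n0[of t], of B] B(1) by linarith
      moreover have "\<rho> * (2 * B + 1) / 2 + B * \<rho> \<le> \<rho> * (2 * B + 1)"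
        using \<rho>(1) B(1) by (simp add: algebra_simps)
      ultimately show ?thesis using \<rho>\<delta> by linarith
    qed
    have zt_near: "\<bar>zt t - z0\<bar> < min \<eta> R1" for t unfolding zt_def by (rule \<delta>(2)[OF ec])
    have De: "(e has_real_derivative deriv \<phi> t * (\<epsilon> * \<gamma> t * h (zt t))) (at t)" for t
    proof -
      have F\<phi>: "((\<lambda>t. F (\<phi> t)) has_real_derivative f (\<phi> t) * deriv \<phi> t) (at t)"
        by (rule DERIV_chain2[where f=F and g=\<phi>, OF DF d1])
      have "((\<lambda>t. (deriv \<phi> t)\<^sup>2 / 2) has_real_derivative deriv \<phi> t * (f (\<phi> t) + \<epsilon> * \<gamma> t * h (zt t))) (at t)"
        by (auto intro!: derivative_eq_intros d2)
      from DERIV_diff[OF DERIV_diff[OF this F\<phi>] DERIV_const[of d]]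
      show ?thesis unfolding e_eq[abs_def] by (simp add: algebra_simps)
    qed
    \<comment> \<open>The derivative \<open>1 / h\<close> of the inverse of \<open>H\<close> cancels
      the factor \<open>h\<close> in the rate of change of the energy; this needs \<open>h\<close>
      to be nonzero along the whole solution.\<close>
    have Dzt: "(zt has_real_derivative \<epsilon> * \<gamma> t * deriv \<phi> t) (at t)" for t
    proof -
      have "(zt has_real_derivative 1 / h (zt t) * (deriv \<phi> t * (\<epsilon> * \<gamma> t * h (zt t)))) (at t)"
        unfolding zt_def[abs_def] by (rule DERIV_chain2[where f="?K" and g=e, OF inv_H_deriv[OF eJ] De[unfolded zt_def]])
      then show ?thesis by (rule DERIV_cong) (use h_nz[OF inI] in simp)
    qed
    obtain S where S: "\<And>t. S (\<phi> t) = t" "\<And>x. \<phi> (S x) = x" "\<And>x. S (x + L) = S x + P"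
      "\<And>x. (S has_real_derivative 1 / deriv \<phi> (S x)) (at x)"
      using shift_inverse[OF d1 pos sh P L] by blast
    define u where "u x = S x + a - s0 x" for x
    define w where "w x = zt (S x) - z0" for x
    have uS: "s0 x + u x - a = S x" for x by (simp add: u_def)
    have contS: "continuous_on UNIV S" using S(4) by (meson DERIV_isCont continuous_at_imp_continuous_on)
    have cu: "continuous_on UNIV u" unfolding u_def by (intro continuous_intros contS)
    have per_u: "periodic L u" by (simp add: periodic_def u_def S(3) shift_s0)
    have wR: "\<bar>w x\<bar> \<le> R1" and w\<eta>: "\<bar>w x\<bar> \<le> \<eta>" for x using zt_near[of "S x"] by (auto simp: w_def)
    have Dw: "(w has_real_derivative \<epsilon> * \<gamma> (S x)) (at x)" for x
    proof -
      have "((\<lambda>x. zt (S x)) has_real_derivative \<epsilon> * \<gamma> (S x) * deriv \<phi> (S x) * (1 / deriv \<phi> (S x))) (at x)"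
        by (rule DERIV_chain2[where f=zt and g=S, OF Dzt S(4)])
      from DERIV_diff[OF this DERIV_const[of z0]] show ?thesis
        unfolding w_def[abs_def] by (rule DERIV_cong) (use pos[of "S x"] in simp)
    qed
    have c\<gamma>: "continuous_on UNIV (\<lambda>x. \<gamma> (S x))" by (intro continuous_intros contS)
    have w_eq: "w x = disp \<epsilon> u a (w 0) x" for x
      using primitive_eqI[of "\<lambda>x. \<epsilon> * \<gamma> (S x)" w x, OF continuous_on_mult_left[OF c\<gamma>] Dw]
      by (simp add: disp_def uS primitive_cmult[OF c\<gamma>])
    have eP: "e (t + P) = e t" for t
      using per_F by (simp add: e_eq per_d sh periodic_def)
    have "w L = w 0" using S(3)[of 0] by (simp add: w_def zt_def eP)
    \<comment> \<open>The energy is \<open>P\<close>-periodic, so \<open>w\<close> returns to its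
      value after \<open>L\<close>, and \<epsilon> times this integral vanishes; here
      \<open>\<epsilon> \<noteq> 0\<close> is used.\<close>
    then have mean0: "primitive (\<lambda>x. \<gamma> (s0 x + u x - a)) L = 0"
      using w_eq[of L] \<epsilon> by (simp add: disp_def)
    have slow_w: "slow x (w x) = 1 / deriv \<phi> (S x)" for x
    proof -
      have "2 * (F x + d + H (z0 + w x)) = (deriv \<phi> (S x))\<^sup>2"
        by (simp add: w_def Hz e_eq S(2))
      then show ?thesis using pos[of "S x"] by (simp add: slow_def)
    qed
    have Du: "(u has_real_derivative slow_diff x (w x)) (at x)" for x
      using DERIV_diff[OF DERIV_add[OF S(4) DERIV_const[of a]] s0]
      unfolding u_def[abs_def] slow_diff_def slow_w slow_0 by simp
    have cw: "continuous_on UNIV w" using Dw by (meson DERIV_isCont continuous_at_imp_continuous_on)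
    have z: "\<bar>0\<bar> \<le> R1" using R1 by simp
    have "continuous_on UNIV (\<lambda>x. slow_diff x (w x))" unfolding slow_diff_def
      by (intro continuous_on_diff continuous_slow cw wR z continuous_on_const)
    from primitive_eqI[of "\<lambda>x. slow_diff x (w x)" u, OF this Du]
    have u_eq: "u x = u 0 + primitive (\<lambda>x. slow_diff x (w x)) x" for x by simp
    have w_fun: "w = disp \<epsilon> u a (w 0)" using w_eq by blast
    have "branch \<epsilon> u a (w 0)"
      unfolding branch_def w_fun[symmetric] using cu per_u mean0 wR u_eq by blast
    moreover have "follows \<phi> u a" unfolding follows_def uS using S(1,2) by blast
    moreover have "\<bar>u x\<bar> \<le> \<eta>" for x
    proof -
      \<comment> \<open>The velocity of \<open>\<psi>\<close> is at least \<open>vm\<close>, so a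
        difference of angles bounds the difference of times, and
        \<open>\<rho> \<le> vm * \<eta>\<close> becomes the bound on \<open>u\<close>.\<close>
      have "vm * \<bar>x - y\<bar> \<le> \<bar>\<psi> x - \<psi> y\<bar>" for x y
      proof -
        have *: "vm * (y - x) \<le> \<psi> y - \<psi> x" if xy: "x < y" for x y
        proof -
          obtain \<xi> where "\<psi> y - \<psi> x = (y - x) * v \<xi>" using MVT2[OF xy \<psi>] by blast
          then show ?thesis using vm(2)[of \<xi>] xy by (simp add: mult.commute mult_left_mono)
        qed
        show ?thesis using *[of x y] *[of y x] by (cases x y rule: linorder_cases) auto
      qed
      from this[of "s0 x" "S x + a"] have "vm * \<bar>u x\<bar> \<le> \<bar>\<phi> (S x) - \<psi> (S x + a)\<bar>"
        by (simp add: \<psi>_s0 S(2) u_def abs_minus_commute)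
      also have "\<dots> \<le> vm * \<eta>" using n0 \<rho>(4) by (rule order_trans)
      finally show ?thesis using vm(1) by simp
    qed
    ultimately show "\<exists>u z. branch \<epsilon> u a z \<and> follows \<phi> u a \<and> (\<forall>x. \<bar>u x\<bar> \<le> \<eta>) \<and> \<bar>z\<bar> \<le> \<eta>"
      using w\<eta> by blast
  qed
qed

text \<open>Writing \<open>v (t + a) = (v (t + a) - \<phi>' t) + \<phi>' t\<close>, the first part of the normalization integrand
  is the derivative of a periodic function, so only \<open>deviation * \<phi>'\<close> remains; it is turned into
  an integral over the angle \<open>x = \<phi> t\<close>.\<close>

lemma phase_normalized_iff_centred:
  assumes \<phi>: "\<And>t. (\<phi> has_real_derivative deriv \<phi> t) (at t)" "continuous_on UNIV (deriv \<phi>)"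
    and sh: "\<And>t. \<phi> (t + P) = \<phi> t + L" and fo: "follows \<phi> u a"
    and u: "continuous_on UNIV u" "periodic L u"
  shows "phase_normalized \<psi> P a \<phi> \<longleftrightarrow> centred u"
proof -
  let ?\<Delta> = "\<lambda>t. \<phi> t - \<psi> (t + a)"
  let ?g = "\<lambda>x. angle_defect x (u x)"
  have c\<phi>: "continuous_on UNIV \<phi>" using \<phi>(1) by (meson DERIV_isCont continuous_at_imp_continuous_on)
  have cg: "continuous_on UNIV ?g" unfolding angle_defect_def by (intro continuous_intros u)
  have pg: "periodic L ?g"
  proof -
    have "\<psi> (s0 (x + L) + u (x + L)) = \<psi> (s0 x + u x) + L" for x
    proof -
      have "s0 (x + L) + u (x + L) = (s0 x + u x) + P" using u(2) by (simp add: periodic_def shift_s0)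
      then show ?thesis by (simp add: shift_\<psi>)
    qed
    then show ?thesis by (simp add: periodic_def angle_defect_def)
  qed
  have d\<Delta>: "(?\<Delta> has_real_derivative deriv \<phi> t - v (t + a)) (at t)" for t
    using DERIV_diff[OF \<phi>(1) DERIV_shift[THEN iffD1, OF \<psi>]] .
  have g\<Delta>: "?g (\<phi> t) = \<psi> (t + a) - \<phi> t" for t
  proof -
    have "t + a = s0 (\<phi> t) + u (\<phi> t)" using fo unfolding follows_def by (metis diff_add_cancel)
    then show ?thesis by (simp add: angle_defect_def)
  qed
  have c1: "continuous_on UNIV (\<lambda>t. ?g (\<phi> t) * deriv \<phi> t)"
    by (intro continuous_on_mult \<phi>(2) continuous_on_compose2[OF cg c\<phi>]) auto
  have c2: "continuous_on UNIV (\<lambda>t. ?\<Delta> t * (deriv \<phi> t - v (t + a)))"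
    by (intro continuous_intros c\<phi> \<phi>(2))
  have "primitive (\<lambda>t. ?\<Delta> t * (deriv \<phi> t - v (t + a))) P = (?\<Delta> P)\<^sup>2 / 2 - (?\<Delta> 0)\<^sup>2 / 2"
  proof (rule primitive_eqI[where G="\<lambda>t. (?\<Delta> t)\<^sup>2 / 2", OF c2])
    show "((\<lambda>t. (?\<Delta> t)\<^sup>2 / 2) has_real_derivative ?\<Delta> t * (deriv \<phi> t - v (t + a))) (at t)" for t
      using DERIV_cdivide[OF DERIV_power[OF d\<Delta>, of 2], of 2] by (rule DERIV_cong) simp
  qed
  also have "?\<Delta> P = ?\<Delta> 0" using sh[of 0] shift_\<psi>[of a] by (simp add: add.commute)
  finally have 1: "primitive (\<lambda>t. ?\<Delta> t * (deriv \<phi> t - v (t + a))) P = 0" by simp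
  have "primitive (\<lambda>t. ?g (\<phi> t) * deriv \<phi> t) P = primitive ?g (\<phi> P) - primitive ?g (\<phi> 0)"
    by (rule primitive_substitution[OF cg \<phi>])
  also have "\<dots> = primitive ?g L"
    using sh[of 0] primitive_periodic[OF cg pg, of "\<phi> 0"] by simp
  finally have 2: "primitive (\<lambda>t. ?g (\<phi> t) * deriv \<phi> t) P = primitive ?g L" .
  have "(LBINT t=0..P. deviation \<psi> a \<phi> t * deriv \<psi> (t + a)) = primitive (\<lambda>t. ?\<Delta> t * v (t + a)) P"
    by (simp add: primitive_def deviation_def deriv_\<psi>)
  also have "(\<lambda>t. ?\<Delta> t * v (t + a)) =
      (\<lambda>t. - 1 * (?g (\<phi> t) * deriv \<phi> t) - ?\<Delta> t * (deriv \<phi> t - v (t + a)))"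
    by (rule ext) (simp add: g\<Delta> algebra_simps)
  also have "primitive \<dots> P = - primitive ?g L"
    by (subst primitive_diff[OF continuous_on_mult_left[OF c1] c2], subst primitive_cmult[OF c1]) (simp add: 1 2)
  finally show ?thesis unfolding phase_normalized_def centred_def by simp
qed

text \<open>Adding \<open>k\<close> to both \<open>u\<close> and \<open>a\<close> leaves the time
  \<open>s0 x + u x - a\<close>, and thus the solution, unchanged. As \<open>\<psi>\<close>
  increases and \<open>u\<close> lies within \<open>\<eta>\<close>, the angle defect is nonpositive
  for \<open>k = - \<eta>\<close> and nonnegative for \<open>k = \<eta>\<close>; the intermediate
  value theorem applies to its integral.\<close>

lemma recentre:
  assumes br: "branch \<epsilon> u a z" and u: "\<And>x. \<bar>u x\<bar> \<le> \<eta>"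
  obtains k where "\<bar>k\<bar> \<le> \<eta>" "branch \<epsilon> (\<lambda>x. u x + k) (a + k) z" "centred (\<lambda>x. u x + k)"
proof -
  note bd = branch_D[OF br]
  obtain B where B: "B > 0" "\<And>t. v t \<le> B" by (rule that[of bound]) (rule bound, assumption?)+
  have \<eta>: "\<eta> \<ge> 0" using u[of 0] by linarith
  have lip: "\<bar>\<psi> x - \<psi> y\<bar> \<le> B * \<bar>x - y\<bar>" for x y
    by (rule lipschitz_of_derivative_bound[OF \<psi>]) (use B(2) v_pos in \<open>simp add: less_imp_le\<close>)
  have mono: "\<psi> x \<le> \<psi> y" if "x \<le> y" for x y
    by (rule DERIV_nonneg_imp_nondecreasing[of x y \<psi>, OF that]) (use \<psi> v_pos less_imp_le in blast)
  define g where "g k = primitive (\<lambda>x. angle_defect x (u x + k)) L" for k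
  have ca: "continuous_on UNIV (\<lambda>x. angle_defect x (u x + k))" for k
    unfolding angle_defect_def by (intro continuous_intros bd(1))
  have glip: "\<bar>g k - g l\<bar> \<le> (B * L) * \<bar>k - l\<bar>" for k l
  proof -
    have "\<bar>primitive (\<lambda>x. angle_defect x (u x + k) - angle_defect x (u x + l)) L\<bar> \<le> (B * \<bar>k - l\<bar>) * L"
    proof (rule primitive_bound[OF continuous_on_diff[OF ca ca]])
      show "\<bar>angle_defect x (u x + k) - angle_defect x (u x + l)\<bar> \<le> B * \<bar>k - l\<bar>" for x
        using lip[of "s0 x + (u x + k)" "s0 x + (u x + l)"] by (simp add: angle_defect_def)
    qed (use L in simp)
    then show ?thesis by (simp only: g_def primitive_diff[OF ca ca] mult_ac)
  qed
  have gc: "isCont g k" for k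
    unfolding isCont_def
  proof (rule Lim_null[THEN iffD2], rule Lim_null_comparison)
    show "((\<lambda>l. (B * L) * \<bar>l - k\<bar>) \<longlongrightarrow> 0) (at k)" by (auto intro!: tendsto_eq_intros)
    show "\<forall>\<^sub>F l in at k. norm (g l - g k) \<le> (B * L) * \<bar>l - k\<bar>" using glip by simp
  qed
  have sign: "angle_defect x (u x + - \<eta>) \<le> 0" "0 \<le> angle_defect x (u x + \<eta>)" for x
    using mono[of "s0 x + (u x - \<eta>)" "s0 x"] mono[of "s0 x" "s0 x + (u x + \<eta>)"] u[of x]
    by (auto simp: angle_defect_def \<psi>_s0 abs_le_iff)
  obtain \<xi> where "g (- \<eta>) = L * angle_defect \<xi> (u \<xi> + - \<eta>)"
    unfolding g_def using primitive_mean_value[OF ca L] by metis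
  then have lo: "g (- \<eta>) \<le> 0" using sign(1) L by (simp add: mult_nonneg_nonpos)
  obtain \<xi>' where "g \<eta> = L * angle_defect \<xi>' (u \<xi>' + \<eta>)"
    unfolding g_def using primitive_mean_value[OF ca L] by metis
  then have hi: "0 \<le> g \<eta>" using sign(2) L by simp
  obtain k where k: "- \<eta> \<le> k" "k \<le> \<eta>" "g k = 0"
    using IVT[of g "- \<eta>" 0 \<eta>] lo hi gc \<eta> by auto
  show ?thesis
  proof (rule that[of k])
    show "\<bar>k\<bar> \<le> \<eta>" using k by (simp add: abs_le_iff)
    show "centred (\<lambda>x. u x + k)" using k(3) by (simp add: centred_def g_def)
    have eq: "s0 x + (u x + k) - (a + k) = s0 x + u x - a" for x by simp
    have eqd: "disp \<epsilon> (\<lambda>x. u x + k) (a + k) z = disp \<epsilon> u a z" unfolding disp_def eq ..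
    have "continuous_on UNIV (\<lambda>x. u x + k)" by (intro continuous_intros bd(1))
    moreover have "periodic L (\<lambda>x. u x + k)" using bd(2) by (simp add: periodic_def)
    moreover have "u x + k = u 0 + k + primitive (\<lambda>x. slow_diff x (disp \<epsilon> u a z x)) x" for x
      using bd(5)[of x] by linarith
    ultimately show "branch \<epsilon> (\<lambda>x. u x + k) (a + k) z"
      unfolding branch_def eq eqd using bd(3,4) by blast
  qed
qed

section \<open>Continuation from a simple zero of the Melnikov function\<close>


lemma perturbed_solution_D:
  assumes "perturbed_solution f h \<gamma> I J d \<epsilon> \<phi>"
  shows "(\<phi> has_real_derivative deriv \<phi> t) (at t)" "continuous_on UNIV (deriv \<phi>)"
proof -
  show "(\<phi> has_real_derivative deriv \<phi> t) (at t)"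
    using assms unfolding perturbed_solution_def solves2_def
    by (meson DERIV_deriv_iff_real_differentiable)
  show "continuous_on UNIV (deriv \<phi>)"
    using assms unfolding perturbed_solution_def solves2_def
    by (meson DERIV_isCont continuous_at_imp_continuous_on)
qed

text \<open>The supremum dominates the values only for bounded functions. Equal shifts make the
  deviation and its derivative periodic, hence bounded.\<close>

lemma norm2_deviation_pointwise:
  assumes \<phi>: "\<And>t. (\<phi> has_real_derivative deriv \<phi> t) (at t)" "continuous_on UNIV (deriv \<phi>)"
    and sh: "\<And>t. \<phi> (t + P) = \<phi> t + L" and le: "norm2 (deviation \<psi> a \<phi>) \<le> \<rho>"
  shows "\<bar>\<phi> t - \<psi> (t + a)\<bar> \<le> \<rho>" "\<bar>deriv \<phi> t - v (t + a)\<bar> \<le> \<rho>"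
proof -
  have c\<phi>: "continuous_on UNIV \<phi>" using \<phi>(1) by (meson DERIV_isCont continuous_at_imp_continuous_on)
  have dev: "deviation \<psi> a \<phi> = (\<lambda>t. \<phi> t - \<psi> (t + a))" by (auto simp: deviation_def)
  have d: "((\<lambda>t. \<phi> t - \<psi> (t + a)) has_real_derivative deriv \<phi> t - v (t + a)) (at t)" for t
    using DERIV_diff[OF \<phi>(1) DERIV_shift[THEN iffD1, OF \<psi>]] .
  have D: "deriv (\<lambda>t. \<phi> t - \<psi> (t + a)) = (\<lambda>t. deriv \<phi> t - v (t + a))"
    by (rule ext) (rule DERIV_imp_deriv[OF d])
  have p0: "periodic P (\<lambda>t. \<phi> t - \<psi> (t + a))"
    using shift_\<psi>[of "_ + a"] by (simp add: periodic_def sh algebra_simps)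
  have "continuous_on UNIV (\<lambda>t. \<phi> t - \<psi> (t + a))" by (intro continuous_intros c\<phi>)
  then obtain C0 where C0: "\<And>t. \<bar>\<phi> t - \<psi> (t + a)\<bar> \<le> C0"
    using periodic_continuous_bounded[OF p0 P] by blast
  have "continuous_on UNIV (\<lambda>t. deriv \<phi> t - v (t + a))" by (intro continuous_intros \<phi>(2))
  then obtain C1 where C1: "\<And>t. \<bar>deriv \<phi> t - v (t + a)\<bar> \<le> C1"
    using periodic_continuous_bounded[OF periodic_derivative[OF p0 d] P] by blast
  have "norm0 (\<lambda>t. \<phi> t - \<psi> (t + a)) \<le> \<rho>" "norm0 (\<lambda>t. deriv \<phi> t - v (t + a)) \<le> \<rho>"
    using le by (simp_all add: norm2_def dev D)
  then show "\<bar>\<phi> t - \<psi> (t + a)\<bar> \<le> \<rho>" "\<bar>deriv \<phi> t - v (t + a)\<bar> \<le> \<rho>"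
    using abs_le_norm0[of "\<lambda>t. \<phi> t - \<psi> (t + a)", OF C0, of t]
      abs_le_norm0[of "\<lambda>t. deriv \<phi> t - v (t + a)", OF C1, of t] by linarith+
qed

text \<open>Order of choices: the uniqueness radius \<open>r\<close> of the curve determines
  \<open>\<rho>\<close>, so that every solution within \<open>\<rho>\<close> has angle coordinates
  in the uniqueness box; only then is \<epsilon> restricted, so that the branch itself lies within
  \<open>\<rho>\<close>.\<close>

theorem melnikov_continuation:
  "\<exists>\<rho>>0. \<exists>\<delta>>0. \<exists>\<epsilon>\<^sub>0>0. \<exists>(\<alpha> :: real \<Rightarrow> real) (\<phi> :: real \<Rightarrow> real \<Rightarrow> real).
     \<alpha> C1_differentiable_on {-\<epsilon>\<^sub>0<..<\<epsilon>\<^sub>0} \<and>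
     ((\<lambda>\<epsilon>. \<bar>\<alpha> \<epsilon> - \<alpha>0\<bar>) \<longlongrightarrow> 0) (at 0) \<and>
     (\<forall>\<epsilon>. 0 < \<bar>\<epsilon>\<bar> \<and> \<bar>\<epsilon>\<bar> < \<epsilon>\<^sub>0 \<longrightarrow>
        (let near = (\<lambda>a \<phi>. perturbed_solution f h \<gamma> I J d \<epsilon> \<phi> \<and>
                           (\<forall>t. \<phi> (t + P) = \<phi> t + L) \<and>
                           norm2 (deviation \<psi> a \<phi>) \<le> \<rho>)
         in near (\<alpha> \<epsilon>) (\<phi> \<epsilon>) \<and>
            (\<forall>\<phi>'. near (\<alpha> \<epsilon>) \<phi>' \<longrightarrow> \<phi>' = \<phi> \<epsilon>) \<and>
            \<bar>\<alpha> \<epsilon> - \<alpha>0\<bar> < \<delta> \<and>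
            phase_normalized \<psi> P (\<alpha> \<epsilon>) (\<phi> \<epsilon>) \<and>
            (\<forall>a \<phi>'. \<bar>a - \<alpha>0\<bar> < \<delta> \<and> near a \<phi>' \<and> phase_normalized \<psi> P a \<phi>'
                    \<longrightarrow> a = \<alpha> \<epsilon>))) \<and>
     ((\<lambda>\<epsilon>. norm2 (deviation \<psi> (\<alpha> \<epsilon>) (\<phi> \<epsilon>))) \<longlongrightarrow> 0) (at 0)"
proof -
  obtain r e \<alpha> U \<zeta> \<alpha>' where r: "r > 0" and e: "e > 0" and \<alpha>0: "\<alpha> 0 = \<alpha>0"
    and curve: "\<forall>\<epsilon>. \<bar>\<epsilon>\<bar> < e \<longrightarrow> branch \<epsilon> (apply_bcontfun (U \<epsilon>)) (\<alpha> \<epsilon>) (\<zeta> \<epsilon>) \<and>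
      centred (apply_bcontfun (U \<epsilon>)) \<and> (\<alpha> has_vector_derivative \<alpha>' \<epsilon>) (at \<epsilon>)"
    and un: "\<forall>\<epsilon> u a z. \<bar>\<epsilon>\<bar> < e \<and> (\<forall>x. \<bar>u x\<bar> \<le> r) \<and> \<bar>a - \<alpha>0\<bar> \<le> r \<and> \<bar>z\<bar> \<le> r \<and>
      branch \<epsilon> u a z \<and> centred u \<longrightarrow> u = apply_bcontfun (U \<epsilon>) \<and> a = \<alpha> \<epsilon>"
    and c\<alpha>': "continuous_on {-e<..<e} \<alpha>'"
    and U0: "((\<lambda>\<epsilon>. norm (U \<epsilon>)) \<longlongrightarrow> 0) (at 0)" and \<zeta>0: "(\<zeta> \<longlongrightarrow> 0) (at 0)"
    by (rule solution_curve)
  have br: "branch \<epsilon> (apply_bcontfun (U \<epsilon>)) (\<alpha> \<epsilon>) (\<zeta> \<epsilon>)" and ce: "centred (apply_bcontfun (U \<epsilon>))"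
    and d\<alpha>: "(\<alpha> has_vector_derivative \<alpha>' \<epsilon>) (at \<epsilon>)" if "\<bar>\<epsilon>\<bar> < e" for \<epsilon>
    using curve that by blast+
  \<comment> \<open>A quarter leaves room for recentring: correction and phase offset are at most
    \<open>r / 4\<close> each, move by at most \<open>r / 4\<close>, and stay within
    \<open>r\<close>.\<close>
  have r4: "r / 4 > 0" using r by simp
  obtain \<rho> where \<rho>: "\<rho> > 0" and sol: "\<forall>\<epsilon> a \<phi>. \<epsilon> \<noteq> 0 \<and> perturbed_solution f h \<gamma> I J d \<epsilon> \<phi> \<and>
      (\<forall>t. \<phi> (t + P) = \<phi> t + L \<and> \<bar>\<phi> t - \<psi> (t + a)\<bar> \<le> \<rho> \<and> \<bar>deriv \<phi> t - v (t + a)\<bar> \<le> \<rho>) \<longrightarrow>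
      (\<exists>u z. branch \<epsilon> u a z \<and> follows \<phi> u a \<and> (\<forall>x. \<bar>u x\<bar> \<le> r / 4) \<and> \<bar>z\<bar> \<le> r / 4)"
    by (rule solution_branch[OF r4])
  obtain C where C: "C > 0" and devb: "\<forall>\<epsilon> u a z \<phi> \<eta>. branch \<epsilon> u a z \<and> follows \<phi> u a \<and>
      (\<forall>t. (\<phi> has_real_derivative deriv \<phi> t) (at t) \<and>
        deriv \<phi> t = 1 / slow (\<phi> t) (disp \<epsilon> u a z (\<phi> t)) \<and>
        (deriv \<phi> has_real_derivative f (\<phi> t) + \<epsilon> * \<gamma> t * h (z0 + disp \<epsilon> u a z (\<phi> t))) (at t)) \<and>
      (\<forall>x. \<bar>u x\<bar> \<le> \<eta>) \<longrightarrow>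
      0 \<le> norm2 (deviation \<psi> a \<phi>) \<and> norm2 (deviation \<psi> a \<phi>) \<le> C * (\<eta> + \<bar>z\<bar> + \<bar>\<epsilon>\<bar>)"
    by (rule branch_deviation_bound)
  define good where "good \<epsilon> \<phi> \<longleftrightarrow> follows \<phi> (apply_bcontfun (U \<epsilon>)) (\<alpha> \<epsilon>) \<and>
      perturbed_solution f h \<gamma> I J d \<epsilon> \<phi> \<and> (\<forall>t. \<phi> (t + P) = \<phi> t + L) \<and>
      0 \<le> norm2 (deviation \<psi> (\<alpha> \<epsilon>) \<phi>) \<and>
      norm2 (deviation \<psi> (\<alpha> \<epsilon>) \<phi>) \<le> C * (norm (U \<epsilon>) + \<bar>\<zeta> \<epsilon>\<bar> + \<bar>\<epsilon>\<bar>)" for \<epsilon> \<phi>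
  have "\<exists>\<phi>. good \<epsilon> \<phi>" if \<epsilon>: "\<bar>\<epsilon>\<bar> < e" for \<epsilon>
  proof -
    obtain \<phi> where \<phi>: "follows \<phi> (apply_bcontfun (U \<epsilon>)) (\<alpha> \<epsilon>)" "perturbed_solution f h \<gamma> I J d \<epsilon> \<phi>"
      "\<forall>t. \<phi> (t + P) = \<phi> t + L"
      and d: "\<forall>t. (\<phi> has_real_derivative deriv \<phi> t) (at t) \<and>
        deriv \<phi> t = 1 / slow (\<phi> t) (disp \<epsilon> (apply_bcontfun (U \<epsilon>)) (\<alpha> \<epsilon>) (\<zeta> \<epsilon>) (\<phi> t)) \<and>
        (deriv \<phi> has_real_derivative f (\<phi> t) +
          \<epsilon> * \<gamma> t * h (z0 + disp \<epsilon> (apply_bcontfun (U \<epsilon>)) (\<alpha> \<epsilon>) (\<zeta> \<epsilon>) (\<phi> t))) (at t)"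
      by (rule branch_solution[OF br[OF \<epsilon>]])
    have "\<forall>x. \<bar>apply_bcontfun (U \<epsilon>) x\<bar> \<le> norm (U \<epsilon>)" by (simp add: bcontfun_real_bound)
    with \<phi>(1) d br[OF \<epsilon>] have "0 \<le> norm2 (deviation \<psi> (\<alpha> \<epsilon>) \<phi>) \<and>
        norm2 (deviation \<psi> (\<alpha> \<epsilon>) \<phi>) \<le> C * (norm (U \<epsilon>) + \<bar>\<zeta> \<epsilon>\<bar> + \<bar>\<epsilon>\<bar>)"
      by (intro devb[rule_format] conjI)
    then show ?thesis unfolding good_def using \<phi> by blast
  qed
  then obtain \<phi> where \<phi>: "\<And>\<epsilon>. \<bar>\<epsilon>\<bar> < e \<Longrightarrow> good \<epsilon> (\<phi> \<epsilon>)" by metis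
  have "isCont \<alpha> 0" using d\<alpha>[of 0] e by (auto intro: has_vector_derivative_continuous)
  then have \<alpha>_lim: "((\<lambda>\<epsilon>. \<bar>\<alpha> \<epsilon> - \<alpha>0\<bar>) \<longlongrightarrow> 0) (at 0)"
    unfolding isCont_def \<alpha>0 by (auto intro!: tendsto_eq_intros)
  have near0: "\<forall>\<^sub>F \<epsilon> in at 0. \<bar>\<epsilon>\<bar> < e"
    unfolding eventually_at using e by (auto intro!: exI[of _ e] simp: dist_real_def)
  have up: "((\<lambda>\<epsilon>. C * (norm (U \<epsilon>) + \<bar>\<zeta> \<epsilon>\<bar> + \<bar>\<epsilon>\<bar>)) \<longlongrightarrow> 0) (at 0)"
    by (intro tendsto_mult_right_zero tendsto_add_zero tendsto_rabs_zero U0 \<zeta>0 tendsto_ident_at)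
  have N_lim: "((\<lambda>\<epsilon>. norm2 (deviation \<psi> (\<alpha> \<epsilon>) (\<phi> \<epsilon>))) \<longlongrightarrow> 0) (at 0)"
    by (rule tendsto_sandwich[OF _ _ tendsto_const up])
      (use near0 \<phi> in \<open>auto simp: good_def elim!: eventually_mono\<close>)
  have "\<forall>\<^sub>F \<epsilon> in at 0. norm2 (deviation \<psi> (\<alpha> \<epsilon>) (\<phi> \<epsilon>)) < \<rho> \<and> \<bar>\<alpha> \<epsilon> - \<alpha>0\<bar> < r / 4 \<and> \<bar>\<epsilon>\<bar> < e"
    using order_tendstoD(2)[OF N_lim \<rho>] order_tendstoD(2)[OF \<alpha>_lim r4] near0
    by (intro eventually_conj)
  then obtain e2 where e2: "e2 > 0" "\<And>\<epsilon>. \<epsilon> \<noteq> 0 \<Longrightarrow> \<bar>\<epsilon>\<bar> < e2 \<Longrightarrow>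
      norm2 (deviation \<psi> (\<alpha> \<epsilon>) (\<phi> \<epsilon>)) < \<rho> \<and> \<bar>\<alpha> \<epsilon> - \<alpha>0\<bar> < r / 4 \<and> \<bar>\<epsilon>\<bar> < e"
    unfolding eventually_at by (auto simp: dist_real_def)
  define \<epsilon>0 where "\<epsilon>0 = min e e2"
  have \<epsilon>0: "\<epsilon>0 > 0" using e e2(1) by (simp add: \<epsilon>0_def)
  have "\<alpha> C1_differentiable_on {-\<epsilon>0<..<\<epsilon>0}"
    unfolding C1_differentiable_on_def
  proof (intro exI[of _ \<alpha>'] conjI ballI)
    show "(\<alpha> has_vector_derivative \<alpha>' x) (at x)" if "x \<in> {-\<epsilon>0<..<\<epsilon>0}" for x
      by (rule d\<alpha>) (use that in \<open>auto simp: \<epsilon>0_def abs_less_iff\<close>)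
    show "continuous_on {-\<epsilon>0<..<\<epsilon>0} \<alpha>'"
      by (rule continuous_on_subset[OF c\<alpha>']) (auto simp: \<epsilon>0_def)
  qed
  moreover have "let near = (\<lambda>a \<phi>. perturbed_solution f h \<gamma> I J d \<epsilon> \<phi> \<and>
          (\<forall>t. \<phi> (t + P) = \<phi> t + L) \<and> norm2 (deviation \<psi> a \<phi>) \<le> \<rho>)
      in near (\<alpha> \<epsilon>) (\<phi> \<epsilon>) \<and> (\<forall>\<phi>'. near (\<alpha> \<epsilon>) \<phi>' \<longrightarrow> \<phi>' = \<phi> \<epsilon>) \<and> \<bar>\<alpha> \<epsilon> - \<alpha>0\<bar> < r / 4 \<and>
         phase_normalized \<psi> P (\<alpha> \<epsilon>) (\<phi> \<epsilon>) \<and>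
         (\<forall>a \<phi>'. \<bar>a - \<alpha>0\<bar> < r / 4 \<and> near a \<phi>' \<and> phase_normalized \<psi> P a \<phi>' \<longrightarrow> a = \<alpha> \<epsilon>)"
    if \<epsilon>: "0 < \<bar>\<epsilon>\<bar> \<and> \<bar>\<epsilon>\<bar> < \<epsilon>0" for \<epsilon>
  proof -
    have \<epsilon>': "\<epsilon> \<noteq> 0" "\<bar>\<epsilon>\<bar> < e" "\<bar>\<epsilon>\<bar> < e2" using \<epsilon> by (auto simp: \<epsilon>0_def)
    have g: "follows (\<phi> \<epsilon>) (apply_bcontfun (U \<epsilon>)) (\<alpha> \<epsilon>)" "perturbed_solution f h \<gamma> I J d \<epsilon> (\<phi> \<epsilon>)"
      "\<phi> \<epsilon> (t + P) = \<phi> \<epsilon> t + L" for t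
      using \<phi>[OF \<epsilon>'(2)] by (auto simp: good_def)
    have sh: "\<forall>t. \<phi> \<epsilon> (t + P) = \<phi> \<epsilon> t + L" using g(3) by blast
    have s: "norm2 (deviation \<psi> (\<alpha> \<epsilon>) (\<phi> \<epsilon>)) < \<rho>" "\<bar>\<alpha> \<epsilon> - \<alpha>0\<bar> < r / 4"
      using e2(2)[OF \<epsilon>'(1,3)] by auto
    have repr: "\<exists>u z. branch \<epsilon> u a z \<and> follows \<phi>' u a \<and> (\<forall>x. \<bar>u x\<bar> \<le> r / 4) \<and> \<bar>z\<bar> \<le> r / 4"
      if "perturbed_solution f h \<gamma> I J d \<epsilon> \<phi>'" "\<forall>t. \<phi>' (t + P) = \<phi>' t + L"
        "norm2 (deviation \<psi> a \<phi>') \<le> \<rho>" for a \<phi>'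
    proof -
      have sh: "\<phi>' (t + P) = \<phi>' t + L" for t using that(2) by blast
      note pw = norm2_deviation_pointwise[OF perturbed_solution_D[OF that(1)] sh that(3)]
      have "\<forall>t. \<phi>' (t + P) = \<phi>' t + L \<and> \<bar>\<phi>' t - \<psi> (t + a)\<bar> \<le> \<rho> \<and> \<bar>deriv \<phi>' t - v (t + a)\<bar> \<le> \<rho>"
        using sh pw by blast
      then show ?thesis using sol \<epsilon>'(1) that(1) by blast
    qed
    have normalized: "phase_normalized \<psi> P a \<phi>' \<longleftrightarrow> centred u"
      if "perturbed_solution f h \<gamma> I J d \<epsilon> \<phi>'" "\<forall>t. \<phi>' (t + P) = \<phi>' t + L" "branch \<epsilon> u a z" "follows \<phi>' u a"
      for a \<phi>' u z
      using phase_normalized_iff_centred[OF perturbed_solution_D[OF that(1)] _ that(4) branch_D(1,2)[OF that(3)]] that(2)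
      by blast
    have "phase_normalized \<psi> P (\<alpha> \<epsilon>) (\<phi> \<epsilon>)"
      using normalized[OF g(2) sh br[OF \<epsilon>'(2)] g(1)] ce[OF \<epsilon>'(2)] by blast
    moreover have "\<phi>' = \<phi> \<epsilon>"
      if n: "perturbed_solution f h \<gamma> I J d \<epsilon> \<phi>'" "\<forall>t. \<phi>' (t + P) = \<phi>' t + L"
        "norm2 (deviation \<psi> (\<alpha> \<epsilon>) \<phi>') \<le> \<rho>" for \<phi>'
    proof -
      obtain u z where u: "branch \<epsilon> u (\<alpha> \<epsilon>) z" "follows \<phi>' u (\<alpha> \<epsilon>)" "\<And>x. \<bar>u x\<bar> \<le> r / 4" "\<bar>z\<bar> \<le> r / 4"
        using repr[OF n] by blast
      obtain k where k: "\<bar>k\<bar> \<le> r / 4" "branch \<epsilon> (\<lambda>x. u x + k) (\<alpha> \<epsilon> + k) z" "centred (\<lambda>x. u x + k)"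
        using recentre[OF u(1,3)] by blast
      have b1: "\<bar>u x + k\<bar> \<le> r" for x using u(3)[of x] k(1) r by linarith
      have b2: "\<bar>\<alpha> \<epsilon> + k - \<alpha>0\<bar> \<le> r" "\<bar>z\<bar> \<le> r" using s(2) k(1) u(4) r by linarith+
      \<comment> \<open>Uniqueness identifies the recentred data with those of the curve; equality
        of the phases then gives \<open>k = 0\<close>.\<close>
      have "(\<lambda>x. u x + k) = apply_bcontfun (U \<epsilon>) \<and> \<alpha> \<epsilon> + k = \<alpha> \<epsilon>"
        by (rule un[rule_format, of \<epsilon> "\<lambda>x. u x + k" "\<alpha> \<epsilon> + k" z])
          (intro conjI allI \<epsilon>'(2) b1 b2 k(2,3))
      then have "u = apply_bcontfun (U \<epsilon>)" by auto
      then show ?thesis using follows_unique u(2) g(1) by blast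
    qed
    moreover have "a = \<alpha> \<epsilon>"
      if a: "\<bar>a - \<alpha>0\<bar> < r / 4" and n: "perturbed_solution f h \<gamma> I J d \<epsilon> \<phi>'" "\<forall>t. \<phi>' (t + P) = \<phi>' t + L"
        "norm2 (deviation \<psi> a \<phi>') \<le> \<rho>" and pn: "phase_normalized \<psi> P a \<phi>'" for a \<phi>'
    proof -
      obtain u z where u: "branch \<epsilon> u a z" "follows \<phi>' u a" "\<And>x. \<bar>u x\<bar> \<le> r / 4" "\<bar>z\<bar> \<le> r / 4"
        using repr[OF n] by blast
      have b1: "\<bar>u x\<bar> \<le> r" for x using u(3)[of x] r by linarith
      have b2: "\<bar>a - \<alpha>0\<bar> \<le> r" "\<bar>z\<bar> \<le> r" using a u(4) r by linarith+
      show ?thesis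
        using un \<epsilon>'(2) b1 b2 u(1) normalized[OF n(1,2) u(1,2)] pn by blast
    qed
    ultimately show ?thesis
      unfolding Let_def using g(2,3) s by (blast intro: less_imp_le)
  qed
  ultimately show ?thesis using \<rho> r4 \<epsilon>0 \<alpha>_lim N_lim by blast
qed

end


section \<open>The Melnikov function as an integral over the angle\<close>

lemma primitive_translate_deriv:
  assumes g: "C2 g" "\<And>x. \<bar>deriv (deriv g) x\<bar> \<le> B" and s: "continuous_on UNIV s" and L: "L > 0"
  shows "((\<lambda>\<alpha>. primitive (\<lambda>x. g (s x - \<alpha>)) L) has_real_derivative
    - primitive (\<lambda>x. deriv g (s x - a)) L) (at a)"
proof -
  let ?M = "\<lambda>\<alpha>. primitive (\<lambda>x. g (s x - \<alpha>)) L" and ?D = "primitive (\<lambda>x. deriv g (s x - a)) L"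
  have cg: "continuous_on UNIV (\<lambda>x. g (s x - \<alpha>))" "continuous_on UNIV (\<lambda>x. deriv g (s x - \<alpha>))" for \<alpha>
    using C2_D(3,4)[OF g(1)] s by (auto intro!: continuous_intros continuous_on_compose2[of UNIV g] continuous_on_compose2[of UNIV "deriv g"])
  \<comment> \<open>Differentiation under the integral by a Taylor remainder uniform in
    \<open>x\<close>: after division by \<open>b - a\<close> it is still of first order. The minus
    sign comes from \<open>s x - \<alpha>\<close>.\<close>
  have quad: "\<bar>?M b - ?M a - (b - a) * (- ?D)\<bar> \<le> (B * (b - a)\<^sup>2) * L" for b
  proof -
    have "\<bar>primitive (\<lambda>x. g (s x - b) - g (s x - a) - (a - b) * deriv g (s x - a)) L\<bar> \<le> (B * (b - a)\<^sup>2) * L"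
    proof (rule primitive_bound)
      show "continuous_on UNIV (\<lambda>x. g (s x - b) - g (s x - a) - (a - b) * deriv g (s x - a))"
        by (intro continuous_intros cg)
      show "\<bar>g (s x - b) - g (s x - a) - (a - b) * deriv g (s x - a)\<bar> \<le> B * (b - a)\<^sup>2" for x
        using quadratic_remainder_bound(1)[of UNIV "s x - a" "s x - b" g "deriv g" "deriv (deriv g)" B] C2_D(1,2)[OF g(1)] g(2)
        by (simp add: power2_commute mult.commute)
    qed (use L in simp)
    also have "primitive (\<lambda>x. g (s x - b) - g (s x - a) - (a - b) * deriv g (s x - a)) L = ?M b - ?M a - (a - b) * ?D"
      by (simp only: primitive_diff[OF continuous_on_diff[OF cg(1) cg(1)] continuous_on_mult_left[OF cg(2)]]
          primitive_diff[OF cg(1) cg(1)] primitive_cmult[OF cg(2)])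
    finally show ?thesis by (simp add: algebra_simps)
  qed
  show ?thesis
    unfolding has_field_derivative_iff
  proof (rule Lim_null[THEN iffD2], rule Lim_null_comparison)
    show "((\<lambda>b. B * L * \<bar>b - a\<bar>) \<longlongrightarrow> 0) (at a)" by (auto intro!: tendsto_eq_intros)
    show "\<forall>\<^sub>F b in at a. norm ((?M b - ?M a) / (b - a) - - ?D) \<le> B * L * \<bar>b - a\<bar>"
      unfolding eventually_at_filter
    proof (intro always_eventually allI impI)
      fix b assume ne: "b \<noteq> a"
      then have "(?M b - ?M a) / (b - a) - - ?D = (?M b - ?M a - (b - a) * (- ?D)) / (b - a)"
        by (simp add: field_simps)
      then have "norm ((?M b - ?M a) / (b - a) - - ?D) \<le> (B * (b - a)\<^sup>2) * L / \<bar>b - a\<bar>"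
        using divide_right_mono[OF quad[of b], of "\<bar>b - a\<bar>"] by simp
      also have "(B * (b - a)\<^sup>2) * L / \<bar>b - a\<bar> = B * L * \<bar>b - a\<bar>"
        using ne by (simp add: power2_eq_square abs_if field_simps)
      finally show "norm ((?M b - ?M a) / (b - a) - - ?D) \<le> B * L * \<bar>b - a\<bar>" .
    qed
  qed
qed

text \<open>The substitution is \<open>x = \<psi> (t + \<alpha>)\<close>, so that
  \<open>t = s0 x - \<alpha>\<close>. It leads to the interval from \<open>\<psi> \<alpha>\<close>
  to \<open>\<psi> \<alpha> + L\<close>, and periodicity of the integrand moves this interval to
  \<open>[0, L]\<close>, removing \<alpha> from the endpoints.\<close>

lemma melnikov_eq_primitive:
  assumes \<psi>: "\<And>t. (\<psi> has_real_derivative v t) (at t)" "continuous_on UNIV v"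
    and sh: "\<And>t. \<psi> (t + P) = \<psi> t + L"
    and s0: "\<And>t. s0 (\<psi> t) = t" "\<And>x. s0 (x + L) = s0 x + P" "continuous_on UNIV s0"
    and g: "continuous_on UNIV g" "periodic P g"
  shows "melnikov \<psi> g P \<alpha> = primitive (\<lambda>x. g (s0 x - \<alpha>)) L"
proof -
  have "deriv \<psi> = v" using \<psi>(1) by (auto intro: DERIV_imp_deriv)
  then have "melnikov \<psi> g P \<alpha> = primitive (\<lambda>t. v (t + \<alpha>) * g t) P"
    by (simp add: melnikov_def primitive_def)
  also have "(\<lambda>t. v (t + \<alpha>) * g t) = (\<lambda>t. g (s0 (\<psi> (t + \<alpha>)) - \<alpha>) * v (t + \<alpha>))"
    by (simp add: s0(1) mult.commute)
  also have "primitive \<dots> P = primitive (\<lambda>x. g (s0 x - \<alpha>)) (\<psi> (P + \<alpha>)) - primitive (\<lambda>x. g (s0 x - \<alpha>)) (\<psi> (0 + \<alpha>))"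
  proof (rule primitive_substitution)
    show "continuous_on UNIV (\<lambda>x. g (s0 x - \<alpha>))"
      by (rule continuous_on_compose2[OF g(1)]) (auto intro!: continuous_intros s0(3))
    show "((\<lambda>t. \<psi> (t + \<alpha>)) has_real_derivative v (t + \<alpha>)) (at t)" for t
      using DERIV_shift[THEN iffD1, OF \<psi>(1)] .
    show "continuous_on UNIV (\<lambda>t. v (t + \<alpha>))"
      by (rule continuous_on_compose2[OF \<psi>(2)]) (auto intro!: continuous_intros)
  qed
  also have "\<psi> (P + \<alpha>) = \<psi> \<alpha> + L" using sh[of \<alpha>] by (simp add: add.commute)
  also have "primitive (\<lambda>x. g (s0 x - \<alpha>)) (\<psi> \<alpha> + L) =
      primitive (\<lambda>x. g (s0 x - \<alpha>)) (\<psi> \<alpha>) + primitive (\<lambda>x. g (s0 x - \<alpha>)) L"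
  proof (rule primitive_periodic)
    show "continuous_on UNIV (\<lambda>x. g (s0 x - \<alpha>))"
      by (rule continuous_on_compose2[OF g(1)]) (auto intro!: continuous_intros s0(3))
    have "s0 (x + L) - \<alpha> = (s0 x - \<alpha>) + P" for x by (simp add: s0(2))
    then show "periodic L (\<lambda>x. g (s0 x - \<alpha>))" using g(2) by (simp only: periodic_def simp_thms)
  qed
  finally show ?thesis by simp
qed

section \<open>Reduction of the hypotheses to the angle setting\<close>

theorem theorem2:
  fixes f h \<gamma> :: "real \<Rightarrow> real"
    and d c \<alpha>\<^sub>0 lam :: real
    and I J \<Lambda> :: "real set"
    and \<psi>\<^sub>0 :: "real \<Rightarrow> real \<Rightarrow> real" and T\<^sub>0 :: "real \<Rightarrow> real"
    and p q :: nat
  assumes "C2 f" and "C2 h" and "C2 \<gamma>" and "periodic 1 \<gamma>"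
    and C1: "open I" "is_interval I" "open J" "is_interval J"
            "diffeo_on (primitive h) I J" "\<forall>z\<in>I. h z \<noteq> 0"
    and C2: "periodic (2 * pi) f" "periodic (2 * pi) (primitive f)"
    and H3: "\<forall>\<mu>\<in>\<Lambda>. nondegenerate_shift_solution f (T\<^sub>0 \<mu>) (\<psi>\<^sub>0 \<mu>)"
    and lam: "lam \<in> \<Lambda>"
    and R': "p > 0" "q > 0" "T\<^sub>0 lam = real p / real q"
    and H2': "\<forall>t. energy f (\<psi>\<^sub>0 lam) t = c" "c - d \<in> J"
    and melnikov: "simple_zero (melnikov (\<psi>\<^sub>0 lam) \<gamma> (real p)) \<alpha>\<^sub>0"
  shows "\<exists>\<rho>>0. \<exists>\<delta>>0. \<exists>\<epsilon>\<^sub>0>0. \<exists>(\<alpha> :: real \<Rightarrow> real) (\<psi> :: real \<Rightarrow> real \<Rightarrow> real).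
     \<alpha> C1_differentiable_on {-\<epsilon>\<^sub>0<..<\<epsilon>\<^sub>0} \<and>
     ((\<lambda>\<epsilon>. \<bar>\<alpha> \<epsilon> - \<alpha>\<^sub>0\<bar>) \<longlongrightarrow> 0) (at 0) \<and>
     (\<forall>\<epsilon>. 0 < \<bar>\<epsilon>\<bar> \<and> \<bar>\<epsilon>\<bar> < \<epsilon>\<^sub>0 \<longrightarrow>
        (let near = (\<lambda>a \<phi>. perturbed_solution f h \<gamma> I J d \<epsilon> \<phi> \<and>
                           shift_periodic q (real p) \<phi> \<and>
                           norm2 (deviation (\<psi>\<^sub>0 lam) a \<phi>) \<le> \<rho>)
         in near (\<alpha> \<epsilon>) (\<psi> \<epsilon>) \<and>
            (\<forall>\<phi>. near (\<alpha> \<epsilon>) \<phi> \<longrightarrow> \<phi> = \<psi> \<epsilon>) \<and>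
            \<bar>\<alpha> \<epsilon> - \<alpha>\<^sub>0\<bar> < \<delta> \<and>
            phase_normalized (\<psi>\<^sub>0 lam) (real p) (\<alpha> \<epsilon>) (\<psi> \<epsilon>) \<and>
            (\<forall>a \<phi>. \<bar>a - \<alpha>\<^sub>0\<bar> < \<delta> \<and> near a \<phi> \<and> phase_normalized (\<psi>\<^sub>0 lam) (real p) a \<phi>
                    \<longrightarrow> a = \<alpha> \<epsilon>))) \<and>
     ((\<lambda>\<epsilon>. norm2 (deviation (\<psi>\<^sub>0 lam) (\<alpha> \<epsilon>) (\<psi> \<epsilon>))) \<longlongrightarrow> 0) (at 0)"
proof -
  note f = \<open>C2 f\<close> and h = \<open>C2 h\<close> and \<gamma> = \<open>C2 \<gamma>\<close> and per_\<gamma>1 = \<open>periodic 1 \<gamma>\<close>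
  define \<psi> where "\<psi> = \<psi>\<^sub>0 lam"
  define v where "v = deriv \<psi>"
  define L P where "L = 2 * pi * real q" and "P = real p"
  let ?F = "primitive f" and ?H = "primitive h"
  have L: "L > 0" and P: "P > 0" using R' by (auto simp: L_def P_def)
  have "nondegenerate_shift_solution f (T\<^sub>0 lam) \<psi>" using H3 lam by (simp add: \<psi>_def)
  then have sol: "solves2 (\<lambda>t x y. f x) \<psi>" and sh1: "shift_periodic 1 (T\<^sub>0 lam) \<psi>"
    by (auto simp: nondegenerate_shift_solution_def)
  have d\<psi>: "(\<psi> has_real_derivative v t) (at t)" and dv: "(v has_real_derivative f (\<psi> t)) (at t)" for t
    using sol unfolding solves2_def v_def by (meson DERIV_deriv_iff_real_differentiable)+
  have cv: "continuous_on UNIV v" using dv by (meson DERIV_isCont continuous_at_imp_continuous_on)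
  have sh: "\<psi> (t + P) = \<psi> t + L" for t
    using shift_of_nat[of \<psi> "T\<^sub>0 lam" "2 * pi" t q] sh1 R' by (simp add: shift_periodic_def L_def P_def mult.commute)
  have en: "(v t)\<^sup>2 / 2 - ?F (\<psi> t) = c" for t
    using H2'(1) by (simp add: energy_def v_def \<psi>_def)
  have cf: "continuous_on UNIV f" and ch: "continuous_on UNIV h" using C2_D(3) f h by blast+
  obtain B where B: "B \<ge> 0" "\<And>x. \<bar>deriv f x\<bar> \<le> B"
    using periodic_continuous_bounded[OF periodic_derivative[OF C2(1) C2_D(1)[OF f]] _ C2_D(4)[OF f]] by auto
  have v_pos: "v t > 0" for t
    using rotation_velocity_pos[OF primitive_has_derivative[OF cf]
        lipschitz_of_derivative_bound[OF C2_D(1)[OF f] B(2)] d\<psi> DERIV_isCont[OF dv] en sh P L] .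
  obtain s0 where s0: "\<And>t. s0 (\<psi> t) = t" "\<And>x. \<psi> (s0 x) = x" "\<And>x. s0 (x + L) = s0 x + P"
    "\<And>x. (s0 has_real_derivative 1 / v (s0 x)) (at x)"
    using shift_inverse[OF d\<psi> v_pos sh P L] by blast
  have cs0: "continuous_on UNIV s0" using s0(4) by (meson DERIV_isCont continuous_at_imp_continuous_on)
  have per_\<gamma>: "periodic P \<gamma>"
    using periodic_of_int[OF per_\<gamma>1, of _ "int p"] by (simp add: periodic_def P_def)
  have perL: "periodic L g" if "periodic (2 * pi) g" for g
    using periodic_of_int[OF that, of _ "int q"] by (simp add: periodic_def L_def mult.commute)
  have per_v: "periodic P v"
  proof -
    \<comment> \<open>Removing the mean rotation leaves a periodic function, and its derivative
      differs from \<open>v\<close> by a constant.\<close>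
    have "periodic P (\<lambda>t. \<psi> t - t * L / P)"
      using P by (simp add: periodic_def sh add_divide_distrib distrib_right)
    moreover have "((\<lambda>t. \<psi> t - t * L / P) has_real_derivative v t - L / P) (at t)" for t
      using P by (auto intro!: derivative_eq_intros d\<psi>)
    ultimately have "periodic P (\<lambda>t. v t - L / P)" by (rule periodic_derivative)
    then show ?thesis by (simp add: periodic_def)
  qed
  have "\<exists>vm>0. \<forall>t. vm \<le> v t"
  proof (rule periodic_continuous_range[OF per_v P cv])
    fix tm assume "\<And>t. v tm \<le> v t"
    then show ?thesis using v_pos[of tm] by blast
  qed
  then obtain vm where vm: "vm > 0" "\<And>t. vm \<le> v t" by blast
  \<comment> \<open>Since \<open>\<psi>\<close> passes through every angle,
    \<open>F + c = v\<^sup>2 / 2\<close> is everywhere at least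
    \<open>vm\<^sup>2 / 2 = 2 * m\<close>. Half of this margin is reserved for the variation of
    \<open>H\<close>, which \<open>R1\<close> limits to \<open>m\<close>.\<close>
  define m where "m = vm\<^sup>2 / 4"
  have m: "m > 0" using vm(1) by (simp add: m_def)
  have F_ge: "2 * m \<le> ?F x + c" for x
    using en[of "s0 x"] power_mono[OF vm(2)[of "s0 x"], of 2] vm(1) by (simp add: s0(2) m_def)
  have bij: "bij_betw ?H I J" using C1(5) by (simp add: diffeo_on_def)
  define z0 where "z0 = inv_into I ?H (c - d)"
  have z0: "z0 \<in> I" "?H z0 = c - d"
    using bij_betwE[OF bij_betw_inv_into[OF bij]] H2'(2) bij_betw_inv_into_right[OF bij H2'(2)]
    by (auto simp: z0_def)
  have DH: "(?H has_real_derivative h z) (at z)" for z by (rule primitive_has_derivative[OF ch])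
  obtain R1 where R1: "R1 > 0" "\<And>z. \<bar>z - z0\<bar> \<le> R1 \<Longrightarrow> z \<in> I" "\<And>z. \<bar>z - z0\<bar> \<le> R1 \<Longrightarrow> \<bar>?H z - ?H z0\<bar> \<le> m"
  proof -
    obtain e1 where e1: "e1 > 0" "cball z0 e1 \<subseteq> I"
      using C1(1) z0(1) open_contains_cball by blast
    have "isCont ?H z0" by (rule DERIV_isCont[OF DH])
    then obtain e2 where e2: "e2 > 0" "\<forall>z. dist z z0 < e2 \<longrightarrow> dist (?H z) (?H z0) < m"
      unfolding continuous_at_eps_delta using m by blast
    show ?thesis
    proof (rule that[of "min e1 (e2 / 2)"])
      show "z \<in> I" if "\<bar>z - z0\<bar> \<le> min e1 (e2 / 2)" for z
        using e1(2) that by (auto simp: subset_iff dist_real_def abs_minus_commute)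
      show "\<bar>?H z - ?H z0\<bar> \<le> m" if "\<bar>z - z0\<bar> \<le> min e1 (e2 / 2)" for z
      proof -
        have "dist z z0 < e2" using e2(1) that by (simp add: dist_real_def)
        then have "dist (?H z) (?H z0) < m" using e2(2) by blast
        then show ?thesis by (simp add: dist_real_def)
      qed
    qed (use e1 e2 in auto)
  qed
  have m_le: "m \<le> ?F x + d + ?H (z0 + w)" if "\<bar>w\<bar> \<le> R1" for x w
    using R1(3)[of "z0 + w"] F_ge[of x] z0(2) that by simp
  have inv_deriv: "(inv_into I ?H has_real_derivative 1 / h (inv_into I ?H y)) (at y)" if y: "y \<in> J" for y
  proof -
    obtain e where e: "e > 0" "ball y e \<subseteq> J" using C1(3) y open_contains_ball by blast
    have inI: "inv_into I ?H y \<in> I" using bij_betwE[OF bij_betw_inv_into[OF bij]] y by blast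
    have "isCont (inv_into I ?H) y"
      using C1(5) y by (auto simp: diffeo_on_def C1_differentiable_on_def intro: has_vector_derivative_continuous)
    then have "(inv_into I ?H has_real_derivative inverse (h (inv_into I ?H y))) (at y)"
    proof (intro DERIV_inverse_function[OF DH, of _ _ "y - e" "y + e"])
      show "?H (inv_into I ?H w) = w" if "y - e < w" "w < y + e" for w
        by (rule bij_betw_inv_into_right[OF bij]) (use e that in \<open>auto simp: subset_iff dist_real_def\<close>)
    qed (use e C1(6) inI in auto)
    then show ?thesis by (simp add: inverse_eq_divide)
  qed
  have mel_eq: "melnikov \<psi> \<gamma> P = (\<lambda>\<alpha>. primitive (\<lambda>x. \<gamma> (s0 x - \<alpha>)) L)"
    using melnikov_eq_primitive[OF d\<psi> cv sh s0(1,3) cs0 C2_D(3)[OF \<gamma>] per_\<gamma>] by blast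
  obtain D where D: "(melnikov \<psi> \<gamma> P has_real_derivative D) (at \<alpha>\<^sub>0)" "D \<noteq> 0" "melnikov \<psi> \<gamma> P \<alpha>\<^sub>0 = 0"
    using melnikov by (auto simp: simple_zero_def \<psi>_def P_def)
  obtain B2 where B2: "B2 \<ge> 0" "\<And>x. \<bar>deriv (deriv \<gamma>) x\<bar> \<le> B2"
    using periodic_continuous_bounded[OF periodic_derivative[OF
          periodic_derivative[OF per_\<gamma> C2_D(1)[OF \<gamma>]] C2_D(2)[OF \<gamma>]] P C2_D(5)[OF \<gamma>]] by auto
  \<comment> \<open>In angle form the derivative of the Melnikov function is minus this integral, so
    simplicity of the zero becomes its nonvanishing.\<close>
  have "D = - primitive (\<lambda>x. deriv \<gamma> (s0 x - \<alpha>\<^sub>0)) L"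
    using DERIV_unique[OF D(1)[unfolded mel_eq] primitive_translate_deriv[OF \<gamma> B2(2) cs0 L]] .
  then have simple: "primitive (\<lambda>x. deriv \<gamma> (s0 x - \<alpha>\<^sub>0)) L \<noteq> 0" using D(2) by simp
  interpret rotator f h \<gamma> \<psi> v s0 I J d c z0 \<alpha>\<^sub>0 L P R1 m
    by unfold_locales
      (use L P f h \<gamma> per_\<gamma> perL C2 d\<psi> dv v_pos en sh s0 R1 m m_le z0 C1(6) bij inv_deriv D(3) mel_eq simple in auto)
  have eq: "shift_periodic q P \<phi> \<longleftrightarrow> (\<forall>t. \<phi> (t + P) = \<phi> t + L)" for \<phi>
    by (simp add: shift_periodic_def L_def P_def)
  show ?thesis
    unfolding P_def[symmetric] \<psi>_def[symmetric] eq by (rule melnikov_continuation)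
qed

end
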